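(* Let $d=2$ and $K_0(r)=r^{-2}$. Then there is $c_0>0$ such that if $|\lambda-\frac12|<c_0$, then the (minimal) energy of equally distributed stripes with volume fraction $\lambda$ is strictly smaller than the energy of periodic ball configurations with volume fraction $\lambda$; that is, $e_S(\lambda)<e_{B,\Lambda_0}(\lambda)$ for every Bravais lattice $\Lambda_0\subset\mathbb R^2$ with $|\Lambda_0|=1$ (with $c_0$ independent of $\Lambda_0$).
   Context: A Bravais lattice in $\mathbb R^2$ is $\Lambda=\mathbb Zv_1\oplus\mathbb Zv_2$ with $v_1,v_2$ linearly independent; $|\Lambda|$ denotes the area of its periodicity cell. Energy: for periodic $u:\mathbb R^2\to\{0,1\}$ (locally of bounded variation) let $C_u(z)=\lim_{R\to\infty}\frac1{|[-R,R]^2|}\int_{[-R,R]^2}u(x+z)u(x)\,dx$, and $$\mathcal E_0^{(1)}(u)=\int_{\mathbb R^2}\frac{C_u(z)-C_u(0)-z\cdot\nabla C_u(0)\,\chi_{B_1}(z)}{|z|}\,|z|^{-2}\,dz,$$ where $z\cdot\nabla C_u(0)$ denotes the one-sided directional derivative $\lim_{t\to0+}\frac{C_u(tz)-C_u(0)}{t}$, and the integral is computed in polar coordinates, integrating over angles first. Stripes: for $d_0,d_1>0$, $a=d_0+d_1$, let $\Omega=\bigcup_{j\in\mathbb Z}(ja,ja+d_0)\times\mathbb R$, with volume fraction $\lambda=d_0/(d_0+d_1)$. $e_S(\lambda)$ is the minimum of $\mathcal E_0^{(1)}(\chi_\Omega)$ over all such stripe configurations with volume fraction $\lambda$. Balls: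 for a Bravais lattice $\Lambda$ and $0<\rho\le\frac12\min\{|p-q|:p,q\in\Lambda,\ p\ne q\}$, let $\Omega=\bigcup_{q\in\Lambda}B_\rho(q)$, with volume fraction $\lambda=|B_\rho|/|\Lambda|$. $e_{B,\Lambda_0}(\lambda)$ is the minimum of $\mathcal E_0^{(1)}(\chi_\Omega)$ over all such configurations with $\Lambda=a\Lambda_0$, $a>0$, and volume fraction $\lambda$; $e_{B,\Lambda_0}(\lambda)=+\infty$ if $\lambda$ is not attainable by such configurations on $\Lambda_0$. *)

theory Defs
  imports "HOL-Analysis.Analysis"
begin

section \<open>Bravais lattices\<close>

(* v \<noteq> w is not redundant: {v, w} collapses to a singleton, which may be independent, if v = w. *)
definition lattice_basis :: "(real^2) set \<Rightarrow> real^2 \<Rightarrow> real^2 \<Rightarrow> bool" where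
  "lattice_basis \<Lambda> v w \<longleftrightarrow>
     v \<noteq> w \<and> independent {v, w} \<and>
     \<Lambda> = {of_int m *\<^sub>R v + of_int n *\<^sub>R w | m n :: int. True}"

definition bravais_lattice :: "(real^2) set \<Rightarrow> bool" where
  "bravais_lattice \<Lambda> \<longleftrightarrow> (\<exists>v w. lattice_basis \<Lambda> v w)"

definition periodicity_cell :: "real^2 \<Rightarrow> real^2 \<Rightarrow> (real^2) set" where
  "periodicity_cell v w = {s *\<^sub>R v + t *\<^sub>R w | s t. 0 \<le> s \<and> s < 1 \<and> 0 \<le> t \<and> t < 1}"

(* All bases of one lattice differ by integer matrices of determinant 1 or -1, so the cell area
   depends on the lattice only. *)
definition cell_area :: "(real^2) set \<Rightarrow> real" where
  "cell_area \<Lambda> = (THE A. \<exists>v w. lattice_basis \<Lambda> v w \<and> A = measure lborel (periodicity_cell v w))"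


section \<open>The energy\<close>

definition autocorrelation :: "(real^2 \<Rightarrow> real) \<Rightarrow> real^2 \<Rightarrow> real" where
  "autocorrelation u z =
     Lim at_top (\<lambda>R. (LINT x:cbox (vec (- R)) (vec R)|lborel. u (x + z) * u x)
                       / measure lborel (cbox (vec (- R)) (vec R) :: (real^2) set))"

definition one_sided_deriv0 :: "(real^2 \<Rightarrow> real) \<Rightarrow> real^2 \<Rightarrow> real" where
  "one_sided_deriv0 f z = Lim (at_right 0) (\<lambda>t. (f (t *\<^sub>R z) - f 0) / t)"

definition K0 :: "real \<Rightarrow> real" where
  "K0 r = r powi (-2)"

definition energy_integrand :: "(real^2 \<Rightarrow> real) \<Rightarrow> real^2 \<Rightarrow> real" where
  "energy_integrand u z =
     (let C = autocorrelation u in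
      (C z - C 0 - one_sided_deriv0 C z * indicator (ball 0 1) z) / norm z * K0 (norm z))"

definition polar :: "real \<Rightarrow> real \<Rightarrow> real^2" where
  "polar r \<theta> = vector [r * cos \<theta>, r * sin \<theta>]"

(* Integral of the positive part minus integral of the negative part. It is meaningful as soon as
   one of the two is finite, and then agrees with the Bochner integral for integrable f. *)
definition extended_integral :: "'a measure \<Rightarrow> ('a \<Rightarrow> real) \<Rightarrow> ereal" where
  "extended_integral M f =
     enn2ereal (\<integral>\<^sup>+ x. ennreal (f x) \<partial>M) - enn2ereal (\<integral>\<^sup>+ x. ennreal (- f x) \<partial>M)"

(* The planar integral in polar coordinates, dz = r d\<theta> dr, angles first. For periodic u with
   values in {0, 1}, locally of bounded variation, the angular integral is nonnegative for r < 1
   and bounded by a multiple of r powi (-3) for r \<ge> 1, so the radial integral is well defined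
   with value in (-\<infinity>, \<infinity>]. *)
definition energy :: "(real^2 \<Rightarrow> real) \<Rightarrow> ereal" where
  "energy u =
     extended_integral (restrict_space lborel {0<..})
       (\<lambda>r. (LINT \<theta>:{0..2 * pi}|lborel. energy_integrand u (polar r \<theta>)) * r)"


section \<open>Stripes and balls\<close>

text \<open>Below, \<open>vf\<close> is the volume fraction.\<close>

definition stripes :: "real \<Rightarrow> real \<Rightarrow> (real^2) set" where
  "stripes d0 d1 =
     (\<Union>j::int. {x. of_int j * (d0 + d1) < x $ 1 \<and> x $ 1 < of_int j * (d0 + d1) + d0})"

(* LEAST is the minimum proper: it is unspecified, rather than an infimum, if none is attained. *)
definition e_S :: "real \<Rightarrow> ereal" where
  "e_S vf = (LEAST e. \<exists>d0 d1. 0 < d0 \<and> 0 < d1 \<and> vf = d0 / (d0 + d1) \<and>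
                        e = energy (indicat_real (stripes d0 d1)))"

definition balls :: "(real^2) set \<Rightarrow> real \<Rightarrow> (real^2) set" where
  "balls \<Lambda> \<rho> = (\<Union>q\<in>\<Lambda>. ball q \<rho>)"

definition admissible_radius :: "(real^2) set \<Rightarrow> real \<Rightarrow> bool" where
  "admissible_radius \<Lambda> \<rho> \<longleftrightarrow>
     0 < \<rho> \<and> (\<forall>p\<in>\<Lambda>. \<forall>q\<in>\<Lambda>. p \<noteq> q \<longrightarrow> \<rho> \<le> dist p q / 2)"

definition ball_energies :: "(real^2) set \<Rightarrow> real \<Rightarrow> ereal set" where
  "ball_energies \<Lambda>0 vf =
     {energy (indicat_real (balls \<Lambda> \<rho>)) | \<Lambda> \<rho>.
        (\<exists>a>0. \<Lambda> = (\<lambda>x. a *\<^sub>R x) ` \<Lambda>0) \<and> admissible_radius \<Lambda> \<rho> \<and>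
        vf = measure lborel (ball 0 \<rho> :: (real^2) set) / cell_area \<Lambda>}"

definition e_B :: "(real^2) set \<Rightarrow> real \<Rightarrow> ereal" where
  "e_B \<Lambda>0 vf =
     (if ball_energies \<Lambda>0 vf = {} then \<infinity> else (LEAST e. e \<in> ball_energies \<Lambda>0 vf))"

end

theory Submission
  imports Defs
begin

text \<open>A scaling by \<open>s\<close> multiplies the energy by \<open>1/s\<close> up to a term in \<open>ln s / s\<close> whose coefficient \<open>d\<close> is the
  perimeter term of the configuration, so the minimum over all scalings is \<open>- d * exp (- 1 - (J - K) / d)\<close>, where
  \<open>J\<close> is a renormalized energy of the unscaled configuration. For stripes \<open>J\<close> is computed from the product
  formula of the sine, which gives \<open>e_S vf \<le> - 2 e / \<pi> * sin (\<pi> vf)\<close>. For balls \<open>J\<close> splits into an explicit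
  self-interaction and the interaction \<open>G\<close> of different balls. The latter is bounded from below uniformly in the
  lattice: \<open>|z| powi (-3)\<close> is a superposition of autocorrelations of discs \<open>D\<close>, and integrating the autocorrelation
  of the configuration against that of \<open>D\<close> gives the mean square of the area of the configuration in translates
  of \<open>D\<close>, which is at least the square of the mean. The resulting bounds are continuous in the volume fraction
  and are strictly ordered at \<open>1/2\<close>.\<close>

section \<open>Integration in the plane\<close>

text \<open>What shapes the proof is how close the two energies are. At volume fraction
  \<open>1/2\<close> stripes win as soon as the interaction \<open>G\<close> contributes more than
  about 2.129 to the renormalized energy of balls. The plain mean-square inequality, with discs of
  radius at least \<open>2/5\<close>, yields only about 2.086. It is therefore applied not to the
  area of the configuration in a disc but to that area minus \<open>\<epsilon>\<close> times the
  indicator function \<open>u\<close> of the configuration. The new cross term is the integral of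
  the autocorrelation over the disc, and this is bounded below by the central peak, that is, by the
  overlap of a ball with itself, the one part of the autocorrelation that is explicit for every
  lattice. With \<open>\<epsilon> = 3/20\<close> on the smaller discs the bound rises to about
  2.149. Because so little is to spare, the overlap of two discs is approximated on both sides by
  polynomials with tuned coefficients, and its moments are computed exactly. For stripes an upper
  bound of the energy is enough, so their correlation is only estimated from above.\<close>

lemma vector_2_eq: "(vector [x, y] :: real^2) = x *\<^sub>R axis 1 1 + y *\<^sub>R axis 2 1"
  by (simp add: vec_eq_iff forall_2 axis_def)

lemma Basis_vec2: "(Basis :: (real^2) set) = {axis 1 1, axis 2 1}"
  by (auto simp: Basis_vec_def UNIV_2)

lemma axis_neq_vec2: "(axis 1 1 :: real^2) \<noteq> axis 2 1"
  by (simp add: axis_eq_axis)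

lemma norm_vec2: "norm (z :: real^2) = sqrt ((z $ 1)\<^sup>2 + (z $ 2)\<^sup>2)"
  by (simp add: norm_vec_def L2_set_def sum_2)

lemma borel_measurable_nth2 [measurable (raw)]:
  "f \<in> borel_measurable M \<Longrightarrow> (\<lambda>x. (f x :: real^2) $ i) \<in> borel_measurable M"
  by (erule measurable_compose) (intro borel_measurable_continuous_onI continuous_intros)

lemma borel_measurable_sin_cos [measurable (raw)]:
  fixes f :: "'a \<Rightarrow> real"
  assumes "f \<in> borel_measurable M"
  shows "(\<lambda>x. sin (f x)) \<in> borel_measurable M" "(\<lambda>x. cos (f x)) \<in> borel_measurable M"
  by (rule measurable_compose[OF assms], intro borel_measurable_continuous_onI continuous_intros)+

lemma borel_measurable_vector_2 [measurable (raw)]: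
  "f \<in> borel_measurable M \<Longrightarrow> g \<in> borel_measurable M \<Longrightarrow>
    (\<lambda>x. vector [f x, g x] :: real^2) \<in> borel_measurable M"
  unfolding vector_2_eq
  by (intro borel_measurable_add borel_measurable_scaleR borel_measurable_const)

text \<open>Both measures agree on boxes, which determine \<open>lborel\<close>. This opens the
  plane to iterated integrals over two real variables.\<close>

lemma lborel_vec2:
  "(lborel :: (real^2) measure) = distr (lborel \<Otimes>\<^sub>M lborel) borel (\<lambda>(x, y). vector [x, y])"
proof (rule lborel_eqI)
  fix l u :: "real^2" assume le: "\<And>b. b \<in> Basis \<Longrightarrow> l \<bullet> b \<le> u \<bullet> b"
  have le1: "l $ 1 \<le> u $ 1" "l $ 2 \<le> u $ 2"
    using le[of "axis 1 1"] le[of "axis 2 1"] by (simp_all add: Basis_vec2 inner_axis)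
  have "(\<lambda>(x, y). vector [x, y] :: real^2) -` box l u \<inter> space (lborel \<Otimes>\<^sub>M lborel)
      = {l $ 1<..<u $ 1} \<times> {l $ 2<..<u $ 2}"
    by (auto simp: box_def Basis_vec2 inner_axis space_pair_measure)
  then have "emeasure (distr (lborel \<Otimes>\<^sub>M lborel) borel (\<lambda>(x, y). vector [x, y] :: real^2)) (box l u)
      = emeasure (lborel \<Otimes>\<^sub>M lborel) ({l $ 1<..<u $ 1} \<times> {l $ 2<..<u $ 2})"
    by (subst emeasure_distr) auto
  also have "\<dots> = emeasure lborel {l $ 1<..<u $ 1} * emeasure lborel {l $ 2<..<u $ 2}"
    by (rule lborel.emeasure_pair_measure_Times) auto
  also have "\<dots> = (\<Prod>b\<in>Basis. (u - l) \<bullet> b)"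
    using le1 by (simp add: Basis_vec2 axis_neq_vec2 inner_axis ennreal_mult)
  finally show "emeasure (distr (lborel \<Otimes>\<^sub>M lborel) borel (\<lambda>(x, y). vector [x, y] :: real^2)) (box l u)
      = (\<Prod>b\<in>Basis. (u - l) \<bullet> b)" .
qed simp

lemma nn_integral_vec2:
  fixes F :: "real^2 \<Rightarrow> ennreal"
  assumes [measurable]: "F \<in> borel_measurable borel"
  shows "(\<integral>\<^sup>+ z. F z \<partial>lborel) = (\<integral>\<^sup>+ x. \<integral>\<^sup>+ y. F (vector [x, y]) \<partial>lborel \<partial>lborel)"
  by (subst lborel_vec2, subst nn_integral_distr)
    (auto simp: lborel.nn_integral_fst[symmetric] split_beta')

lemma nn_integral_lborel_translate:
  fixes F :: "'a::euclidean_space \<Rightarrow> ennreal"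
  assumes [measurable]: "F \<in> borel_measurable borel"
  shows "(\<integral>\<^sup>+ z. F (z + c) \<partial>lborel) = (\<integral>\<^sup>+ z. F z \<partial>lborel)"
  by (subst (2) lborel_distr_plus[symmetric, of c], subst nn_integral_distr) (auto simp: add.commute)

lemma nn_integral_lborel_uminus:
  fixes F :: "'a::euclidean_space \<Rightarrow> ennreal"
  assumes [measurable]: "F \<in> borel_measurable borel"
  shows "(\<integral>\<^sup>+ z. F (- z) \<partial>lborel) = (\<integral>\<^sup>+ z. F z \<partial>lborel)"
proof -
  have "(\<integral>\<^sup>+ z. F z \<partial>lborel) = (\<integral>\<^sup>+ z. F z \<partial>density (distr lborel borel (\<lambda>x. 0 + (-1) *\<^sub>R x)) (\<lambda>_. ennreal (\<bar>-1\<bar>^DIM('a))))"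
    by (subst lborel_affine[of "-1" 0]) auto
  also have "\<dots> = (\<integral>\<^sup>+ z. F (- z) \<partial>lborel)"
    by (subst nn_integral_density) (simp_all add: nn_integral_distr)
  finally show ?thesis ..
qed

section \<open>Rotations and polar coordinates\<close>

definition rot :: "real \<Rightarrow> real^2 \<Rightarrow> real^2" where
  "rot \<theta> z = vector [cos \<theta> * z $ 1 - sin \<theta> * z $ 2, sin \<theta> * z $ 1 + cos \<theta> * z $ 2]"

lemma rot_nth [simp]:
  "rot \<theta> z $ 1 = cos \<theta> * z $ 1 - sin \<theta> * z $ 2" "rot \<theta> z $ 2 = sin \<theta> * z $ 1 + cos \<theta> * z $ 2"
  by (simp_all add: rot_def)

lemma norm_rot [simp]: "norm (rot \<theta> z) = norm z"
proof -
  have "(rot \<theta> z $ 1)\<^sup>2 + (rot \<theta> z $ 2)\<^sup>2 = ((cos \<theta>)\<^sup>2 + (sin \<theta>)\<^sup>2) * ((z $ 1)\<^sup>2 + (z $ 2)\<^sup>2)"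
    unfolding rot_nth by (simp only: power2_eq_square) algebra
  then show ?thesis by (simp add: norm_vec2)
qed

lemma linear_rot: "linear (rot \<theta>)"
  by (rule linearI) (simp_all add: vec_eq_iff forall_2 algebra_simps)

lemma orthogonal_transformation_rot: "orthogonal_transformation (rot \<theta>)"
  by (simp add: orthogonal_transformation linear_rot)

lemma rot_rot: "rot \<alpha> (rot \<beta> z) = rot (\<alpha> + \<beta>) z"
  by (simp add: vec_eq_iff forall_2 cos_add sin_add algebra_simps)

lemma rot_0 [simp]: "rot 0 z = z"
  by (simp add: vec_eq_iff forall_2)

lemma rot_inverse [simp]: "rot \<theta> (rot (- \<theta>) z) = z" "rot (- \<theta>) (rot \<theta> z) = z"
  by (simp_all add: rot_rot)

lemma measurable_rot [measurable (raw)]: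
  assumes [measurable]: "f \<in> borel_measurable M" "g \<in> borel_measurable M"
  shows "(\<lambda>x. rot (f x) (g x)) \<in> borel_measurable M"
  unfolding rot_def by measurable

text \<open>Invariance under orthogonal maps is a fact about \<open>lebesgue\<close>; on a box and
  its preimage, both Borel, it carries over to \<open>lborel\<close>.\<close>

lemma lborel_distr_rot: "distr lborel borel (rot \<theta>) = lborel"
proof (rule lborel_eqI[symmetric])
  fix l u :: "real^2" assume le: "\<And>b. b \<in> Basis \<Longrightarrow> l \<bullet> b \<le> u \<bullet> b"
  have vim: "rot \<theta> -` box l u = rot (- \<theta>) ` box l u"
    by (auto intro!: image_eqI[where x="rot \<theta> _"])
  have meas: "rot \<theta> -` box l u \<in> sets borel"
    by (rule measurable_sets_borel[of _ borel]) auto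
  have *: "rot (- \<theta>) ` box l u \<in> lmeasurable"
    "measure lebesgue (rot (- \<theta>) ` box l u) = measure lebesgue (box l u)"
    using measurable_orthogonal_image[OF orthogonal_transformation_rot, of "box l u" "- \<theta>"]
      measure_orthogonal_image[OF orthogonal_transformation_rot, of "box l u" "- \<theta>"] by auto
  have "emeasure (distr lborel borel (rot \<theta>)) (box l u) = emeasure lborel (rot \<theta> -` box l u)"
    by (subst emeasure_distr) auto
  also have "\<dots> = emeasure lebesgue (rot \<theta> -` box l u)"
    using meas by simp
  also have "\<dots> = emeasure lebesgue (box l u)"
    using * by (simp add: vim emeasure_eq_measure2)
  also have "\<dots> = (\<Prod>b\<in>Basis. (u - l) \<bullet> b)"
    using le by (simp add: emeasure_lborel_box_eq inner_diff_left)
  finally show "emeasure (distr lborel borel (rot \<theta>)) (box l u) = (\<Prod>b\<in>Basis. (u - l) \<bullet> b)" .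
qed simp

lemma nn_integral_rot:
  assumes [measurable]: "F \<in> borel_measurable borel"
  shows "(\<integral>\<^sup>+ z. F (rot \<theta> z) \<partial>lborel) = (\<integral>\<^sup>+ z. F z \<partial>lborel)"
  by (subst (2) lborel_distr_rot[symmetric, of \<theta>], subst nn_integral_distr) auto

lemma polar_nth [simp]: "polar r \<theta> $ 1 = r * cos \<theta>" "polar r \<theta> $ 2 = r * sin \<theta>"
  by (simp_all add: polar_def)

lemma measurable_polar [measurable (raw)]:
  assumes [measurable]: "f \<in> borel_measurable M" "g \<in> borel_measurable M"
  shows "(\<lambda>x. polar (f x) (g x)) \<in> borel_measurable M"
  unfolding polar_def by measurable

lemma norm_polar [simp]: "norm (polar r \<theta>) = \<bar>r\<bar>"
proof -
  have "(r * cos \<theta>)\<^sup>2 + (r * sin \<theta>)\<^sup>2 = r\<^sup>2"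
    using sin_cos_squared_add2[of \<theta>] by (simp add: power_mult_distrib flip: distrib_left)
  then show ?thesis by (simp add: norm_vec2)
qed

lemma rot_polar: "rot \<alpha> (polar r \<theta>) = polar r (\<alpha> + \<theta>)"
  by (simp add: vec_eq_iff forall_2 cos_add sin_add algebra_simps)

lemma polar_periodic: "polar r (\<theta> + 2 * pi) = polar r \<theta>"
  by (simp add: polar_def)

lemma polar_exists: "\<exists>\<theta>. z = polar (norm z) \<theta>"
proof -
  have "(z $ 1 / norm z)\<^sup>2 + (z $ 2 / norm z)\<^sup>2 = 1" if "z \<noteq> 0"
  proof -
    have "(z $ 1)\<^sup>2 + (z $ 2)\<^sup>2 = (norm z)\<^sup>2" by (simp add: norm_vec2)
    with that show ?thesis
      by (simp add: power_divide flip: add_divide_distrib del: sum_power2_eq_zero_iff)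
  qed
  then obtain t where t: "z $ 1 / norm z = cos t" "z $ 2 / norm z = sin t" if "z \<noteq> 0"
    using sincos_total_2pi_le[of "z $ 1 / norm z" "z $ 2 / norm z"] by blast
  have "z = polar (norm z) t"
  proof (cases "z = 0")
    case False
    with t[OF False, symmetric] show ?thesis by (simp add: vec_eq_iff forall_2)
  qed (simp add: vec_eq_iff forall_2)
  then show ?thesis ..
qed

text \<open>Reduce \<open>c\<close> modulo \<open>2 * pi\<close> to \<open>d\<close>, cut the
  shifted period at \<open>2 * pi\<close>, and move the overhanging piece back by one
  period.\<close>

lemma nn_integral_periodic_shift:
  fixes f :: "real \<Rightarrow> ennreal"
  assumes [measurable]: "f \<in> borel_measurable borel" and per: "\<And>x. f (x + 2 * pi) = f x"
  shows "(\<integral>\<^sup>+ x. f (c + x) * indicator {0..2 * pi} x \<partial>lborel) = (\<integral>\<^sup>+ x. f x * indicator {0..2 * pi} x \<partial>lborel)"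
proof -
  have per_int: "f (x + 2 * pi * real_of_int n) = f x" for x n
  proof (induction n rule: int_induct[where k=0])
    case (step1 n)
    then show ?case using per[of "x + 2 * pi * real_of_int n"] by (simp add: algebra_simps)
  next
    case (step2 n)
    then show ?case using per[of "x + 2 * pi * real_of_int (n - 1)"] by (simp add: algebra_simps)
  qed simp
  define d where "d = c - 2 * pi * real_of_int \<lfloor>c / (2 * pi)\<rfloor>"
  have "d = 2 * pi * frac (c / (2 * pi))"
    by (simp add: d_def frac_def field_simps)
  then have d: "0 \<le> d" "d < 2 * pi"
    using frac_lt_1[of "c / (2 * pi)"] by simp_all
  have fd: "f (c + x) = f (d + x)" for x
    using per_int[of "d + x" "\<lfloor>c / (2 * pi)\<rfloor>"] by (simp add: d_def algebra_simps)
  have ae: "(\<integral>\<^sup>+ x. g x * indicator {a..b} x \<partial>lborel) = (\<integral>\<^sup>+ x. g x * indicator {a..<b} x \<partial>lborel)"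
    for g :: "real \<Rightarrow> ennreal" and a b :: real
    by (intro nn_integral_cong_AE, use AE_lborel_singleton[of b] in eventually_elim)
      (auto split: split_indicator)
  have shift: "(\<integral>\<^sup>+ x. g x \<partial>lborel) = (\<integral>\<^sup>+ x. g (x + t) \<partial>lborel)"
    if "g \<in> borel_measurable borel" for g :: "real \<Rightarrow> ennreal" and t
    using nn_integral_lborel_translate[OF that, of t] by simp
  have "(\<integral>\<^sup>+ x. f (c + x) * indicator {0..2 * pi} x \<partial>lborel)
      = (\<integral>\<^sup>+ x. f (d + x) * indicator {0..<2 * pi} x \<partial>lborel)"
    by (simp add: fd ae)
  also have "\<dots> = (\<integral>\<^sup>+ x. f x * indicator {d..<d + 2 * pi} x \<partial>lborel)"
    by (subst (2) shift[where t=d]) (auto intro!: nn_integral_cong simp: add.commute split: split_indicator)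
  also have "\<dots> = (\<integral>\<^sup>+ x. f x * indicator {d..<2 * pi} x + f x * indicator {2 * pi..<d + 2 * pi} x \<partial>lborel)"
    using d by (auto intro!: nn_integral_cong split: split_indicator)
  also have "\<dots> = (\<integral>\<^sup>+ x. f x * indicator {d..<2 * pi} x \<partial>lborel) + (\<integral>\<^sup>+ x. f x * indicator {2 * pi..<d + 2 * pi} x \<partial>lborel)"
    by (rule nn_integral_add) auto
  also have "(\<integral>\<^sup>+ x. f x * indicator {2 * pi..<d + 2 * pi} x \<partial>lborel) = (\<integral>\<^sup>+ x. f x * indicator {0..<d} x \<partial>lborel)"
    by (subst shift[where t="2 * pi"]) (auto intro!: nn_integral_cong simp: per split: split_indicator)
  also have "(\<integral>\<^sup>+ x. f x * indicator {d..<2 * pi} x \<partial>lborel) + (\<integral>\<^sup>+ x. f x * indicator {0..<d} x \<partial>lborel)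
     = (\<integral>\<^sup>+ x. f x * indicator {d..<2 * pi} x + f x * indicator {0..<d} x \<partial>lborel)"
    by (rule nn_integral_add[symmetric]) auto
  also have "\<dots> = (\<integral>\<^sup>+ x. f x * indicator {0..<2 * pi} x \<partial>lborel)"
    using d by (auto intro!: nn_integral_cong split: split_indicator)
  finally show ?thesis by (simp add: ae)
qed

lemma emeasure_ball_vec2: "0 \<le> r \<Longrightarrow> emeasure lborel (ball (c::real^2) r) = ennreal (pi * r\<^sup>2)"
  by (simp add: emeasure_ball unit_ball_vol_2)

text \<open>The half-lines \<open>{..<r}\<close> form an intersection-stable generator, and on them
  both sides are the area of a disc.\<close>

lemma distr_norm_vec2:
  "distr (lborel :: (real^2) measure) borel norm
    = density lborel (\<lambda>r. ennreal (2 * pi * r) * indicator {0<..} r)"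
proof (rule measure_eqI_generator_eq[where E="range (\<lambda>r::real. {..<r})" and A="\<lambda>n. {..<real n}" and \<Omega>=UNIV])
  show "Int_stable (range (\<lambda>r::real. {..<r}))"
  proof (clarsimp simp: Int_stable_def)
    fix a b :: real
    have "{..<a} \<inter> {..<b} = {..<min a b}" by auto
    then show "{..<a} \<inter> {..<b} \<in> range lessThan" by simp
  qed
  show "sets (distr (lborel :: (real^2) measure) borel norm) = sigma_sets UNIV (range (\<lambda>r::real. {..<r}))"
    by (simp add: borel_Iio)
  show "sets (density lborel (\<lambda>r. ennreal (2 * pi * r) * indicator {0<..} r)) = sigma_sets UNIV (range (\<lambda>r::real. {..<r}))"
    by (simp add: borel_Iio)
  have L: "emeasure (distr (lborel :: (real^2) measure) borel norm) {..<r} = ennreal (pi * (max 0 r)\<^sup>2)" for r :: real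
  proof -
    have "emeasure (distr (lborel :: (real^2) measure) borel norm) {..<r} = emeasure lborel (ball (0::real^2) (max 0 r))"
      by (subst emeasure_distr) (auto intro!: arg_cong[where f="emeasure lborel"] simp: less_max_iff_disj)
    then show ?thesis by (simp add: emeasure_ball_vec2)
  qed
  have R: "emeasure (density lborel (\<lambda>r. ennreal (2 * pi * r) * indicator {0<..} r)) {..<r} = ennreal (pi * (max 0 r)\<^sup>2)" for r :: real
  proof -
    have "emeasure (density lborel (\<lambda>r. ennreal (2 * pi * r) * indicator {0<..} r)) {..<r}
        = (\<integral>\<^sup>+ x. ennreal (2 * pi * x) * indicator {0<..} x * indicator {..<r} x \<partial>lborel)"
      by (subst emeasure_density) auto
    also have "\<dots> = (\<integral>\<^sup>+ x. ennreal (2 * pi * x) * indicator {0..max 0 r} x \<partial>lborel)"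
      by (intro nn_integral_cong_AE, use AE_lborel_singleton[of r] AE_lborel_singleton[of 0] in eventually_elim)
        (auto split: split_indicator)
    also have "\<dots> = ennreal (pi * (max 0 r)\<^sup>2 - pi * 0\<^sup>2)"
      by (rule nn_integral_FTC_Icc) (auto intro!: derivative_eq_intros)
    finally show ?thesis by simp
  qed
  fix X assume "X \<in> range (\<lambda>r::real. {..<r})"
  then show "emeasure (distr (lborel :: (real^2) measure) borel norm) X
      = emeasure (density lborel (\<lambda>r. ennreal (2 * pi * r) * indicator {0<..} r)) X"
    using L R by auto
next
  show "(\<Union>i. {..<real i}) = UNIV"
    using reals_Archimedean2 by auto
  fix i
  have "emeasure (distr (lborel :: (real^2) measure) borel norm) {..<real i} = emeasure lborel (ball (0::real^2) (real i))"
    by (subst emeasure_distr) (auto intro!: arg_cong[where f="emeasure lborel"])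
  then show "emeasure (distr (lborel :: (real^2) measure) borel norm) {..<real i} \<noteq> \<infinity>"
    by (simp add: emeasure_ball_vec2)
qed auto

lemma nn_integral_radial:
  fixes G :: "real \<Rightarrow> ennreal"
  assumes [measurable]: "G \<in> borel_measurable borel"
  shows "(\<integral>\<^sup>+ z. G (norm (z::real^2)) \<partial>lborel) = (\<integral>\<^sup>+ r. ennreal (2 * pi * r) * indicator {0<..} r * G r \<partial>lborel)"
proof -
  have "(\<integral>\<^sup>+ z. G (norm (z::real^2)) \<partial>lborel) = (\<integral>\<^sup>+ r. G r \<partial>distr (lborel :: (real^2) measure) borel norm)"
    by (subst nn_integral_distr) auto
  then show ?thesis
    by (simp add: distr_norm_vec2 nn_integral_density)
qed

text \<open>Averaging over rotations reduces the claim to radial integrands.\<close>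

lemma nn_integral_polar:
  fixes F :: "real^2 \<Rightarrow> ennreal"
  assumes [measurable]: "F \<in> borel_measurable borel"
  shows "(\<integral>\<^sup>+ z. F z \<partial>lborel)
    = (\<integral>\<^sup>+ r. ennreal r * indicator {0<..} r * (\<integral>\<^sup>+ \<theta>. F (polar r \<theta>) * indicator {0..2 * pi} \<theta> \<partial>lborel) \<partial>lborel)"
proof -
  define G where "G r = (\<integral>\<^sup>+ \<theta>. F (polar r \<theta>) * indicator {0..2 * pi} \<theta> \<partial>lborel)" for r
  have G [measurable]: "G \<in> borel_measurable borel"
    unfolding G_def by measurable
  \<comment> \<open>Turning \<open>z\<close> through all angles runs once around its circle, so the
    result depends on \<open>norm z\<close> only; the polar angle of \<open>z\<close> disappears by
    periodicity.\<close>
  have avg: "(\<integral>\<^sup>+ \<theta>. F (rot \<theta> z) * indicator {0..2 * pi} \<theta> \<partial>lborel) = G (norm z)" for z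
  proof -
    obtain \<phi> where z: "z = polar (norm z) \<phi>" using polar_exists by blast
    have "F (rot \<theta> z) = F (polar (norm z) (\<phi> + \<theta>))" for \<theta>
      by (subst z) (simp add: rot_polar add.commute)
    then have "(\<integral>\<^sup>+ \<theta>. F (rot \<theta> z) * indicator {0..2 * pi} \<theta> \<partial>lborel)
        = (\<integral>\<^sup>+ \<theta>. F (polar (norm z) (\<phi> + \<theta>)) * indicator {0..2 * pi} \<theta> \<partial>lborel)"
      by simp
    also have "\<dots> = G (norm z)"
      unfolding G_def by (rule nn_integral_periodic_shift) (measurable, simp add: polar_periodic)
    finally show ?thesis .
  qed
  have "ennreal (2 * pi) * (\<integral>\<^sup>+ z. F z \<partial>lborel) = (\<integral>\<^sup>+ \<theta>. (\<integral>\<^sup>+ z. F z \<partial>lborel) * indicator {0..2 * pi} \<theta> \<partial>lborel)"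
    by (subst nn_integral_cmult) (simp_all add: mult.commute)
  also have "\<dots> = (\<integral>\<^sup>+ \<theta>. (\<integral>\<^sup>+ z. F (rot \<theta> z) * indicator {0..2 * pi} \<theta> \<partial>lborel) \<partial>lborel)"
    by (intro nn_integral_cong, subst nn_integral_multc) (simp_all add: nn_integral_rot[OF assms])
  also have "\<dots> = (\<integral>\<^sup>+ z. (\<integral>\<^sup>+ \<theta>. F (rot \<theta> z) * indicator {0..2 * pi} \<theta> \<partial>lborel) \<partial>lborel)"
    by (rule lborel_pair.Fubini') measurable
  also have "\<dots> = (\<integral>\<^sup>+ z. G (norm (z::real^2)) \<partial>lborel)"
    by (simp add: avg)
  also have "\<dots> = (\<integral>\<^sup>+ r. ennreal (2 * pi) * (ennreal r * indicator {0<..} r * G r) \<partial>lborel)"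
    by (subst nn_integral_radial)
      (auto intro!: nn_integral_cong simp: ennreal_mult mult.assoc split: split_indicator)
  also have "\<dots> = ennreal (2 * pi) * (\<integral>\<^sup>+ r. ennreal r * indicator {0<..} r * G r \<partial>lborel)"
    by (rule nn_integral_cmult) measurable
  finally have "ennreal (2 * pi) * (\<integral>\<^sup>+ z. F z \<partial>lborel)
    = ennreal (2 * pi) * (\<integral>\<^sup>+ r. ennreal r * indicator {0<..} r * G r \<partial>lborel)" .
  then have "(\<integral>\<^sup>+ z. F z \<partial>lborel) = (\<integral>\<^sup>+ r. ennreal r * indicator {0<..} r * G r \<partial>lborel)"
    by (subst (asm) ennreal_mult_cancel_left) auto
  then show ?thesis
    unfolding G_def .
qed

section \<open>Scaling and the renormalized energy\<close>

text \<open>The function \<open>f\<close> may fail to be integrable, so linearity of the integral is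
  not at hand. The integrable \<open>k\<close> dominates the negative part of \<open>f\<close>;
  hence that part is finite, and what remains is one nonnegative, possibly infinite integral minus a
  real number.\<close>

lemma extended_integral_add:
  assumes [measurable]: "f \<in> borel_measurable M" and k: "integrable M k"
    and nonneg: "\<And>x. x \<in> space M \<Longrightarrow> 0 \<le> f x + k x"
  shows "extended_integral M f = enn2ereal (\<integral>\<^sup>+ x. ennreal (f x + k x) \<partial>M) - ereal (integral\<^sup>L M k)"
proof -
  have [measurable]: "k \<in> borel_measurable M" using k by auto
  let ?J = "\<integral>\<^sup>+ x. ennreal (f x + k x) \<partial>M"
  let ?p = "\<integral>\<^sup>+ x. ennreal (f x) \<partial>M" and ?n = "\<integral>\<^sup>+ x. ennreal (- f x) \<partial>M"
  let ?kp = "\<integral>\<^sup>+ x. ennreal (k x) \<partial>M" and ?kn = "\<integral>\<^sup>+ x. ennreal (- k x) \<partial>M"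
  have fin: "?kp \<noteq> \<infinity>" "?kn \<noteq> \<infinity>"
    using integrableD(2)[OF k] integrableD(3)[OF k] by auto
  have n_le: "?n \<le> ?kp"
    using nonneg by (intro nn_integral_mono ennreal_leI) (force simp: add.commute)
  have pw: "ennreal (f x + k x) + ennreal (- f x) + ennreal (- k x) = ennreal (f x) + ennreal (k x)"
    if "x \<in> space M" for x
    using nonneg[OF that]
    by (cases "f x \<ge> 0"; cases "k x \<ge> 0") (auto simp: ennreal_neg simp flip: ennreal_plus)
  have "?J + ?n + ?kn = (\<integral>\<^sup>+ x. ennreal (f x + k x) + ennreal (- f x) + ennreal (- k x) \<partial>M)"
    by (simp add: nn_integral_add)
  also have "\<dots> = (\<integral>\<^sup>+ x. ennreal (f x) + ennreal (k x) \<partial>M)"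
    by (intro nn_integral_cong pw)
  also have "\<dots> = ?p + ?kp"
    by (simp add: nn_integral_add)
  finally have eq: "?J + ?n + ?kn = ?p + ?kp" .
  obtain a where a: "?kp = ennreal a" "a \<ge> 0" using fin(1) by (cases ?kp) auto
  obtain b where b: "?kn = ennreal b" "b \<ge> 0" using fin(2) by (cases ?kn) auto
  obtain m where m: "?n = ennreal m" "m \<ge> 0" using n_le a by (cases ?n) (auto simp: top_unique)
  have k_int: "integral\<^sup>L M k = a - b"
    using real_lebesgue_integral_def[OF k] a b by (simp add: enn2real_ennreal)
  show ?thesis
  proof (cases ?J)
    case (real j)
    with eq a b m have "ennreal (j + m + b) = ?p + ennreal a" by (simp flip: ennreal_plus)
    then obtain q where q: "?p = ennreal q" "q \<ge> 0" by (cases ?p) auto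
    with eq real a b m have "j + m + b = q + a"
      by (simp add: ennreal_plus[symmetric] del: ennreal_plus)
    then show ?thesis
      by (simp add: extended_integral_def real q m k_int enn2ereal_ennreal)
  next
    case top
    with eq a have "?p = \<infinity>" by (cases ?p) (auto simp flip: ennreal_plus)
    then show ?thesis
      by (simp add: extended_integral_def top m k_int enn2ereal_ennreal)
  qed
qed

lemma has_bochner_integral_tail_power:
  assumes "0 < s"
  shows "has_bochner_integral lborel (\<lambda>r::real. indicator {s..} r * (1 / r ^ Suc (Suc k)))
    (1 / (real (Suc k) * s ^ Suc k))"
proof (rule has_bochner_integral_nn_integral)
  have *: "((\<lambda>r::real. - (1 / (real (Suc k) * r ^ Suc k))) \<longlongrightarrow> - 0) at_top"
    by (intro tendsto_minus tendsto_divide_0[OF tendsto_const] filterlim_at_top_imp_at_infinity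
        filterlim_tendsto_pos_mult_at_top[OF tendsto_const] filterlim_pow_at_top filterlim_ident) auto
  have "(\<integral>\<^sup>+ r. ennreal (1 / r ^ Suc (Suc k)) * indicator {s..} r \<partial>lborel)
      = ennreal (- 0 - (- (1 / (real (Suc k) * s ^ Suc k))))"
  proof (rule nn_integral_FTC_atLeast[OF _ _ _ *])
    fix r assume "s \<le> r"
    with assms have "r > 0" by simp
    have "((\<lambda>r. real (Suc k) * r ^ Suc k) has_real_derivative real (Suc k) * (real (Suc k) * r ^ k)) (at r)"
      using DERIV_cmult[OF DERIV_pow[of "Suc k" r], of "real (Suc k)"] by simp
    from DERIV_minus[OF DERIV_inverse_fun[OF this]] \<open>r > 0\<close>
    have "((\<lambda>r. - (1 / (real (Suc k) * r ^ Suc k))) has_real_derivative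
        real (Suc k) * (real (Suc k) * r ^ k) / (real (Suc k) * r ^ Suc k)\<^sup>2) (at r)"
      by (simp add: divide_inverse power2_eq_square del: of_nat_Suc)
    also have "real (Suc k) * (real (Suc k) * r ^ k) / (real (Suc k) * r ^ Suc k)\<^sup>2 = 1 / r ^ Suc (Suc k)"
      using \<open>r > 0\<close> by (simp add: power2_eq_square del: of_nat_Suc)
    finally show "((\<lambda>r. - (1 / (real (Suc k) * r ^ Suc k))) has_real_derivative 1 / r ^ Suc (Suc k)) (at r)" .
    from \<open>r > 0\<close> show "0 \<le> 1 / r ^ Suc (Suc k)" by simp
  qed auto
  also have "(\<integral>\<^sup>+ r. ennreal (1 / r ^ Suc (Suc k)) * indicator {s..} r \<partial>lborel)
      = (\<integral>\<^sup>+ r. ennreal (indicator {s..} r * (1 / r ^ Suc (Suc k))) \<partial>lborel)"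
    by (intro nn_integral_cong) (simp split: split_indicator)
  finally show "(\<integral>\<^sup>+ r. ennreal (indicator {s..} r * (1 / r ^ Suc (Suc k))) \<partial>lborel)
      = ennreal (1 / (real (Suc k) * s ^ Suc k))"
    by simp
qed (use assms in \<open>auto split: split_indicator\<close>)

lemma has_bochner_integral_inverse_interval:
  assumes "0 < a" "a \<le> b"
  shows "has_bochner_integral lborel (\<lambda>r::real. indicator {a..<b} r * (1 / r)) (ln b - ln a)"
proof -
  have "has_bochner_integral lborel (\<lambda>r::real. (1 / r) * indicator {a..b} r) (ln b - ln a)"
    using assms by (intro has_bochner_integral_FTC_Icc_real)
      (auto intro!: derivative_eq_intros continuous_intros)
  moreover have "AE r in lborel. (1 / r) * indicator {a..b} r = indicator {a..<b} r * (1 / r)"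
    using AE_lborel_singleton[of b] by eventually_elim (auto split: split_indicator)
  ultimately show ?thesis
    by (subst (asm) has_bochner_integral_cong_AE) auto
qed

text \<open>The origin of the logarithm in the scaling law: the cutoff of the derivative term stays
  at radius 1 while the configuration is stretched by \<open>s\<close>.\<close>

lemma has_bochner_integral_log_scale:
  assumes "0 < s"
  shows "has_bochner_integral lborel
    (\<lambda>r::real. indicator {0<..} r * ((indicator {..<s} r - indicator {..<1} r) / r)) (ln s)"
proof (cases "1 \<le> s")
  case True
  have "(\<lambda>r::real. indicator {0<..} r * ((indicator {..<s} r - indicator {..<1} r) / r))
      = (\<lambda>r. indicator {1..<s} r * (1 / r))"
    using True by (auto simp: fun_eq_iff split: split_indicator)
  with has_bochner_integral_inverse_interval[of 1 s] True show ?thesis by simp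
next
  case False
  have "(\<lambda>r::real. indicator {0<..} r * ((indicator {..<s} r - indicator {..<1} r) / r))
      = (\<lambda>r. - (indicator {s..<1} r * (1 / r)))"
    using False assms by (auto simp: fun_eq_iff split: split_indicator)
  with has_bochner_integral_minus[OF has_bochner_integral_inverse_interval[of s 1]] False assms
  show ?thesis by simp
qed

lemma content_cbox_vec2: "0 \<le> R \<Longrightarrow> measure lborel (cbox (vec (- R)) (vec R) :: (real^2) set) = (2 * R)\<^sup>2"
  by (simp add: content_cbox_cart interval_ne_empty_cart prod_2 power2_eq_square)

lemma integral_lborel_scaleR:
  fixes f :: "'a::euclidean_space \<Rightarrow> real"
  assumes [measurable]: "f \<in> borel_measurable borel" and "c \<noteq> 0"
  shows "(LINT x|lborel. f x) = \<bar>c\<bar> ^ DIM('a) * (LINT x|lborel. f (c *\<^sub>R x))"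
  by (subst lborel_affine[OF \<open>c \<noteq> 0\<close>, of 0]) (simp add: integral_density integral_distr)

lemma autocorrelation_scale:
  assumes [measurable]: "u \<in> borel_measurable borel" and s: "0 < s"
  shows "autocorrelation (\<lambda>x. u (x /\<^sub>R s)) z = autocorrelation u (z /\<^sub>R s)"
proof -
  define F where "F R = (LINT x:cbox (vec (- R)) (vec R)|lborel. u (x + z /\<^sub>R s) * u x)
      / measure lborel (cbox (vec (- R)) (vec R) :: (real^2) set)" for R
  have F: "(LINT x:cbox (vec (- R)) (vec R)|lborel. u ((x + z) /\<^sub>R s) * u (x /\<^sub>R s))
      / measure lborel (cbox (vec (- R)) (vec R) :: (real^2) set) = F (R / s)" if "R > 0" for R
  proof -
    have box: "s *\<^sub>R x \<in> cbox (vec (- R)) (vec R) \<longleftrightarrow> x \<in> cbox (vec (- (R / s))) (vec (R / s))" for x :: "real^2"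
      using s by (simp add: mem_box_cart forall_2 field_simps)
    have "(LINT x:cbox (vec (- R)) (vec R)|lborel. u ((x + z) /\<^sub>R s) * u (x /\<^sub>R s))
       = s\<^sup>2 * (LINT x|lborel. indicator (cbox (vec (- R)) (vec R)) (s *\<^sub>R x) *\<^sub>R
            (u ((s *\<^sub>R x + z) /\<^sub>R s) * u ((s *\<^sub>R x) /\<^sub>R s)))"
      unfolding set_lebesgue_integral_def by (subst integral_lborel_scaleR[where c=s]) (use s in auto)
    also have "\<dots> = s\<^sup>2 * (LINT x:cbox (vec (- (R / s))) (vec (R / s))|lborel. u (x + z /\<^sub>R s) * u x)"
      unfolding set_lebesgue_integral_def using s
      by (intro arg_cong2[where f=times] Bochner_Integration.integral_cong refl)
        (simp add: indicator_def box scaleR_add_right)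
    finally show ?thesis
      using s that by (simp add: F_def content_cbox_vec2 power_divide power_mult_distrib)
  qed
  \<comment> \<open>\<open>Lim\<close> is a definite description, so the two limits are identified
    by showing that the same values \<open>l\<close> qualify on both sides; existence of a limit is
    not assumed.\<close>
  have "((\<lambda>R. (LINT x:cbox (vec (- R)) (vec R)|lborel. u ((x + z) /\<^sub>R s) * u (x /\<^sub>R s))
      / measure lborel (cbox (vec (- R)) (vec R) :: (real^2) set)) \<longlongrightarrow> l) at_top \<longleftrightarrow> (F \<longlongrightarrow> l) at_top" for l
  proof -
    have "((\<lambda>R. (LINT x:cbox (vec (- R)) (vec R)|lborel. u ((x + z) /\<^sub>R s) * u (x /\<^sub>R s))
      / measure lborel (cbox (vec (- R)) (vec R) :: (real^2) set)) \<longlongrightarrow> l) at_top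
      \<longleftrightarrow> ((\<lambda>R. F (R / s)) \<longlongrightarrow> l) at_top"
      by (rule tendsto_cong, rule eventually_mono[OF eventually_gt_at_top[of 0]]) (rule F)
    also have "\<dots> \<longleftrightarrow> (F \<longlongrightarrow> l) at_top"
    proof
      assume *: "((\<lambda>R. F (R / s)) \<longlongrightarrow> l) at_top"
      have "filterlim (\<lambda>R. s * R) at_top at_top"
        using s by (intro filterlim_tendsto_pos_mult_at_top[OF tendsto_const] filterlim_ident) auto
      from filterlim_compose[OF * this] s show "(F \<longlongrightarrow> l) at_top" by simp
    next
      assume *: "(F \<longlongrightarrow> l) at_top"
      have "filterlim (\<lambda>R. (1 / s) * R) at_top at_top"
        using s by (intro filterlim_tendsto_pos_mult_at_top[OF tendsto_const] filterlim_ident) auto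
      from filterlim_compose[OF * this] s show "((\<lambda>R. F (R / s)) \<longlongrightarrow> l) at_top" by simp
    qed
    finally show ?thesis .
  qed
  then show ?thesis
    by (simp add: autocorrelation_def F_def[abs_def] Topological_Spaces.Lim_def)
qed

section \<open>Energy of a rescaled configuration and its minimum\<close>

locale radial_profile =
  fixes u :: "real^2 \<Rightarrow> real" and d K :: real
  assumes u_meas [measurable]: "u \<in> borel_measurable borel"
    and C_meas [measurable]: "autocorrelation u \<in> borel_measurable borel"
    and C_bounds: "\<And>z. 0 \<le> autocorrelation u z" "\<And>z. autocorrelation u z \<le> autocorrelation u 0"
    and D_integral: "\<And>r. 0 < r \<Longrightarrow> has_bochner_integral lborel
       (\<lambda>\<theta>. indicator {0..2 * pi} \<theta> * one_sided_deriv0 (autocorrelation u) (polar r \<theta>)) (- (d * r))"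
    and C_slope: "\<And>z. autocorrelation u 0 + one_sided_deriv0 (autocorrelation u) z \<le> autocorrelation u z"
    and d_pos: "0 < d"
    and K_def: "K = 2 * pi * autocorrelation u 0"
begin

definition profile :: "real \<Rightarrow> real" where
  "profile r = (LINT \<theta>|lborel. indicator {0..2 * pi} \<theta> * (autocorrelation u (polar r \<theta>) - autocorrelation u 0))"

text \<open>The integrand is nonnegative, below radius 1 by \<open>C_slope\<close> and beyond it
  because \<open>profile\<close> is at least \<open>- K\<close>. So a value in
  \<open>ennreal\<close> always exists, and no positive and negative parts have to be
  balanced.\<close>

definition renormalized_energy :: ennreal where
  "renormalized_energy =
    (\<integral>\<^sup>+ r. indicator {0<..} r * ennreal ((profile r + (if r < 1 then d * r else K)) / r\<^sup>2) \<partial>lborel)"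

lemma integrable_C: "integrable lborel (\<lambda>\<theta>. indicator {0..2 * pi} \<theta> * (autocorrelation u (polar r \<theta>) - autocorrelation u 0))"
proof (rule Bochner_Integration.integrable_bound)
  show "integrable lborel (\<lambda>\<theta>::real. indicator {0..2 * pi} \<theta> * autocorrelation u 0 :: real)"
    by (intro integrable_mult_left) simp
  show "AE \<theta> in lborel. norm (indicator {0..2 * pi} \<theta> * (autocorrelation u (polar r \<theta>) - autocorrelation u 0))
      \<le> norm (indicator {0..2 * pi} \<theta> * autocorrelation u 0)"
  proof (rule AE_I2)
    fix \<theta>
    show "norm (indicator {0..2 * pi} \<theta> * (autocorrelation u (polar r \<theta>) - autocorrelation u 0))
      \<le> norm (indicator {0..2 * pi} \<theta> * autocorrelation u 0)"
      using C_bounds(1)[of "polar r \<theta>"] C_bounds(2)[of "polar r \<theta>"]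
      by (simp add: indicator_def)
  qed
qed measurable

lemma profile_meas [measurable]: "profile \<in> borel_measurable borel"
  unfolding profile_def[abs_def] by measurable

lemma profile_ge: "- K \<le> profile r"
proof -
  have "(LINT \<theta>|lborel. indicator {0..2 * pi} \<theta> * (- autocorrelation u 0)) \<le> profile r"
    unfolding profile_def using C_bounds(1)
    by (intro integral_mono integrable_C integrable_mult_left) (auto split: split_indicator)
  then show ?thesis by (simp add: K_def)
qed

lemma profile_slope: "0 < r \<Longrightarrow> 0 \<le> profile r + d * r"
proof -
  assume r: "0 < r"
  have "- (d * r) = (LINT \<theta>|lborel. indicator {0..2 * pi} \<theta> * one_sided_deriv0 (autocorrelation u) (polar r \<theta>))"
    using D_integral[OF r] by (simp add: has_bochner_integral_iff)
  also have "\<dots> \<le> profile r"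
    unfolding profile_def using D_integral[OF r] C_slope
    by (intro integral_mono integrable_C) (auto simp: has_bochner_integral_iff algebra_simps split: split_indicator)
  finally show ?thesis by simp
qed

lemma angular_integral:
  assumes s: "0 < s" and r: "0 < r"
  shows "(LINT \<theta>:{0..2 * pi}|lborel. energy_integrand (\<lambda>x. u (x /\<^sub>R s)) (polar r \<theta>)) * r
     = (profile (r / s) + (if r < 1 then d * (r / s) else 0)) / r\<^sup>2"
proof -
  let ?C = "autocorrelation u"
  have C: "autocorrelation (\<lambda>x. u (x /\<^sub>R s)) = (\<lambda>z. ?C (z /\<^sub>R s))"
    using autocorrelation_scale[OF u_meas s] by (auto simp: fun_eq_iff)
  have D: "one_sided_deriv0 (\<lambda>z. ?C (z /\<^sub>R s)) z = one_sided_deriv0 ?C (z /\<^sub>R s)" for z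
    by (simp add: one_sided_deriv0_def mult.commute)
  have pol: "polar r \<theta> /\<^sub>R s = polar (r / s) \<theta>" for \<theta>
    by (simp add: vec_eq_iff forall_2 divide_inverse mult.commute)
  have ball: "polar r \<theta> \<in> ball 0 1 \<longleftrightarrow> r < 1" for \<theta>
    using r by simp
  have K0: "K0 r = 1 / r\<^sup>2"
    using r by (simp add: K0_def power_int_minus field_simps)
  have "(LINT \<theta>:{0..2 * pi}|lborel. energy_integrand (\<lambda>x. u (x /\<^sub>R s)) (polar r \<theta>))
    = (LINT \<theta>|lborel. (indicator {0..2 * pi} \<theta> * (?C (polar (r / s) \<theta>) - ?C 0)
        - (if r < 1 then 1 else 0) * (indicator {0..2 * pi} \<theta> * one_sided_deriv0 ?C (polar (r / s) \<theta>))) * (1 / (r * r\<^sup>2)))"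
    unfolding set_lebesgue_integral_def energy_integrand_def Let_def C D pol
    using r by (intro Bochner_Integration.integral_cong refl)
      (auto simp: indicator_def ball K0 field_simps)
  also have "\<dots> = (profile (r / s) - (if r < 1 then 1 else 0) * (- (d * (r / s)))) * (1 / (r * r\<^sup>2))"
  proof (rule has_bochner_integral_integral_eq)
    show "has_bochner_integral lborel (\<lambda>\<theta>. (indicator {0..2 * pi} \<theta> * (?C (polar (r / s) \<theta>) - ?C 0)
        - (if r < 1 then 1 else 0) * (indicator {0..2 * pi} \<theta> * one_sided_deriv0 ?C (polar (r / s) \<theta>))) * (1 / (r * r\<^sup>2)))
       ((profile (r / s) - (if r < 1 then 1 else 0) * (- (d * (r / s)))) * (1 / (r * r\<^sup>2)))"
      using s r unfolding profile_def
      by (intro has_bochner_integral_mult_left has_bochner_integral_diff has_bochner_integral_mult_right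
          D_integral has_bochner_integral_integrable integrable_C) auto
  qed
  finally show ?thesis using r by simp
qed

text \<open>Substituting \<open>r = s * t\<close> produces the factor \<open>1 / s\<close>, but the
  derivative term keeps its cutoff at \<open>r = 1\<close>, that is, at \<open>t = 1 / s\<close>.
  Adding \<open>k\<close> moves this cutoff to \<open>r = s\<close> and adds the constant
  \<open>K\<close> beyond it; the integral of \<open>k\<close> is the explicit correction
  \<open>(K + d * ln s) / s\<close>.\<close>

theorem energy_scaled:
  assumes s: "0 < s"
  shows "energy (\<lambda>x. u (x /\<^sub>R s)) = ereal (1 / s) * (enn2ereal renormalized_energy - ereal (K + d * ln s))"
proof -
  define f where "f r = (profile (r / s) + (if r < 1 then d * (r / s) else 0)) / r\<^sup>2" for r
  define k where "k r = K * (indicator {s..} r * (1 / r\<^sup>2))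
      + d / s * (indicator {0<..} r * ((indicator {..<s} r - indicator {..<1} r) / r))" for r :: real
  have [measurable]: "f \<in> borel_measurable borel" unfolding f_def by measurable
  have k: "has_bochner_integral lborel k (K * (1 / s) + d / s * ln s)"
    unfolding k_def using has_bochner_integral_tail_power[OF s, of 0]
    by (intro has_bochner_integral_add has_bochner_integral_mult_right has_bochner_integral_log_scale s)
      (simp add: power2_eq_square)
  have supp: "k r = indicator {0<..} r * k r" for r
    using s by (auto simp: k_def split: split_indicator)
  have k': "integrable (restrict_space lborel {0<..}) k"
    "integral\<^sup>L (restrict_space lborel {0<..}) k = K * (1 / s) + d / s * ln s"
    using k by (simp_all add: integrable_restrict_space integral_restrict_space has_bochner_integral_iff flip: supp)
  have fk: "f r + k r = (profile (r / s) + (if r / s < 1 then d * (r / s) else K)) / r\<^sup>2" if "0 < r" for r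
    using s that by (auto simp: f_def k_def field_simps power2_eq_square split: split_indicator)
  have nonneg: "0 \<le> profile t + (if t < 1 then d * t else K)" if "0 < t" for t
    using profile_slope[OF that] profile_ge[of t] by auto
  have "energy (\<lambda>x. u (x /\<^sub>R s)) = extended_integral (restrict_space lborel {0<..}) f"
    unfolding energy_def extended_integral_def
    by (intro arg_cong2[where f="(-)"] arg_cong[where f=enn2ereal] nn_integral_cong)
      (auto simp: angular_integral[OF s] f_def space_restrict_space)
  also have "\<dots> = enn2ereal (\<integral>\<^sup>+ r. ennreal (f r + k r) \<partial>restrict_space lborel {0<..})
      - ereal (K * (1 / s) + d / s * ln s)"
  proof (subst extended_integral_add[OF _ k'(1)])
    show "f \<in> borel_measurable (restrict_space lborel {0<..})"
      by (rule measurable_restrict_space1) simp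
    show "0 \<le> f r + k r" if "r \<in> space (restrict_space lborel {0<..})" for r
      using that s nonneg[of "r / s"] by (subst fk) (auto simp: space_restrict_space)
  qed (simp add: k'(2))
  also have "(\<integral>\<^sup>+ r. ennreal (f r + k r) \<partial>restrict_space lborel {0<..})
     = (\<integral>\<^sup>+ r. ennreal ((profile (r / s) + (if r / s < 1 then d * (r / s) else K)) / r\<^sup>2) * indicator {0<..} r \<partial>lborel)"
    by (subst nn_integral_restrict_space) (auto intro!: nn_integral_cong simp: fk split: split_indicator)
  also have "\<dots> = ennreal s * (\<integral>\<^sup>+ t. ennreal ((profile t + (if t < 1 then d * t else K)) / (s * t)\<^sup>2) * indicator {0<..} t \<partial>lborel)"
    by (subst nn_integral_real_affine[where c=s and t=0])
      (use s in \<open>auto intro!: arg_cong2[where f=times] nn_integral_cong simp: zero_less_mult_iff split: split_indicator\<close>)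
  also have "\<dots> = ennreal s * (\<integral>\<^sup>+ t. ennreal (1 / s\<^sup>2) * (indicator {0<..} t * ennreal ((profile t + (if t < 1 then d * t else K)) / t\<^sup>2)) \<partial>lborel)"
  proof (rule arg_cong2[where f=times, OF refl], rule nn_integral_cong)
    fix t :: real
    define A where "A = profile t + (if t < 1 then d * t else K)"
    have "A \<ge> 0" if "t > 0" using nonneg[OF that] by (simp add: A_def)
    then have "ennreal (A / (s * t)\<^sup>2) = ennreal (1 / s\<^sup>2) * ennreal (A / t\<^sup>2)" if "t > 0"
      using that s by (subst ennreal_mult[symmetric]) (simp_all add: power_mult_distrib)
    then show "ennreal ((profile t + (if t < 1 then d * t else K)) / (s * t)\<^sup>2) * indicator {0<..} t
      = ennreal (1 / s\<^sup>2) * (indicator {0<..} t * ennreal ((profile t + (if t < 1 then d * t else K)) / t\<^sup>2))"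
      unfolding A_def[symmetric] by (simp split: split_indicator)
  qed
  also have "\<dots> = ennreal (1 / s) * renormalized_energy"
    using s unfolding renormalized_energy_def
    by (subst nn_integral_cmult) (auto simp: power2_eq_square simp flip: mult.assoc ennreal_mult)
  finally have E: "energy (\<lambda>x. u (x /\<^sub>R s)) = enn2ereal (ennreal (1 / s) * renormalized_energy) - ereal (K * (1 / s) + d / s * ln s)" .
  show ?thesis
  proof (cases renormalized_energy)
    case (real j)
    then show ?thesis
      using s unfolding E
      by (subst real(2), subst real(2), subst ennreal_mult[symmetric]) (simp_all add: enn2ereal_ennreal field_simps)
  next
    case top
    then show ?thesis
      using s unfolding E by (simp add: ennreal_mult_top)
  qed
qed

text \<open>The function \<open>d * (m - ln s) / s\<close> has its minimum at
  \<open>s = exp (1 + m)\<close>. That the minimum is attained matters, since \<open>LEAST\<close>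
  is unspecified otherwise; for infinite renormalized energy all scalings have energy
  \<open>\<infinity>\<close>.\<close>

theorem least_energy_scaled:
  "(LEAST e. \<exists>s>0. e = energy (\<lambda>x. u (x /\<^sub>R s)))
    = (if renormalized_energy = \<infinity> then \<infinity>
       else ereal (- d * exp (- 1 - (enn2real renormalized_energy - K) / d)))"
proof (cases renormalized_energy)
  case (real j)
  define m where "m = (j - K) / d"
  have E: "energy (\<lambda>x. u (x /\<^sub>R s)) = ereal (d * (m - ln s) / s)" if "0 < s" for s
    using that d_pos real(1) by (subst energy_scaled[OF that]) (simp add: real enn2ereal_ennreal m_def field_simps)
  have bound: "- d * exp (- 1 - m) \<le> d * (m - ln s) / s" if s: "0 < s" for s
  proof -
    \<comment> \<open>This is \<open>ln y \<le> y - 1\<close>, with equality for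
      \<open>y = 1\<close>, that is, exactly at the minimiser
      \<open>s = exp (1 + m)\<close>.\<close>
    have "ln (s * exp (- 1 - m)) \<le> s * exp (- 1 - m) - 1"
      using s by (intro ln_le_minus_one) simp
    then have "ln s - m \<le> s * exp (- 1 - m)"
      using s by (simp add: ln_mult)
    then have "d * (ln s - m) \<le> d * (s * exp (- 1 - m))"
      using d_pos by (intro mult_left_mono) auto
    then show ?thesis
      using s by (simp add: field_simps)
  qed
  have attained: "d * (m - ln (exp (1 + m))) / exp (1 + m) = - d * exp (- 1 - m)"
    by (simp add: exp_minus[symmetric] divide_inverse)
  have "(LEAST e. \<exists>s>0. e = energy (\<lambda>x. u (x /\<^sub>R s))) = ereal (- d * exp (- 1 - m))"
  proof (rule Least_equality)
    show "\<exists>s>0. ereal (- d * exp (- 1 - m)) = energy (\<lambda>x. u (x /\<^sub>R s))"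
      using E[of "exp (1 + m)"] attained by (intro exI[of _ "exp (1 + m)"]) simp
  next
    fix e assume "\<exists>s>0. e = energy (\<lambda>x. u (x /\<^sub>R s))"
    then show "ereal (- d * exp (- 1 - m)) \<le> e"
      using E bound by auto
  qed
  then show ?thesis by (simp add: real m_def)
next
  case top
  have E: "energy (\<lambda>x. u (x /\<^sub>R s)) = \<infinity>" if "0 < s" for s
    using that by (subst energy_scaled[OF that]) (simp add: top)
  have "(LEAST e. \<exists>s>0. e = energy (\<lambda>x. u (x /\<^sub>R s))) = \<infinity>"
  proof (rule Least_equality)
    show "\<exists>s>0. \<infinity> = energy (\<lambda>x. u (x /\<^sub>R s))"
      using E[OF zero_less_one, symmetric] zero_less_one by blast
  qed (use E in auto)
  then show ?thesis by (simp add: top)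
qed

end

section \<open>Lattices and periodic sets\<close>

locale planar_lattice =
  fixes \<Lambda> :: "(real^2) set" and v w :: "real^2"
  assumes basis: "lattice_basis \<Lambda> v w"
begin

definition det2 :: real where "det2 = v $ 1 * w $ 2 - v $ 2 * w $ 1"
definition coord1 :: "real^2 \<Rightarrow> real" where "coord1 x = (x $ 1 * w $ 2 - x $ 2 * w $ 1) / det2"
definition coord2 :: "real^2 \<Rightarrow> real" where "coord2 x = (v $ 1 * x $ 2 - v $ 2 * x $ 1) / det2"
definition lpt :: "int \<times> int \<Rightarrow> real^2" where "lpt p = of_int (fst p) *\<^sub>R v + of_int (snd p) *\<^sub>R w"
text \<open>Enumerating the lattice by natural numbers turns lattice sums into \<open>suminf\<close>
  of nonnegative terms, which commutes with \<open>nn_integral\<close>.\<close>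

definition pt :: "nat \<Rightarrow> real^2" where "pt n = lpt (from_nat_into UNIV n)"

abbreviation cell :: "(real^2) set" where "cell \<equiv> periodicity_cell v w"
abbreviation covol :: real where "covol \<equiv> measure lborel cell"

lemma lattice_eq: "\<Lambda> = range lpt"
  using basis by (auto simp: lattice_basis_def lpt_def image_iff) blast

lemma det2_nonzero: "det2 \<noteq> 0"
proof
  assume 0: "det2 = 0"
  have ind: "independent {v, w}" and neq: "v \<noteq> w" using basis by (auto simp: lattice_basis_def)
  have comb: "a = 0 \<and> b = 0" if "a *\<^sub>R v + b *\<^sub>R w = 0" for a b
  proof -
    have "(\<Sum>x\<in>{v, w}. (if x = v then a else b) *\<^sub>R x) = 0"
      using that neq by auto
    from independentD[OF ind _ _ this] neq show ?thesis by force
  qed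
  have "w $ 1 *\<^sub>R v + (- v $ 1) *\<^sub>R w = 0" "w $ 2 *\<^sub>R v + (- v $ 2) *\<^sub>R w = 0"
    using 0 by (auto simp: vec_eq_iff forall_2 det2_def algebra_simps)
  from comb[OF this(1)] comb[OF this(2)] have "v = 0" by (simp add: vec_eq_iff forall_2)
  with ind show False by (simp add: dependent_zero)
qed

lemma coord_expansion: "coord1 x *\<^sub>R v + coord2 x *\<^sub>R w = x"
  using det2_nonzero
  by (simp add: vec_eq_iff forall_2 coord1_def coord2_def divide_simps) (simp add: det2_def algebra_simps)

lemma coord_combination [simp]:
  "coord1 (s *\<^sub>R v + t *\<^sub>R w) = s" "coord2 (s *\<^sub>R v + t *\<^sub>R w) = t"
  using det2_nonzero by (simp_all add: coord1_def coord2_def divide_simps) (simp_all add: det2_def algebra_simps)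

lemma coord_add: "coord1 (x + y) = coord1 x + coord1 y" "coord2 (x + y) = coord2 x + coord2 y"
  "coord1 (x - y) = coord1 x - coord1 y" "coord2 (x - y) = coord2 x - coord2 y"
  by (simp_all add: coord1_def coord2_def add_divide_distrib[symmetric] diff_divide_distrib[symmetric] algebra_simps)

lemma coord_lpt: "coord1 (lpt p) = of_int (fst p)" "coord2 (lpt p) = of_int (snd p)"
  by (simp_all add: lpt_def)

lemma cell_iff: "x \<in> cell \<longleftrightarrow> 0 \<le> coord1 x \<and> coord1 x < 1 \<and> 0 \<le> coord2 x \<and> coord2 x < 1"
proof
  assume "x \<in> cell" then show "0 \<le> coord1 x \<and> coord1 x < 1 \<and> 0 \<le> coord2 x \<and> coord2 x < 1"
    by (auto simp: periodicity_cell_def)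
next
  assume "0 \<le> coord1 x \<and> coord1 x < 1 \<and> 0 \<le> coord2 x \<and> coord2 x < 1"
  then show "x \<in> cell"
    using coord_expansion[of x, symmetric] unfolding periodicity_cell_def by blast
qed

lemma cell_borel [measurable]: "cell \<in> sets borel"
proof -
  have "cell = {x. 0 \<le> coord1 x \<and> coord1 x < 1 \<and> 0 \<le> coord2 x \<and> coord2 x < 1}"
    using cell_iff by auto
  also have "\<dots> \<in> sets borel" unfolding coord1_def coord2_def by measurable
  finally show ?thesis .
qed

lemma inj_lpt: "inj lpt"
  by (rule injI) (metis coord_lpt of_int_eq_iff prod_eq_iff)

lemma bij_pt: "bij_betw pt UNIV \<Lambda>"
proof -
  have "infinite (UNIV :: (int \<times> int) set)"
    by (simp add: finite_prod)
  then have "bij_betw (from_nat_into (UNIV :: (int \<times> int) set)) UNIV UNIV"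
    by (intro bij_betw_from_nat_into) auto
  moreover have "bij_betw lpt UNIV \<Lambda>"
    using inj_lpt by (simp add: bij_betw_def lattice_eq)
  ultimately show ?thesis
    unfolding pt_def[abs_def] using bij_betw_trans by (fastforce simp: comp_def)
qed

lemma pt_in: "pt n \<in> \<Lambda>" using bij_pt by (auto simp: bij_betw_def)

lemma pt_exists: "q \<in> \<Lambda> \<Longrightarrow> \<exists>n. q = pt n" using bij_pt by (auto simp: bij_betw_def)

lemma zero_in [simp]: "0 \<in> \<Lambda>"
  unfolding lattice_eq by (rule image_eqI[of _ _ "(0, 0)"]) (auto simp: lpt_def)

lemma add_in: "p \<in> \<Lambda> \<Longrightarrow> q \<in> \<Lambda> \<Longrightarrow> p + q \<in> \<Lambda>"
proof -
  assume "p \<in> \<Lambda>" "q \<in> \<Lambda>"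
  then obtain a b where "p = lpt a" "q = lpt b" by (auto simp: lattice_eq)
  then have "p + q = lpt (fst a + fst b, snd a + snd b)"
    by (simp add: lpt_def algebra_simps)
  then show ?thesis by (simp add: lattice_eq)
qed

lemma uminus_in: "p \<in> \<Lambda> \<Longrightarrow> - p \<in> \<Lambda>"
proof -
  assume "p \<in> \<Lambda>"
  then obtain a where "p = lpt a" by (auto simp: lattice_eq)
  then have "- p = lpt (- fst a, - snd a)"
    by (simp add: lpt_def algebra_simps)
  then show ?thesis by (simp add: lattice_eq)
qed

lemma diff_in: "p \<in> \<Lambda> \<Longrightarrow> q \<in> \<Lambda> \<Longrightarrow> p - q \<in> \<Lambda>"
  using add_in[OF _ uminus_in, of p q] by simp

definition spread :: "(real^2) set \<Rightarrow> (real^2) set" where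
  "spread B = {x. \<exists>q\<in>\<Lambda>. x - q \<in> B}"

text \<open>Distinct lattice translates of \<open>B\<close> are disjoint. Both the periodicity cell
  and a ball of admissible radius are of this kind.\<close>

definition packing :: "(real^2) set \<Rightarrow> bool" where
  "packing B \<longleftrightarrow> B \<in> sets borel \<and> (\<forall>x\<in>B. \<forall>q\<in>\<Lambda>. x + q \<in> B \<longrightarrow> q = 0)"

lemma spread_borel: "B \<in> sets borel \<Longrightarrow> spread B \<in> sets borel"
proof -
  assume [measurable]: "B \<in> sets borel"
  have "spread B = (\<Union>n. {x. x - pt n \<in> B})"
    unfolding spread_def using pt_in pt_exists by auto blast
  also have "\<dots> \<in> sets borel" by measurable
  finally show ?thesis .
qed

lemma spread_shift: "q \<in> \<Lambda> \<Longrightarrow> x + q \<in> spread B \<longleftrightarrow> x \<in> spread B"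
proof -
  have *: "x + q \<in> spread B" if "x \<in> spread B" "q \<in> \<Lambda>" for x q
    using that add_in by (force simp: spread_def algebra_simps)
  assume "q \<in> \<Lambda>"
  then show ?thesis using *[of x q] *[of "x + q" "- q"] uminus_in by auto
qed

lemma subset_spread: "B \<subseteq> spread B"
  by (auto simp: spread_def intro!: bexI[of _ 0])

text \<open>At most one translate contains \<open>x\<close>: two of them would give a nonzero
  lattice vector joining two points of \<open>B\<close>.\<close>

lemma suminf_packing:
  assumes "packing B"
  shows "(\<Sum>n. indicator B (x - pt n)) = (indicator (spread B) x :: ennreal)"
proof (cases "x \<in> spread B")
  case True
  then obtain n where n: "x - pt n \<in> B" using pt_exists by (auto simp: spread_def)
  have uniq: "m = n" if "x - pt m \<in> B" for m
  proof -
    have "x - pt n + (pt n - pt m) \<in> B" using that by simp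
    then have "pt n - pt m = 0"
      using assms n pt_in diff_in unfolding packing_def by blast
    then show ?thesis using bij_pt by (auto simp: bij_betw_def inj_on_def)
  qed
  have "(\<Sum>n. indicator B (x - pt n)) = (\<Sum>m\<in>{n}. indicator B (x - pt m) :: ennreal)"
    by (rule suminf_finite) (use uniq in \<open>auto simp: indicator_def\<close>)
  then show ?thesis using n True by simp
next
  case False
  then have "indicator B (x - pt n) = (0 :: ennreal)" for n
    using pt_in by (auto simp: spread_def indicator_def)
  then show ?thesis using False by simp
qed

lemma packing_cell: "packing cell"
proof -
  have "q = 0" if xq: "x \<in> cell" "q \<in> \<Lambda>" "x + q \<in> cell" for x q
  proof -
    obtain p where p: "q = lpt p" using xq lattice_eq by blast
    have "\<bar>of_int (fst p) :: real\<bar> < 1" "\<bar>of_int (snd p) :: real\<bar> < 1"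
      using xq by (auto simp: cell_iff p coord_add coord_lpt)
    then have "fst p = 0" "snd p = 0" by linarith+
    then show ?thesis by (simp add: p lpt_def)
  qed
  then show ?thesis by (auto simp: packing_def)
qed

lemma spread_cell: "spread cell = UNIV"
proof -
  have "x \<in> spread cell" for x
  proof -
    have "x - lpt (\<lfloor>coord1 x\<rfloor>, \<lfloor>coord2 x\<rfloor>) \<in> cell"
      by (simp add: cell_iff coord_add coord_lpt) linarith
    moreover have "lpt (\<lfloor>coord1 x\<rfloor>, \<lfloor>coord2 x\<rfloor>) \<in> \<Lambda>" by (simp add: lattice_eq)
    ultimately show ?thesis unfolding spread_def by blast
  qed
  then show ?thesis by auto
qed

section \<open>Folding integrals over the plane into one cell\<close>

definition periodic :: "(real^2 \<Rightarrow> 'b) \<Rightarrow> bool" where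
  "periodic F \<longleftrightarrow> (\<forall>q\<in>\<Lambda>. \<forall>x. F (x + q) = F x)"

text \<open>The tiling enters as \<open>suminf_packing\<close> for the cell: its translates cover
  every point exactly once, so the integrand may be multiplied by their sum.\<close>

lemma nn_integral_unfold:
  assumes [measurable]: "g \<in> borel_measurable borel"
  shows "(\<integral>\<^sup>+ x. g x \<partial>lborel) = (\<integral>\<^sup>+ x. indicator cell x * (\<Sum>n. g (x + pt n)) \<partial>lborel)"
proof -
  have "(\<integral>\<^sup>+ x. g x \<partial>lborel) = (\<integral>\<^sup>+ x. (\<Sum>n. g x * indicator cell (x - pt n)) \<partial>lborel)"
    by (intro nn_integral_cong) (simp add: ennreal_suminf_cmult suminf_packing packing_cell spread_cell)
  also have "\<dots> = (\<Sum>n. \<integral>\<^sup>+ x. g x * indicator cell (x - pt n) \<partial>lborel)"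
    by (rule nn_integral_suminf) measurable
  also have "\<dots> = (\<Sum>n. \<integral>\<^sup>+ x. g (x + pt n) * indicator cell x \<partial>lborel)"
  proof (intro arg_cong[where f=suminf] ext)
    fix n
    show "(\<integral>\<^sup>+ x. g x * indicator cell (x - pt n) \<partial>lborel) = (\<integral>\<^sup>+ x. g (x + pt n) * indicator cell x \<partial>lborel)"
      by (subst nn_integral_lborel_translate[symmetric, where c="pt n"]) auto
  qed
  also have "\<dots> = (\<integral>\<^sup>+ x. (\<Sum>n. g (x + pt n) * indicator cell x) \<partial>lborel)"
    by (rule nn_integral_suminf[symmetric]) measurable
  also have "\<dots> = (\<integral>\<^sup>+ x. indicator cell x * (\<Sum>n. g (x + pt n)) \<partial>lborel)"
    by (intro nn_integral_cong) (simp add: ennreal_suminf_multc mult.commute)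
  finally show ?thesis .
qed

text \<open>Negation permutes the lattice, and a sum of nonnegative terms does not depend on the
  order.\<close>

lemma suminf_pt_uminus:
  fixes f :: "real^2 \<Rightarrow> ennreal"
  shows "(\<Sum>n. f (- pt n)) = (\<Sum>n. f (pt n))"
proof -
  define \<sigma> where "\<sigma> n = the_inv_into UNIV pt (- pt n)" for n
  have inj: "inj pt" using bij_pt by (simp add: bij_betw_def)
  have \<sigma>: "pt (\<sigma> n) = - pt n" for n
    using bij_pt uminus_in[OF pt_in, of n] f_the_inv_into_f[OF inj, of "- pt n"]
    by (simp add: \<sigma>_def bij_betw_def)
  have "\<sigma> (\<sigma> n) = n" for n
    using inj \<sigma>[of "\<sigma> n"] \<sigma>[of n] by (auto dest: injD)
  then have "bij_betw \<sigma> UNIV UNIV"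
    by (intro bij_betw_byWitness[where f'=\<sigma>]) auto
  then have "(\<integral>\<^sup>+ n. f (pt (\<sigma> n)) \<partial>count_space UNIV) = (\<integral>\<^sup>+ n. f (pt n) \<partial>count_space UNIV)"
    by (rule nn_integral_bij_count_space)
  then show ?thesis
    by (simp add: nn_integral_count_space_nat \<sigma>)
qed

text \<open>After unfolding, periodicity pulls \<open>F\<close> out of the lattice sum, and the
  symmetry of the lattice reverses the sign of the translation.\<close>

lemma nn_integral_fold:
  fixes F :: "real^2 \<Rightarrow> ennreal"
  assumes [measurable]: "F \<in> borel_measurable borel" and F: "periodic F"
    and [measurable]: "G \<in> borel_measurable borel"
  shows "(\<integral>\<^sup>+ x. F x * G x \<partial>lborel) = (\<integral>\<^sup>+ x. indicator cell x * (F x * (\<Sum>n. G (x - pt n))) \<partial>lborel)"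
proof -
  have "(\<integral>\<^sup>+ x. F x * G x \<partial>lborel) = (\<integral>\<^sup>+ x. indicator cell x * (\<Sum>n. F (x + pt n) * G (x + pt n)) \<partial>lborel)"
    by (rule nn_integral_unfold) measurable
  also have "\<dots> = (\<integral>\<^sup>+ x. indicator cell x * (F x * (\<Sum>n. G (x + pt n))) \<partial>lborel)"
    using F pt_in by (intro nn_integral_cong) (simp add: periodic_def ennreal_suminf_cmult)
  also have "\<dots> = (\<integral>\<^sup>+ x. indicator cell x * (F x * (\<Sum>n. G (x - pt n))) \<partial>lborel)"
    using suminf_pt_uminus[of "\<lambda>q. G (_ + q)"] by simp
  finally show ?thesis .
qed

text \<open>Modulo the lattice, \<open>B\<close> and the part of the cell that its translates cover
  are the same set.\<close>

lemma nn_integral_packing: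
  fixes F :: "real^2 \<Rightarrow> ennreal"
  assumes [measurable]: "F \<in> borel_measurable borel" and F: "periodic F" and B: "packing B"
  shows "(\<integral>\<^sup>+ x. F x * indicator B x \<partial>lborel) = (\<integral>\<^sup>+ x. indicator cell x * (F x * indicator (spread B) x) \<partial>lborel)"
proof -
  have [measurable]: "B \<in> sets borel" using B by (simp add: packing_def)
  show ?thesis
    by (subst nn_integral_fold[OF _ F]) (use B in \<open>auto simp: suminf_packing\<close>)
qed

text \<open>The translated cell tiles the plane as well, so folding its indicator function gives the
  constant 1.\<close>

lemma nn_integral_cell_translate:
  fixes F :: "real^2 \<Rightarrow> ennreal"
  assumes [measurable]: "F \<in> borel_measurable borel" and F: "periodic F"
  shows "(\<integral>\<^sup>+ x. indicator cell x * F (x + y) \<partial>lborel) = (\<integral>\<^sup>+ x. indicator cell x * F x \<partial>lborel)"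
proof -
  have "(\<integral>\<^sup>+ x. indicator cell x * F (x + y) \<partial>lborel) = (\<integral>\<^sup>+ x. F x * indicator cell (x - y) \<partial>lborel)"
    by (subst (2) nn_integral_lborel_translate[symmetric, where c=y]) (auto simp: mult.commute)
  also have "\<dots> = (\<integral>\<^sup>+ x. indicator cell x * (F x * (\<Sum>n. indicator cell ((x - y) - pt n))) \<partial>lborel)"
    by (subst nn_integral_fold[OF _ F]) (auto simp: algebra_simps)
  also have "\<dots> = (\<integral>\<^sup>+ x. indicator cell x * F x \<partial>lborel)"
    by (simp add: suminf_packing[OF packing_cell] spread_cell)
  finally show ?thesis .
qed

section \<open>Means over large squares and the autocorrelation of a periodic set\<close>

abbreviation sq :: "real \<Rightarrow> (real^2) set" where "sq R \<equiv> cbox (vec (- R)) (vec R)"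

lemma mem_box2: "x \<in> sq R \<longleftrightarrow> \<bar>x $ 1\<bar> \<le> R \<and> \<bar>x $ 2\<bar> \<le> R"
  by (auto simp: mem_box_cart forall_2)

definition diam :: real where "diam = \<bar>v $ 1\<bar> + \<bar>v $ 2\<bar> + \<bar>w $ 1\<bar> + \<bar>w $ 2\<bar>"

lemma diam_nonneg: "0 \<le> diam" by (simp add: diam_def)

lemma cell_subset_box: "cell \<subseteq> sq diam"
proof
  fix x assume "x \<in> cell"
  then obtain s t where st: "x = s *\<^sub>R v + t *\<^sub>R w" "0 \<le> s" "s < 1" "0 \<le> t" "t < 1"
    by (auto simp: periodicity_cell_def)
  have *: "\<bar>s * a + t * b\<bar> \<le> \<bar>a\<bar> + \<bar>b\<bar>" for a b :: real
    using st mult_right_mono[of "\<bar>s\<bar>" 1 "\<bar>a\<bar>"] mult_right_mono[of "\<bar>t\<bar>" 1 "\<bar>b\<bar>"]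
      abs_triangle_ineq[of "s * a" "t * b"] by (simp add: abs_mult)
  show "x \<in> sq diam"
    unfolding mem_box2 diam_def st by (auto intro!: order_trans[OF *])
qed

lemma emeasure_cell_finite: "emeasure lborel cell < \<infinity>"
  by (rule le_less_trans[OF emeasure_mono[OF cell_subset_box]]) (auto simp: emeasure_lborel_cbox_eq)

text \<open>If the cell were a null set, unfolding the constant 1 would give the whole plane measure
  0. No formula for the area is involved.\<close>

lemma covol_pos: "0 < covol"
proof (rule ccontr)
  assume "\<not> 0 < covol"
  then have "covol = 0" using measure_nonneg[of lborel cell] by linarith
  then have "emeasure lborel cell = 0"
    using emeasure_cell_finite by (auto simp: measure_def enn2real_eq_0_iff)
  then have "AE x in lborel. x \<notin> cell"
    by (intro AE_not_in) (auto simp: null_sets_def)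
  have "(\<integral>\<^sup>+ x. indicator cell x * (\<Sum>n. 1) \<partial>lborel) = (\<integral>\<^sup>+ x. 0 \<partial>(lborel :: (real^2) measure))"
  proof (rule nn_integral_cong_AE)
    from \<open>AE x in lborel. x \<notin> cell\<close>
    show "AE x in lborel. indicator cell x * (\<Sum>n. 1) = (0 :: ennreal)"
      by eventually_elim simp
  qed
  moreover have "(\<integral>\<^sup>+ x. 1 \<partial>(lborel :: (real^2) measure)) = (\<integral>\<^sup>+ x. indicator cell x * (\<Sum>n. 1) \<partial>lborel)"
    by (rule nn_integral_unfold) simp
  ultimately show False by simp
qed

lemma emeasure_cell: "emeasure lborel cell = ennreal covol"
  using emeasure_cell_finite by (intro emeasure_eq_ennreal_measure) auto

definition cnt :: "real \<Rightarrow> ennreal" where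
  "cnt R = (\<Sum>n. indicator (sq R) (pt n))"

text \<open>Folding a square into the cell counts the lattice points \<open>q\<close> with
  \<open>x - q\<close> in the square. For \<open>x\<close> in the cell this number lies between the
  counts for the squares with half-side changed by \<open>diam\<close>, which no longer depend on
  \<open>x\<close>.\<close>

lemma box_integral_bounds:
  fixes F :: "real^2 \<Rightarrow> ennreal"
  assumes [measurable]: "F \<in> borel_measurable borel" and F: "periodic F"
  defines "m \<equiv> \<integral>\<^sup>+ x. indicator cell x * F x \<partial>lborel"
  shows "cnt (R - diam) * m \<le> (\<integral>\<^sup>+ x. F x * indicator (sq R) x \<partial>lborel)"
    "(\<integral>\<^sup>+ x. F x * indicator (sq R) x \<partial>lborel) \<le> cnt (R + diam) * m"
proof -
  have eq: "(\<integral>\<^sup>+ x. F x * indicator (sq R) x \<partial>lborel)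
      = (\<integral>\<^sup>+ x. indicator cell x * (F x * (\<Sum>n. indicator (sq R) (x - pt n))) \<partial>lborel)"
    by (rule nn_integral_fold[OF _ F]) auto
  have c: "cnt S * m = (\<integral>\<^sup>+ x. indicator cell x * (F x * cnt S) \<partial>lborel)" for S
    unfolding m_def by (subst nn_integral_cmult[symmetric]) (auto simp: mult_ac)
  have "cnt (R - diam) \<le> (\<Sum>n. indicator (sq R) (x - pt n))"
    "(\<Sum>n. indicator (sq R) (x - pt n)) \<le> cnt (R + diam)" if "x \<in> cell" for x
  proof -
    have x: "\<bar>x $ 1\<bar> \<le> diam" "\<bar>x $ 2\<bar> \<le> diam"
      using that cell_subset_box mem_box2 by blast+
    have "x - pt n \<in> sq R" if "pt n \<in> sq (R - diam)" for n
      using that x unfolding mem_box2 by auto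
    moreover have "pt n \<in> sq (R + diam)" if "x - pt n \<in> sq R" for n
      using that x unfolding mem_box2 by auto
    ultimately show "cnt (R - diam) \<le> (\<Sum>n. indicator (sq R) (x - pt n))"
      "(\<Sum>n. indicator (sq R) (x - pt n)) \<le> cnt (R + diam)"
      unfolding cnt_def by (auto intro!: suminf_le simp: indicator_def)
  qed
  then have "indicator cell x * (F x * cnt (R - diam)) \<le> indicator cell x * (F x * (\<Sum>n. indicator (sq R) (x - pt n)))"
    "indicator cell x * (F x * (\<Sum>n. indicator (sq R) (x - pt n))) \<le> indicator cell x * (F x * cnt (R + diam))" for x
    by (cases "x \<in> cell"; simp add: mult_left_mono)+
  then show "cnt (R - diam) * m \<le> (\<integral>\<^sup>+ x. F x * indicator (sq R) x \<partial>lborel)"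
    "(\<integral>\<^sup>+ x. F x * indicator (sq R) x \<partial>lborel) \<le> cnt (R + diam) * m"
    unfolding eq c by (auto intro!: nn_integral_mono)
qed

lemma cnt_bounds:
  assumes "0 \<le> R"
  shows "cnt (R - diam) * ennreal covol \<le> ennreal ((2 * R)\<^sup>2)"
    "ennreal ((2 * R)\<^sup>2) \<le> cnt (R + diam) * ennreal covol"
proof -
  have "periodic (\<lambda>_. 1 :: ennreal)" by (simp add: periodic_def)
  from box_integral_bounds[OF _ this, of R]
  have "cnt (R - diam) * emeasure lborel cell \<le> emeasure lborel (sq R)"
    "emeasure lborel (sq R) \<le> cnt (R + diam) * emeasure lborel cell"
    by simp_all
  moreover have "emeasure lborel (sq R) = ennreal ((2 * R)\<^sup>2)"
    by (subst emeasure_eq_ennreal_measure) (simp_all only: content_cbox_vec2[OF assms], simp add: emeasure_lborel_cbox_eq)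
  ultimately show "cnt (R - diam) * ennreal covol \<le> ennreal ((2 * R)\<^sup>2)"
    "ennreal ((2 * R)\<^sup>2) \<le> cnt (R + diam) * ennreal covol"
    by (simp_all add: emeasure_cell)
qed

text \<open>The lattice point count is eliminated through \<open>cnt_bounds\<close>, the same
  estimate for the constant function 1. The integral is then caught between areas of squares of
  half-side \<open>R - 2 * diam\<close> and \<open>R + 2 * diam\<close>, whose ratio to the area of
  \<open>sq R\<close> tends to 1.\<close>

lemma box_mean_tendsto:
  fixes F :: "real^2 \<Rightarrow> real"
  assumes [measurable]: "F \<in> borel_measurable borel" and F: "periodic F" "\<And>x. 0 \<le> F x"
    and m: "(\<integral>\<^sup>+ x. indicator cell x * ennreal (F x) \<partial>lborel) = ennreal m" "0 \<le> m"
  shows "((\<lambda>R. (LINT x:sq R|lborel. F x) / measure lborel (sq R)) \<longlongrightarrow> m / covol) at_top"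
proof -
  define I where "I R = (\<integral>\<^sup>+ x. ennreal (F x) * indicator (sq R) x \<partial>lborel)" for R
  have F': "periodic (\<lambda>x. ennreal (F x))" using F by (simp add: periodic_def)
  note b = box_integral_bounds[OF _ F', unfolded m(1), folded I_def, simplified]
  have up: "I R \<le> ennreal ((2 * (R + 2 * diam))\<^sup>2 * m / covol)" if "0 \<le> R" for R
  proof -
    have "I R * ennreal covol \<le> cnt (R + diam) * ennreal m * ennreal covol"
      by (intro mult_right_mono b) auto
    also have "\<dots> = cnt ((R + 2 * diam) - diam) * ennreal covol * ennreal m"
      by (simp add: mult_ac add.commute)
    also have "\<dots> \<le> ennreal ((2 * (R + 2 * diam))\<^sup>2) * ennreal m"
      using that diam_nonneg by (intro mult_right_mono cnt_bounds) auto
    also have "\<dots> = ennreal ((2 * (R + 2 * diam))\<^sup>2 * m / covol) * ennreal covol"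
      using covol_pos m(2) by (simp flip: ennreal_mult)
    finally show ?thesis
      using covol_pos by (subst (asm) (1 2) mult.commute, subst (asm) ennreal_mult_le_mult_iff) auto
  qed
  have low: "ennreal ((2 * (R - 2 * diam))\<^sup>2 * m / covol) \<le> I R" if "2 * diam \<le> R" for R
  proof -
    have "ennreal ((2 * (R - 2 * diam))\<^sup>2 * m / covol) * ennreal covol = ennreal ((2 * (R - 2 * diam))\<^sup>2) * ennreal m"
      using covol_pos m(2) by (simp flip: ennreal_mult)
    also have "\<dots> \<le> cnt ((R - 2 * diam) + diam) * ennreal covol * ennreal m"
      using that diam_nonneg by (intro mult_right_mono cnt_bounds) auto
    also have "\<dots> = cnt (R - diam) * ennreal m * ennreal covol"
      by (simp add: mult_ac)
    also have "\<dots> \<le> I R * ennreal covol"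
      by (intro mult_right_mono b) auto
    finally show ?thesis
      using covol_pos by (subst (asm) (1 2) mult.commute, subst (asm) ennreal_mult_le_mult_iff) auto
  qed
  have LI: "(LINT x:sq R|lborel. F x) = enn2real (I R)" for R
    unfolding set_lebesgue_integral_def I_def using F(2)
    by (subst integral_eq_nn_integral)
      (auto intro!: arg_cong[where f=enn2real] nn_integral_cong split: split_indicator)
  define h where "h t = (1 + t) * (1 + t) * m / covol" for t :: real
  have lim0: "((\<lambda>R. a / R) \<longlongrightarrow> 0) at_top" for a :: real
    by (intro tendsto_divide_0[OF tendsto_const] filterlim_at_top_imp_at_infinity filterlim_ident)
  have limh: "((\<lambda>R. h (a / R)) \<longlongrightarrow> m / covol) at_top" for a :: real
  proof -
    have "((\<lambda>R. h (a / R)) \<longlongrightarrow> h 0) at_top"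
      unfolding h_def using covol_pos by (intro tendsto_intros lim0) auto
    then show ?thesis by (simp add: h_def)
  qed
  show ?thesis
  proof (rule tendsto_sandwich[OF _ _ limh[of "- 2 * diam"] limh[of "2 * diam"]])
    have ev: "eventually (\<lambda>R. 2 * diam + 1 \<le> R) at_top" by (rule eventually_ge_at_top)
    have h_eq: "h (a / R) = (2 * (R + a))\<^sup>2 * m / covol / (2 * R)\<^sup>2" if "R > 0" for a R :: real
    proof -
      have "2 * (R + a) = 2 * R * (1 + a / R)" using that by (simp add: field_simps)
      then show ?thesis using that by (simp add: h_def power_mult_distrib power2_eq_square)
    qed
    show "eventually (\<lambda>R. h (- 2 * diam / R) \<le> (LINT x:sq R|lborel. F x) / measure lborel (sq R)) at_top"
      using ev
    proof eventually_elim
      case (elim R)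
      then have R: "R > 0" "2 * diam \<le> R" "0 \<le> R" using diam_nonneg by linarith+
      have bd: "(2 * (R - 2 * diam))\<^sup>2 * m / covol \<le> enn2real (I R)"
        using low[OF R(2)] up[OF R(3)] m(2) covol_pos
        by (cases "I R") (auto simp: top_unique)
      then show ?case
        using divide_right_mono[OF bd zero_le_power2, of "2 * R"] R h_eq[OF R(1), of "- 2 * diam"]
        by (simp only: LI content_cbox_vec2[OF R(3)]) simp
    qed
    show "eventually (\<lambda>R. (LINT x:sq R|lborel. F x) / measure lborel (sq R) \<le> h (2 * diam / R)) at_top"
      using ev
    proof eventually_elim
      case (elim R)
      then have R: "R > 0" "2 * diam \<le> R" "0 \<le> R" using diam_nonneg by linarith+
      have bd: "enn2real (I R) \<le> (2 * (R + 2 * diam))\<^sup>2 * m / covol"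
        using up[OF R(3)] m(2) covol_pos
        by (cases "I R") (auto simp: top_unique)
      then show ?case
        using divide_right_mono[OF bd zero_le_power2, of "2 * R"] R h_eq[OF R(1), of "2 * diam"]
        by (simp only: LI content_cbox_vec2[OF R(3)])
    qed
  qed
qed

text \<open>The product inside the limit is periodic, so its mean over squares is a cell integral;
  \<open>nn_integral_packing\<close> then trades the cell for \<open>B\<close>.\<close>

lemma autocorrelation_spread:
  assumes B: "packing B"
  shows "autocorrelation (indicat_real (spread B)) z = measure lborel {x \<in> B. x + z \<in> spread B} / covol"
proof -
  have [measurable]: "B \<in> sets borel" "spread B \<in> sets borel"
    using B spread_borel by (auto simp: packing_def)
  define F where "F x = indicat_real (spread B) (x + z) * indicat_real (spread B) x" for x
  have per: "periodic (\<lambda>x. indicator (spread B) (x + z) :: ennreal)" "periodic F"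
    using spread_shift by (auto simp: periodic_def F_def indicator_def add.assoc add.commute[of _ z] simp flip: add.assoc)
  have "(\<integral>\<^sup>+ x. indicator cell x * ennreal (F x) \<partial>lborel)
     = (\<integral>\<^sup>+ x. indicator cell x * (indicator (spread B) (x + z) * indicator (spread B) x) \<partial>lborel)"
    by (intro nn_integral_cong) (auto simp: F_def indicator_def)
  also have "\<dots> = (\<integral>\<^sup>+ x. indicator (spread B) (x + z) * indicator B x \<partial>lborel)"
    by (rule nn_integral_packing[OF _ per(1) B, symmetric]) measurable
  also have "\<dots> = (\<integral>\<^sup>+ x. indicator {x \<in> B. x + z \<in> spread B} x \<partial>lborel)"
    by (intro nn_integral_cong) (auto simp: indicator_def)
  also have "\<dots> = emeasure lborel {x \<in> B. x + z \<in> spread B}"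
    by (rule nn_integral_indicator) measurable
  finally have m: "(\<integral>\<^sup>+ x. indicator cell x * ennreal (F x) \<partial>lborel) = emeasure lborel {x \<in> B. x + z \<in> spread B}" .
  moreover have "(\<integral>\<^sup>+ x. indicator cell x * ennreal (F x) \<partial>lborel) \<le> (\<integral>\<^sup>+ x. indicator cell x \<partial>lborel)"
    by (intro nn_integral_mono) (auto simp: F_def indicator_def)
  ultimately have "emeasure lborel {x \<in> B. x + z \<in> spread B} < \<infinity>"
    using emeasure_cell_finite by (auto simp: less_top top_unique)
  then have m': "(\<integral>\<^sup>+ x. indicator cell x * ennreal (F x) \<partial>lborel) = ennreal (measure lborel {x \<in> B. x + z \<in> spread B})"
    unfolding m by (intro emeasure_eq_ennreal_measure) auto
  have "((\<lambda>R. (LINT x:sq R|lborel. F x) / measure lborel (sq R)) \<longlongrightarrow>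
      measure lborel {x \<in> B. x + z \<in> spread B} / covol) at_top"
    by (rule box_mean_tendsto[OF _ per(2) _ m']) (auto simp: F_def)
  then show ?thesis
    unfolding autocorrelation_def F_def by (intro tendsto_Lim) auto
qed

lemma emeasure_packing_le:
  assumes "packing B"
  shows "emeasure lborel B \<le> ennreal covol"
proof -
  have [measurable]: "B \<in> sets borel" using assms by (auto simp: packing_def)
  have "emeasure lborel B = (\<integral>\<^sup>+ x. indicator cell x * (1 * indicator (spread B) x) \<partial>lborel)"
    using nn_integral_packing[OF _ _ assms, of "\<lambda>_. 1"] by (simp add: periodic_def)
  also have "\<dots> \<le> (\<integral>\<^sup>+ x. indicator cell x \<partial>lborel)"
    by (intro nn_integral_mono) (auto simp: indicator_def)
  finally show ?thesis by (simp add: emeasure_cell)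
qed

end

text \<open>The cell of one basis is a packing for the lattice, hence its area is at most that of
  the cell of any other basis. Exchanging the two bases gives equality, without integer
  matrices.\<close>

lemma cell_area_eq:
  assumes "lattice_basis \<Lambda> v w"
  shows "cell_area \<Lambda> = measure lborel (periodicity_cell v w)"
  unfolding cell_area_def
proof (rule the_equality)
  show "\<exists>v' w'. lattice_basis \<Lambda> v' w' \<and> measure lborel (periodicity_cell v w) = measure lborel (periodicity_cell v' w')"
    using assms by blast
next
  fix A assume "\<exists>v w. lattice_basis \<Lambda> v w \<and> A = measure lborel (periodicity_cell v w)"
  then obtain v' w' where 2: "lattice_basis \<Lambda> v' w'" "A = measure lborel (periodicity_cell v' w')"
    by blast
  interpret L: planar_lattice \<Lambda> v w by unfold_locales fact
  interpret L': planar_lattice \<Lambda> v' w' by unfold_locales fact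
  have "emeasure lborel (periodicity_cell v' w') \<le> emeasure lborel (periodicity_cell v w)"
    using L.emeasure_packing_le[of "periodicity_cell v' w'"] L'.packing_cell
    by (simp add: L.emeasure_cell L.packing_def L'.packing_def)
  moreover have "emeasure lborel (periodicity_cell v w) \<le> emeasure lborel (periodicity_cell v' w')"
    using L'.emeasure_packing_le[of "periodicity_cell v w"] L.packing_cell
    by (simp add: L'.emeasure_cell L.packing_def L'.packing_def)
  ultimately show "A = measure lborel (periodicity_cell v w)"
    by (simp add: 2 measure_def)
qed

lemma has_bochner_integral_nonneg:
  fixes c :: real
  shows "has_bochner_integral M f c \<Longrightarrow> (\<And>x. 0 \<le> f x) \<Longrightarrow> 0 \<le> c"
  by (auto simp: has_bochner_integral_iff intro: integral_nonneg)

section \<open>The autocorrelation as a cell integral, and the variance inequality\<close>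

context planar_lattice
begin

lemma spread_cong_shift: "q \<in> \<Lambda> \<Longrightarrow> x + q + z \<in> spread B \<longleftrightarrow> x + z \<in> spread B"
  using spread_shift[of q "x + z" B] by (simp add: algebra_simps)

lemma periodic_spread_product:
  "periodic (\<lambda>x. indicator (spread B) (x + y) * indicator (spread B) (x + z) :: ennreal)"
  using spread_cong_shift by (simp add: periodic_def indicator_def)

text \<open>Replaces the limit over squares by an integral over one cell that is jointly measurable
  in both shifts; measurability of the autocorrelation and the use of Fubini below rest on this
  form.\<close>

lemma nn_integral_cell_autocorrelation:
  assumes B: "packing B"
  shows "(\<integral>\<^sup>+ x. indicator cell x * (indicator (spread B) (x + y) * indicator (spread B) (x + z)) \<partial>lborel)
    = ennreal (covol * autocorrelation (indicat_real (spread B)) (y - z))"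
proof -
  have [measurable]: "B \<in> sets borel" "spread B \<in> sets borel"
    using B spread_borel by (auto simp: packing_def)
  have "(\<integral>\<^sup>+ x. indicator cell x * (indicator (spread B) (x + y) * indicator (spread B) (x + z)) \<partial>lborel)
    = (\<integral>\<^sup>+ x. indicator cell x * (indicator (spread B) ((x + z) + (y - z)) * indicator (spread B) ((x + z) + 0)) \<partial>lborel)"
    by (simp add: algebra_simps)
  also have "\<dots> = (\<integral>\<^sup>+ x. indicator cell x * (indicator (spread B) (x + (y - z)) * indicator (spread B) (x + 0)) \<partial>lborel)"
    by (rule nn_integral_cell_translate[OF _ periodic_spread_product]) measurable
  also have "\<dots> = (\<integral>\<^sup>+ x. indicator cell x * (indicator (spread B) (x + (y - z)) * indicator (spread B) x) \<partial>lborel)"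
    by simp
  also have "\<dots> = (\<integral>\<^sup>+ x. indicator (spread B) (x + (y - z)) * indicator B x \<partial>lborel)"
    using spread_cong_shift
    by (intro nn_integral_packing[OF _ _ B, symmetric]) (auto simp: periodic_def indicator_def)
  also have "\<dots> = (\<integral>\<^sup>+ x. indicator {x \<in> B. x + (y - z) \<in> spread B} x \<partial>lborel)"
    by (intro nn_integral_cong) (auto simp: indicator_def)
  also have "\<dots> = emeasure lborel {x \<in> B. x + (y - z) \<in> spread B}"
    by (rule nn_integral_indicator) measurable
  also have "\<dots> = ennreal (measure lborel {x \<in> B. x + (y - z) \<in> spread B})"
  proof (rule emeasure_eq_ennreal_measure)
    have "emeasure lborel {x \<in> B. x + (y - z) \<in> spread B} \<le> emeasure lborel B"
      by (intro emeasure_mono) auto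
    also have "\<dots> \<le> ennreal covol" by (rule emeasure_packing_le[OF B])
    finally show "emeasure lborel {x \<in> B. x + (y - z) \<in> spread B} \<noteq> top"
      by (auto simp: top_unique)
  qed
  finally show ?thesis
    using covol_pos by (simp add: autocorrelation_spread[OF B])
qed

lemma autocorrelation_spread_0:
  assumes B: "packing B"
  shows "autocorrelation (indicat_real (spread B)) 0 = measure lborel B / covol"
proof -
  have "{x \<in> B. x + 0 \<in> spread B} = B" using subset_spread by auto
  then show ?thesis by (simp only: autocorrelation_spread[OF B])
qed

lemma autocorrelation_spread_bounds:
  assumes B: "packing B"
  shows "0 \<le> autocorrelation (indicat_real (spread B)) z"
    "autocorrelation (indicat_real (spread B)) z \<le> autocorrelation (indicat_real (spread B)) 0"
proof -
  have [measurable]: "B \<in> sets borel" "spread B \<in> sets borel"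
    using B spread_borel by (auto simp: packing_def)
  have "emeasure lborel B < \<infinity>"
    using le_less_trans[OF emeasure_packing_le[OF B] ennreal_less_top] by simp
  then have "measure lborel {x \<in> B. x + z \<in> spread B} \<le> measure lborel B"
    by (intro measure_mono_fmeasurable) (auto simp: fmeasurable_def)
  then show "autocorrelation (indicat_real (spread B)) z \<le> autocorrelation (indicat_real (spread B)) 0"
    using covol_pos
    by (subst autocorrelation_spread_0[OF B], subst autocorrelation_spread[OF B]) (simp add: divide_right_mono)
  show "0 \<le> autocorrelation (indicat_real (spread B)) z"
    unfolding autocorrelation_spread[OF B] using covol_pos by simp
qed

lemma autocorrelation_spread_measurable:
  assumes B: "packing B"
  shows "autocorrelation (indicat_real (spread B)) \<in> borel_measurable borel"
proof -
  have [measurable]: "spread B \<in> sets borel"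
    using B spread_borel by (auto simp: packing_def)
  have "autocorrelation (indicat_real (spread B)) z
     = enn2real (\<integral>\<^sup>+ x. indicator cell x * (indicator (spread B) (x + z) * indicator (spread B) (x + 0)) \<partial>lborel) / covol" for z
    unfolding nn_integral_cell_autocorrelation[OF B]
    using covol_pos autocorrelation_spread_bounds(1)[OF B, of z] by simp
  moreover have "(\<lambda>z. enn2real (\<integral>\<^sup>+ x. indicator cell x * (indicator (spread B) (x + z) * indicator (spread B) (x + 0)) \<partial>lborel) / covol) \<in> borel_measurable borel"
    by measurable
  ultimately show ?thesis by (simp add: fun_eq_iff[symmetric] cong: measurable_cong)
qed

text \<open>Expanding the square of the deviation of \<open>1\<^sub>D * u - \<epsilon> u\<close> from its mean over a cell, where
  \<open>u\<close> is the periodic indicator function and \<open>*\<close> the convolution.\<close>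

theorem correlation_inequality:
  fixes \<epsilon> :: real
  assumes B: "packing B" and [measurable]: "D \<in> sets borel" and D: "emeasure lborel D < \<infinity>" and \<epsilon>: "0 \<le> \<epsilon>"
  defines "C \<equiv> autocorrelation (indicat_real (spread B))"
  defines "X \<equiv> \<integral>\<^sup>+ z. ennreal (C z) * emeasure lborel {y \<in> D. y + z \<in> D} \<partial>lborel"
  defines "Y \<equiv> \<integral>\<^sup>+ z. ennreal (C z) * indicator D z \<partial>lborel"
  shows "X < \<infinity>" "(C 0)\<^sup>2 * (measure lborel D - \<epsilon>)\<^sup>2 + 2 * \<epsilon> * enn2real Y \<le> enn2real X + \<epsilon>\<^sup>2 * C 0"
proof -
  have [measurable]: "B \<in> sets borel" "spread B \<in> sets borel"
    using B spread_borel by (auto simp: packing_def)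
  have [measurable]: "C \<in> borel_measurable borel"
    unfolding C_def by (rule autocorrelation_spread_measurable[OF B])
  have C: "0 \<le> C z" "C z \<le> C 0" for z
    unfolding C_def using autocorrelation_spread_bounds[OF B] by auto
  note cellC = nn_integral_cell_autocorrelation[OF B, folded C_def]
  \<comment> \<open>The area of the configuration in the translate of \<open>D\<close> by
    \<open>x\<close>. The facts 1, 2 and 3 are its integral over a cell, its correlation with the
    configuration, and its mean square, the last one after two exchanges of integrals and the
    substitution of \<open>z\<close> for \<open>y - y'\<close>.\<close>
  define U where "U x = (\<integral>\<^sup>+ y. indicator D y * indicator (spread B) (x + y) \<partial>lborel)" for x
  have [measurable]: "U \<in> borel_measurable borel" unfolding U_def by measurable
  define p where "p = measure lborel D"
  have p: "emeasure lborel D = ennreal p" "0 \<le> p"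
    using D by (auto simp: p_def emeasure_eq_ennreal_measure)
  have U_le: "U x \<le> ennreal p" for x
  proof -
    have "U x \<le> (\<integral>\<^sup>+ y. indicator D y \<partial>lborel)"
      unfolding U_def by (intro nn_integral_mono) (auto simp: indicator_def)
    then show ?thesis by (simp add: p)
  qed
  define Ur where "Ur x = enn2real (U x)" for x
  have [measurable]: "Ur \<in> borel_measurable borel" unfolding Ur_def by measurable
  have Ur: "U x = ennreal (Ur x)" "0 \<le> Ur x" for x
    using le_less_trans[OF U_le ennreal_less_top] by (auto simp: Ur_def)
  let ?u = "indicat_real (spread B)"
  have u: "(\<integral>\<^sup>+ x. indicator cell x * indicator (spread B) (x + y) \<partial>lborel) = ennreal (covol * C 0)" for y
  proof -
    have "(\<integral>\<^sup>+ x. indicator cell x * indicator (spread B) (x + y) \<partial>lborel)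
      = (\<integral>\<^sup>+ x. indicator cell x * (indicator (spread B) (x + y) * indicator (spread B) (x + y)) \<partial>lborel)"
      by (intro nn_integral_cong) (auto simp: indicator_def)
    then show ?thesis by (simp add: cellC)
  qed
  have 1: "(\<integral>\<^sup>+ x. indicator cell x * U x \<partial>lborel) = ennreal (covol * C 0 * p)"
  proof -
    have "(\<integral>\<^sup>+ x. indicator cell x * U x \<partial>lborel)
        = (\<integral>\<^sup>+ x. \<integral>\<^sup>+ y. indicator D y * (indicator cell x * indicator (spread B) (x + y)) \<partial>lborel \<partial>lborel)"
      unfolding U_def by (subst nn_integral_cmult[symmetric]) (auto simp: mult_ac)
    also have "\<dots> = (\<integral>\<^sup>+ y. \<integral>\<^sup>+ x. indicator D y * (indicator cell x * indicator (spread B) (x + y)) \<partial>lborel \<partial>lborel)"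
      by (rule lborel_pair.Fubini') measurable
    also have "\<dots> = (\<integral>\<^sup>+ y. indicator D y * ennreal (covol * C 0) \<partial>lborel)"
      by (intro nn_integral_cong) (simp add: nn_integral_cmult u)
    also have "\<dots> = ennreal (covol * C 0 * p)"
      using covol_pos C(1)[of 0] p by (subst nn_integral_multc) (simp_all add: ennreal_mult mult_ac)
    finally show ?thesis .
  qed
  have 2: "(\<integral>\<^sup>+ x. indicator cell x * (U x * indicator (spread B) x) \<partial>lborel) = ennreal covol * Y"
  proof -
    have "(\<integral>\<^sup>+ x. indicator cell x * (U x * indicator (spread B) x) \<partial>lborel)
        = (\<integral>\<^sup>+ x. \<integral>\<^sup>+ y. indicator D y * (indicator cell x * (indicator (spread B) (x + y) * indicator (spread B) (x + 0))) \<partial>lborel \<partial>lborel)"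
      unfolding U_def by (subst nn_integral_multc[symmetric] nn_integral_cmult[symmetric], simp)+ (simp add: mult_ac)
    also have "\<dots> = (\<integral>\<^sup>+ y. \<integral>\<^sup>+ x. indicator D y * (indicator cell x * (indicator (spread B) (x + y) * indicator (spread B) (x + 0))) \<partial>lborel \<partial>lborel)"
      by (rule lborel_pair.Fubini') measurable
    also have "\<dots> = (\<integral>\<^sup>+ y. indicator D y * ennreal (covol * C y) \<partial>lborel)"
      by (intro nn_integral_cong, subst nn_integral_cmult) (measurable, simp only: cellC, simp)
    also have "\<dots> = (\<integral>\<^sup>+ y. ennreal covol * (ennreal (C y) * indicator D y) \<partial>lborel)"
      using covol_pos C by (intro nn_integral_cong) (simp add: ennreal_mult mult_ac)
    also have "\<dots> = ennreal covol * Y"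
      unfolding Y_def by (rule nn_integral_cmult) measurable
    finally show ?thesis .
  qed
  have 3: "(\<integral>\<^sup>+ x. indicator cell x * (U x * U x) \<partial>lborel) = ennreal covol * X"
  proof -
    have "(\<integral>\<^sup>+ x. indicator cell x * (U x * U x) \<partial>lborel)
        = (\<integral>\<^sup>+ x. \<integral>\<^sup>+ y. indicator D y * (indicator cell x * (indicator (spread B) (x + y) * U x)) \<partial>lborel \<partial>lborel)"
    proof (rule nn_integral_cong)
      fix x
      have "indicator cell x * (U x * U x) = (\<integral>\<^sup>+ y. indicator D y * indicator (spread B) (x + y) \<partial>lborel) * (indicator cell x * U x)"
        unfolding U_def by (simp add: mult_ac)
      also have "\<dots> = (\<integral>\<^sup>+ y. indicator D y * indicator (spread B) (x + y) * (indicator cell x * U x) \<partial>lborel)"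
        by (rule nn_integral_multc[symmetric]) measurable
      finally show "indicator cell x * (U x * U x)
          = (\<integral>\<^sup>+ y. indicator D y * (indicator cell x * (indicator (spread B) (x + y) * U x)) \<partial>lborel)"
        by (simp add: mult_ac)
    qed
    also have "\<dots> = (\<integral>\<^sup>+ y. \<integral>\<^sup>+ x. indicator D y * (indicator cell x * (indicator (spread B) (x + y) * U x)) \<partial>lborel \<partial>lborel)"
      by (rule lborel_pair.Fubini') measurable
    also have "\<dots> = (\<integral>\<^sup>+ y. indicator D y * (\<integral>\<^sup>+ y'. indicator D y' * ennreal (covol * C (y - y')) \<partial>lborel) \<partial>lborel)"
    proof (rule nn_integral_cong)
      fix y
      have "(\<integral>\<^sup>+ x. indicator cell x * (indicator (spread B) (x + y) * U x) \<partial>lborel)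
        = (\<integral>\<^sup>+ x. \<integral>\<^sup>+ y'. indicator D y' * (indicator cell x * (indicator (spread B) (x + y) * indicator (spread B) (x + y'))) \<partial>lborel \<partial>lborel)"
      proof (rule nn_integral_cong)
        fix x
        have "indicator cell x * (indicator (spread B) (x + y) * U x)
          = (indicator cell x * indicator (spread B) (x + y)) * (\<integral>\<^sup>+ y'. indicator D y' * indicator (spread B) (x + y') \<partial>lborel)"
          unfolding U_def by (simp add: mult_ac)
        also have "\<dots> = (\<integral>\<^sup>+ y'. (indicator cell x * indicator (spread B) (x + y)) * (indicator D y' * indicator (spread B) (x + y')) \<partial>lborel)"
          by (rule nn_integral_cmult[symmetric]) measurable
        finally show "indicator cell x * (indicator (spread B) (x + y) * U x)
          = (\<integral>\<^sup>+ y'. indicator D y' * (indicator cell x * (indicator (spread B) (x + y) * indicator (spread B) (x + y'))) \<partial>lborel)"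
          by (simp add: mult_ac)
      qed
      also have "\<dots> = (\<integral>\<^sup>+ y'. \<integral>\<^sup>+ x. indicator D y' * (indicator cell x * (indicator (spread B) (x + y) * indicator (spread B) (x + y'))) \<partial>lborel \<partial>lborel)"
        by (rule lborel_pair.Fubini') measurable
      also have "\<dots> = (\<integral>\<^sup>+ y'. indicator D y' * ennreal (covol * C (y - y')) \<partial>lborel)"
        by (intro nn_integral_cong, subst nn_integral_cmult) (measurable, simp only: cellC)
      finally show "(\<integral>\<^sup>+ x. indicator D y * (indicator cell x * (indicator (spread B) (x + y) * U x)) \<partial>lborel)
         = indicator D y * (\<integral>\<^sup>+ y'. indicator D y' * ennreal (covol * C (y - y')) \<partial>lborel)"
        by (subst nn_integral_cmult) auto
    qed
    also have "\<dots> = (\<integral>\<^sup>+ y. \<integral>\<^sup>+ y'. indicator D y * (indicator D y' * ennreal (covol * C (y - y'))) \<partial>lborel \<partial>lborel)"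
      by (simp add: nn_integral_cmult)
    also have "\<dots> = (\<integral>\<^sup>+ y'. \<integral>\<^sup>+ y. indicator D y * (indicator D y' * ennreal (covol * C (y - y'))) \<partial>lborel \<partial>lborel)"
      by (rule lborel_pair.Fubini') measurable
    also have "\<dots> = (\<integral>\<^sup>+ y'. \<integral>\<^sup>+ z. indicator D (y' + z) * (indicator D y' * ennreal (covol * C z)) \<partial>lborel \<partial>lborel)"
    proof (rule nn_integral_cong)
      fix y'
      have "(\<integral>\<^sup>+ y. indicator D y * (indicator D y' * ennreal (covol * C (y - y'))) \<partial>lborel)
        = (\<integral>\<^sup>+ z. indicator D (z + y') * (indicator D y' * ennreal (covol * C ((z + y') - y'))) \<partial>lborel)"
        by (rule nn_integral_lborel_translate[symmetric]) measurable
      then show "(\<integral>\<^sup>+ y. indicator D y * (indicator D y' * ennreal (covol * C (y - y'))) \<partial>lborel)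
        = (\<integral>\<^sup>+ z. indicator D (y' + z) * (indicator D y' * ennreal (covol * C z)) \<partial>lborel)"
        by (simp add: add.commute)
    qed
    also have "\<dots> = (\<integral>\<^sup>+ z. \<integral>\<^sup>+ y'. indicator D (y' + z) * (indicator D y' * ennreal (covol * C z)) \<partial>lborel \<partial>lborel)"
      by (rule lborel_pair.Fubini') measurable
    also have "\<dots> = (\<integral>\<^sup>+ z. ennreal covol * (ennreal (C z) * emeasure lborel {y \<in> D. y + z \<in> D}) \<partial>lborel)"
    proof (rule nn_integral_cong)
      fix z
      have "(\<integral>\<^sup>+ y'. indicator D (y' + z) * (indicator D y' * ennreal (covol * C z)) \<partial>lborel)
         = (\<integral>\<^sup>+ y'. ennreal (covol * C z) * indicator {y \<in> D. y + z \<in> D} y' \<partial>lborel)"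
        by (intro nn_integral_cong) (auto simp: indicator_def)
      also have "\<dots> = ennreal (covol * C z) * emeasure lborel {y \<in> D. y + z \<in> D}"
        by (rule nn_integral_cmult_indicator) measurable
      finally show "(\<integral>\<^sup>+ y'. indicator D (y' + z) * (indicator D y' * ennreal (covol * C z)) \<partial>lborel)
         = ennreal covol * (ennreal (C z) * emeasure lborel {y \<in> D. y + z \<in> D})"
        using covol_pos C by (simp add: ennreal_mult mult_ac)
    qed
    also have "\<dots> = ennreal covol * X"
      unfolding X_def
    proof (rule nn_integral_cmult)
      have "emeasure lborel {y \<in> D. y + z \<in> D} = (\<integral>\<^sup>+ y. indicator D y * indicator D (y + z) \<partial>lborel)" for z
      proof -
        have "emeasure lborel {y \<in> D. y + z \<in> D} = (\<integral>\<^sup>+ y. indicator {y \<in> D. y + z \<in> D} y \<partial>lborel)"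
          by (rule nn_integral_indicator[symmetric]) measurable
        also have "\<dots> = (\<integral>\<^sup>+ y. indicator D y * indicator D (y + z) \<partial>lborel)"
          by (intro nn_integral_cong) (auto simp: indicator_def)
        finally show ?thesis .
      qed
      then show "(\<lambda>z. ennreal (C z) * emeasure lborel {y \<in> D. y + z \<in> D}) \<in> borel_measurable lborel"
        by simp
    qed
    finally show ?thesis .
  qed
  have "ennreal covol * X \<le> (\<integral>\<^sup>+ x. indicator cell x * (ennreal p * ennreal p) \<partial>lborel)"
    unfolding 3[symmetric] using U_le by (intro nn_integral_mono mult_left_mono mult_mono) auto
  also have "\<dots> = ennreal (covol * (p * p))"
    using p covol_pos by (simp add: nn_integral_multc emeasure_cell ennreal_mult)
  finally have "ennreal covol * X < \<infinity>"
    using le_less_trans[OF _ ennreal_less_top] by simp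
  then show X: "X < \<infinity>"
    using covol_pos by (auto simp: ennreal_mult_less_top)
  have "Y \<le> (\<integral>\<^sup>+ z. ennreal (C 0) * indicator D z \<partial>lborel)"
    unfolding Y_def using C by (intro nn_integral_mono mult_right_mono ennreal_leI) auto
  also have "\<dots> < \<infinity>"
    by (simp add: nn_integral_cmult_indicator p ennreal_mult_less_top)
  finally have Y: "Y < \<infinity>" .
  have int: "has_bochner_integral lborel (\<lambda>x. indicator cell x * f x) c"
    if [measurable]: "f \<in> borel_measurable borel" and "\<And>x. 0 \<le> f x" "0 \<le> c"
      and "(\<integral>\<^sup>+ x. indicator cell x * ennreal (f x) \<partial>lborel) = ennreal c" for f c
    using that by (intro has_bochner_integral_nn_integral)
      (auto simp: ennreal_mult' ennreal_indicator cong: nn_integral_cong)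
  have "has_bochner_integral lborel (\<lambda>x. indicator cell x * Ur x) (covol * C 0 * p)"
    using 1 covol_pos C(1)[of 0] p Ur by (intro int) auto
  moreover have "has_bochner_integral lborel (\<lambda>x. indicator cell x * (Ur x * ?u x)) (covol * enn2real Y)"
    using 2 covol_pos Y Ur
    by (intro int) (auto simp: ennreal_mult ennreal_enn2real ennreal_indicator)
  moreover have "has_bochner_integral lborel (\<lambda>x. indicator cell x * (Ur x * Ur x)) (covol * enn2real X)"
    using 3 covol_pos X Ur by (intro int) (auto simp: ennreal_mult ennreal_enn2real)
  moreover have "has_bochner_integral lborel (\<lambda>x. indicator cell x * ?u x) (covol * C 0)"
    using u[of 0] covol_pos C(1)[of 0] by (intro int) (auto simp: ennreal_indicator)
  moreover have "has_bochner_integral lborel (\<lambda>x. indicator cell x * 1) covol"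
    using covol_pos by (intro int) (auto simp: emeasure_cell)
  \<comment> \<open>The terms of the expanded square of \<open>Ur - \<epsilon> u - \<mu>\<close>.
    Since \<open>u\<close> is an indicator function, \<open>u\<close> squared is \<open>u\<close>,
    which joins its quadratic and its linear term.\<close>
  ultimately have sq: "has_bochner_integral lborel (\<lambda>x. (indicator cell x * (Ur x * Ur x) - (2 * \<epsilon>) * (indicator cell x * (Ur x * ?u x)))
      + (\<epsilon>\<^sup>2 + 2 * \<mu> * \<epsilon>) * (indicator cell x * ?u x) - (2 * \<mu>) * (indicator cell x * Ur x) + \<mu>\<^sup>2 * (indicator cell x * 1))
      ((covol * enn2real X - (2 * \<epsilon>) * (covol * enn2real Y)) + (\<epsilon>\<^sup>2 + 2 * \<mu> * \<epsilon>) * (covol * C 0) - (2 * \<mu>) * (covol * C 0 * p) + \<mu>\<^sup>2 * covol)" for \<mu>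
    by (intro has_bochner_integral_add has_bochner_integral_diff has_bochner_integral_mult_right)
  \<comment> \<open>The mean of \<open>Ur - \<epsilon> u\<close> over a cell, which makes the
    integral of the square smallest.\<close>
  define \<mu> where "\<mu> = C 0 * (p - \<epsilon>)"
  have "0 \<le> (indicator cell x * (Ur x * Ur x) - (2 * \<epsilon>) * (indicator cell x * (Ur x * ?u x)))
      + (\<epsilon>\<^sup>2 + 2 * \<mu> * \<epsilon>) * (indicator cell x * ?u x) - (2 * \<mu>) * (indicator cell x * Ur x) + \<mu>\<^sup>2 * (indicator cell x * 1)" for x
  proof -
    have "(indicator cell x * (Ur x * Ur x) - (2 * \<epsilon>) * (indicator cell x * (Ur x * ?u x)))
      + (\<epsilon>\<^sup>2 + 2 * \<mu> * \<epsilon>) * (indicator cell x * ?u x) - (2 * \<mu>) * (indicator cell x * Ur x) + \<mu>\<^sup>2 * (indicator cell x * 1)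
      = indicator cell x * (Ur x - \<epsilon> * ?u x - \<mu>)\<^sup>2"
      by (simp add: indicator_def power2_eq_square algebra_simps)
    then show ?thesis by simp
  qed
  then have "0 \<le> (covol * enn2real X - (2 * \<epsilon>) * (covol * enn2real Y)) + (\<epsilon>\<^sup>2 + 2 * \<mu> * \<epsilon>) * (covol * C 0) - (2 * \<mu>) * (covol * C 0 * p) + \<mu>\<^sup>2 * covol"
    using has_bochner_integral_nonneg[OF sq[of \<mu>]] by blast
  also have "\<dots> = covol * (enn2real X + \<epsilon>\<^sup>2 * C 0 - 2 * \<epsilon> * enn2real Y - \<mu>\<^sup>2)"
    by (simp add: \<mu>_def power2_eq_square algebra_simps)
  finally show "(C 0)\<^sup>2 * (measure lborel D - \<epsilon>)\<^sup>2 + 2 * \<epsilon> * enn2real Y \<le> enn2real X + \<epsilon>\<^sup>2 * C 0"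
    using covol_pos by (simp add: zero_le_mult_iff \<mu>_def p_def power_mult_distrib)
qed

end

text \<open>Several antiderivatives below are merely continuous at an end of the interval, where a
  square root, an inverse trigonometric function or \<open>ln (cos x)\<close> is singular.
  Nonnegativity turns the gauge integral into a Lebesgue integral.\<close>

lemma has_bochner_integral_FTC_interior:
  fixes f F :: "real \<Rightarrow> real"
  assumes "a \<le> b" and [measurable]: "f \<in> borel_measurable borel"
    and nonneg: "\<And>x. a \<le> x \<Longrightarrow> x \<le> b \<Longrightarrow> 0 \<le> f x"
    and F: "continuous_on {a..b} F" "\<And>x. a < x \<Longrightarrow> x < b \<Longrightarrow> (F has_real_derivative f x) (at x)"
  shows "has_bochner_integral lborel (\<lambda>x. indicator {a..b} x * f x) (F b - F a)"
proof -
  have "(f has_integral F b - F a) {a..b}"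
    using assms(1) F
    by (intro fundamental_theorem_of_calculus_interior)
      (auto simp: has_real_derivative_iff_has_vector_derivative[symmetric])
  then have I: "((\<lambda>x. indicator {a..b} x * f x) has_integral F b - F a) UNIV"
    by (subst (asm) has_integral_restrict_UNIV[symmetric])
      (auto elim!: has_integral_eq[rotated] simp: indicator_def)
  have nn: "0 \<le> indicator {a..b} x * f x" for x
    using nonneg by (auto simp: indicator_def)
  have "integral\<^sup>N lborel (\<lambda>x. ennreal (indicator {a..b} x * f x)) = ennreal (F b - F a)"
    by (rule nn_integral_has_integral_lborel[OF _ nn I]) measurable
  moreover have "0 \<le> F b - F a"
    by (rule has_integral_nonneg[OF I]) (use nn in auto)
  ultimately show ?thesis
    using nn by (intro has_bochner_integral_nn_integral) auto
qed

section \<open>Overlap of two discs\<close>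

text \<open>\<open>lens x\<close> is the area common to two discs of radius \<open>1/2\<close> whose centres are at distance \<open>x\<close>.\<close>

definition lens :: "real \<Rightarrow> real" where
  "lens x = indicator {0..1} x * ((arccos x - x * sqrt (1 - x\<^sup>2)) / 2)"

lemma lens_continuous: "continuous_on {0..1} lens"
proof -
  have "continuous_on {0..1} (\<lambda>x. (arccos x - x * sqrt (1 - x\<^sup>2)) / 2)"
    by (intro continuous_intros) auto
  then show ?thesis
    by (rule continuous_on_eq) (auto simp: lens_def)
qed

lemma lens_measurable [measurable]: "lens \<in> borel_measurable borel"
proof -
  have "(\<lambda>x. indicator {0..1} x *\<^sub>R ((arccos x - x * sqrt (1 - x\<^sup>2)) / 2) :: real) \<in> borel_measurable borel"
    by (intro borel_measurable_continuous_on_indicator continuous_intros) auto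
  then show ?thesis by (simp add: lens_def[abs_def])
qed

lemma DERIV_lens [derivative_intros]:
  assumes "0 < x" "x < 1"
  shows "(lens has_real_derivative - sqrt (1 - x\<^sup>2)) (at x)"
proof -
  have x2: "x\<^sup>2 < 1" using assms by (simp add: power_less_one_iff)
  define q where "q = sqrt (1 - x\<^sup>2)"
  have q: "q > 0" "q\<^sup>2 = 1 - x\<^sup>2" using x2 by (simp_all add: q_def)
  have "((\<lambda>x. (arccos x - x * sqrt (1 - x\<^sup>2)) / 2) has_real_derivative
     (inverse (- q) - (q + x * (- x / q))) / 2) (at x)"
    unfolding q_def using assms x2
    by (auto intro!: derivative_eq_intros simp: divide_simps)
  also have "(inverse (- q) - (q + x * (- x / q))) / 2 = - q"
    using q by (simp add: field_simps power2_eq_square)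
  finally have "((\<lambda>x. (arccos x - x * sqrt (1 - x\<^sup>2)) / 2) has_real_derivative - q) (at x)" .
  moreover have "eventually (\<lambda>y. y \<in> {0<..<1}) (nhds x)"
    using assms by (intro eventually_nhds_in_open) auto
  then have "eventually (\<lambda>y. (arccos y - y * sqrt (1 - y\<^sup>2)) / 2 = lens y) (nhds x)"
    by eventually_elim (simp add: lens_def)
  ultimately show ?thesis
    unfolding q_def by (subst (asm) DERIV_cong_ev[OF refl _ refl])
qed

lemma lens_0 [simp]: "lens 0 = pi / 4" by (simp add: lens_def)

lemma lens_ge_1: "1 \<le> x \<Longrightarrow> lens x = 0" by (cases "x = 1") (auto simp: lens_def)

text \<open>Exhibits \<open>lens x\<close> as the area under a quarter circle to the right of
  \<open>x\<close>. In this form it is recognised in the overlap of two discs and later superposed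
  over all radii.\<close>

lemma has_bochner_integral_lens:
  assumes "0 \<le> x" "x \<le> 1"
  shows "has_bochner_integral lborel (\<lambda>t. indicator {x..1} t * sqrt (1 - t\<^sup>2)) (lens x)"
proof -
  have "has_bochner_integral lborel (\<lambda>t. indicator {x..1} t * sqrt (1 - t\<^sup>2)) (- lens 1 - - lens x)"
  proof (rule has_bochner_integral_FTC_interior)
    show "continuous_on {x..1} (\<lambda>x. - lens x)"
      using assms by (intro continuous_on_minus continuous_on_subset[OF lens_continuous]) auto
    show "((\<lambda>x. - lens x) has_real_derivative sqrt (1 - t\<^sup>2)) (at t)" if "x < t" "t < 1" for t
      using that assms by (auto intro!: derivative_eq_intros)
    show "0 \<le> sqrt (1 - t\<^sup>2)" if "x \<le> t" "t \<le> 1" for t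
      using that assms by (simp add: power_le_one_iff)
  qed (use assms in auto)
  then show ?thesis by (simp add: lens_ge_1)
qed

lemma lens_nonneg: "0 \<le> lens x"
proof (cases "0 \<le> x \<and> x \<le> 1")
  case True
  then show ?thesis
    using has_bochner_integral_nonneg[OF has_bochner_integral_lens[of x]]
    by (force simp: indicator_def power_le_one_iff)
qed (auto simp: lens_def)

lemma nn_integral_half_disc:
  assumes s: "0 < s" and c: "0 \<le> c"
  shows "(\<integral>\<^sup>+ t. indicator {c..} t * ennreal (sqrt (max 0 (s\<^sup>2 - t\<^sup>2))) \<partial>lborel) = ennreal (s\<^sup>2 * lens (c / s))"
proof -
  have "(\<integral>\<^sup>+ t. indicator {c..} t * ennreal (sqrt (max 0 (s\<^sup>2 - t\<^sup>2))) \<partial>lborel)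
     = ennreal s * (\<integral>\<^sup>+ t. indicator {c..} (s * t) * ennreal (sqrt (max 0 (s\<^sup>2 - (s * t)\<^sup>2))) \<partial>lborel)"
    using s by (subst nn_integral_real_affine[where c=s and t=0]) auto
  also have "(\<integral>\<^sup>+ t. indicator {c..} (s * t) * ennreal (sqrt (max 0 (s\<^sup>2 - (s * t)\<^sup>2))) \<partial>lborel)
     = (\<integral>\<^sup>+ t. ennreal s * (indicator {c / s..} t * ennreal (sqrt (max 0 (1 - t\<^sup>2)))) \<partial>lborel)"
  proof (rule nn_integral_cong)
    fix t :: real
    have "max 0 (s\<^sup>2 - (s * t)\<^sup>2) = s\<^sup>2 * max 0 (1 - t\<^sup>2)"
      using s by (subst max_mult_distrib_left) (auto simp: power_mult_distrib algebra_simps)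
    then have "sqrt (max 0 (s\<^sup>2 - (s * t)\<^sup>2)) = s * sqrt (max 0 (1 - t\<^sup>2))"
      using s by (simp add: real_sqrt_mult)
    moreover have "c \<le> s * t \<longleftrightarrow> c / s \<le> t" using s by (simp add: field_simps)
    ultimately show "indicator {c..} (s * t) * ennreal (sqrt (max 0 (s\<^sup>2 - (s * t)\<^sup>2)))
       = ennreal s * (indicator {c / s..} t * ennreal (sqrt (max 0 (1 - t\<^sup>2))))"
      using s by (simp add: indicator_def ennreal_mult)
  qed
  also have "\<dots> = ennreal s * (\<integral>\<^sup>+ t. indicator {c / s..} t * ennreal (sqrt (max 0 (1 - t\<^sup>2))) \<partial>lborel)"
    by (rule nn_integral_cmult) measurable
  also have "(\<integral>\<^sup>+ t. indicator {c / s..} t * ennreal (sqrt (max 0 (1 - t\<^sup>2))) \<partial>lborel) = ennreal (lens (c / s))"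
  proof (cases "c / s \<le> 1")
    case True
    have "(\<integral>\<^sup>+ t. indicator {c / s..} t * ennreal (sqrt (max 0 (1 - t\<^sup>2))) \<partial>lborel)
      = (\<integral>\<^sup>+ t. ennreal (indicator {c / s..1} t * sqrt (1 - t\<^sup>2)) \<partial>lborel)"
    proof (rule nn_integral_cong)
      fix t :: real
      have "1 - t\<^sup>2 \<le> 0" if "1 < t" using that by (simp add: one_le_power)
      moreover have "0 \<le> 1 - t\<^sup>2" if "c / s \<le> t" "t \<le> 1"
        using that s c order_trans[of 0 "c / s" t] by (simp add: power_le_one_iff)
      ultimately show "indicator {c / s..} t * ennreal (sqrt (max 0 (1 - t\<^sup>2)))
        = ennreal (indicator {c / s..1} t * sqrt (1 - t\<^sup>2))"
        by (cases "t \<le> 1") (auto simp: indicator_def max_absorb1 max_absorb2)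
    qed
    also have "\<dots> = ennreal (lens (c / s))"
    proof -
      have I: "has_bochner_integral lborel (\<lambda>t. indicator {c / s..1} t * sqrt (1 - t\<^sup>2)) (lens (c / s))"
        using True s c by (intro has_bochner_integral_lens) auto
      have nn: "0 \<le> indicator {c / s..1} t * sqrt (1 - t\<^sup>2)" for t
        using order_trans[of 0 "c / s" t] s c by (auto simp: indicator_def power_le_one_iff)
      show ?thesis
        using I nn_integral_eq_integral[of lborel "\<lambda>t. indicator {c / s..1} t * sqrt (1 - t\<^sup>2)"] nn
        by (auto simp: has_bochner_integral_iff)
    qed
    finally show ?thesis .
  next
    case False
    have "(\<integral>\<^sup>+ t. indicator {c / s..} t * ennreal (sqrt (max 0 (1 - t\<^sup>2))) \<partial>lborel) = (\<integral>\<^sup>+ t. 0 \<partial>(lborel :: real measure))"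
    proof (rule nn_integral_cong)
      fix t :: real
      have "1 - t\<^sup>2 \<le> 0" if "c / s \<le> t" using that False by (simp add: one_le_power)
      then show "indicator {c / s..} t * ennreal (sqrt (max 0 (1 - t\<^sup>2))) = 0"
        by (auto simp: indicator_def max_absorb1)
    qed
    then show ?thesis using False by (simp add: lens_ge_1)
  qed
  finally show ?thesis
    using s by (simp add: ennreal_mult' power2_eq_square mult.assoc)
qed

lemma emeasure_square_less: "emeasure lborel {y::real. y\<^sup>2 < c} = ennreal (2 * sqrt (max 0 c))"
proof (cases "0 < c")
  case True
  have "y\<^sup>2 < c \<longleftrightarrow> \<bar>y\<bar> < sqrt c" for y
    using real_sqrt_less_iff[of "y\<^sup>2" c] by (simp only: real_sqrt_abs)
  then have *: "{y::real. y\<^sup>2 < c} = {- sqrt c<..<sqrt c}"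
    by (intro set_eqI) (simp only: abs_less_iff minus_less_iff mem_Collect_eq greaterThanLessThan_iff conj_commute)
  show ?thesis
    unfolding * using True by simp
next
  case False
  then have "\<not> y\<^sup>2 < c" for y :: real using zero_le_power2[of y] by linarith
  then have "{y::real. y\<^sup>2 < c} = {}" by simp
  then show ?thesis using False by simp
qed

text \<open>A rotation and a shift put the centres at \<open>- r / 2\<close> and
  \<open>r / 2\<close> on the first axis. The vertical line at \<open>x\<close> is then limited by
  the farther centre, at distance \<open>\<bar>x\<bar> + r / 2\<close>. So the overlap consists of
  four congruent pieces, each the area under a circular arc beyond \<open>r / 2\<close>.\<close>

theorem emeasure_ball_overlap:
  assumes s: "0 < s"
  shows "emeasure lborel {y \<in> ball (0::real^2) s. y + z \<in> ball 0 s} = ennreal (4 * s\<^sup>2 * lens (norm z / (2 * s)))"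
proof -
  define r where "r = norm z"
  have r: "0 \<le> r" by (simp add: r_def)
  obtain \<theta> where z: "z = polar r \<theta>" unfolding r_def using polar_exists by blast
  have [measurable]: "ball (0::real^2) s \<in> sets borel" by simp
  let ?I = "\<lambda>z y::real^2. indicator (ball 0 s) y * indicator (ball 0 s) (y + z) :: ennreal"
  have "emeasure lborel {y \<in> ball (0::real^2) s. y + z \<in> ball 0 s} = (\<integral>\<^sup>+ y. indicator {y \<in> ball (0::real^2) s. y + z \<in> ball 0 s} y \<partial>lborel)"
    by (rule nn_integral_indicator[symmetric]) measurable
  also have "\<dots> = (\<integral>\<^sup>+ y. ?I z y \<partial>lborel)"
    by (intro nn_integral_cong) (auto simp: indicator_def)
  also have "\<dots> = (\<integral>\<^sup>+ y. ?I z (rot \<theta> y) \<partial>lborel)"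
    by (rule nn_integral_rot[symmetric]) measurable
  also have "\<dots> = (\<integral>\<^sup>+ y. ?I (vector [r, 0]) y \<partial>lborel)"
  proof (rule nn_integral_cong)
    fix y
    have "z = rot \<theta> (vector [r, 0])"
      unfolding z by (simp add: vec_eq_iff forall_2)
    then have "rot \<theta> y + z = rot \<theta> (y + vector [r, 0])"
      by (simp add: linear_add[OF linear_rot])
    then show "?I z (rot \<theta> y) = ?I (vector [r, 0]) y"
      by (simp add: indicator_def)
  qed
  also have "\<dots> = (\<integral>\<^sup>+ x. \<integral>\<^sup>+ y. ?I (vector [r, 0]) (vector [x, y]) \<partial>lborel \<partial>lborel)"
    by (rule nn_integral_vec2) measurable
  also have "\<dots> = (\<integral>\<^sup>+ x. \<integral>\<^sup>+ y. ?I (vector [r, 0]) (vector [x + (- (r / 2)), y]) \<partial>lborel \<partial>lborel)"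
    by (rule nn_integral_lborel_translate[symmetric]) measurable
  also have "\<dots> = (\<integral>\<^sup>+ x. \<integral>\<^sup>+ y. indicator {y. y\<^sup>2 < s\<^sup>2 - (\<bar>x\<bar> + r / 2)\<^sup>2} y \<partial>lborel \<partial>lborel)"
  proof (intro nn_integral_cong)
    fix x y :: real
    have nrm: "norm (vector [a, y] :: real^2) < s \<longleftrightarrow> y\<^sup>2 < s\<^sup>2 - a\<^sup>2" for a
    proof -
      have "norm (vector [a, y] :: real^2) < s \<longleftrightarrow> (norm (vector [a, y] :: real^2))\<^sup>2 < s\<^sup>2"
        using s power2_less_imp_less[of "norm (vector [a, y] :: real^2)" s]
          power_strict_mono[of "norm (vector [a, y] :: real^2)" s 2]
        by (intro iffI) simp_all
      also have "(norm (vector [a, y] :: real^2))\<^sup>2 = a\<^sup>2 + y\<^sup>2"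
        by (simp add: norm_vec2)
      finally show ?thesis by (simp add: less_diff_eq add.commute)
    qed
    have sh: "vector [x + (- (r / 2)), y] + vector [r, 0] = (vector [x + r / 2, y] :: real^2)"
      by (simp add: vec_eq_iff forall_2)
    have "y\<^sup>2 < s\<^sup>2 - (x + (- (r / 2)))\<^sup>2 \<and> y\<^sup>2 < s\<^sup>2 - (x + r / 2)\<^sup>2 \<longleftrightarrow> y\<^sup>2 < s\<^sup>2 - (\<bar>x\<bar> + r / 2)\<^sup>2"
    proof -
      have e: "(x + (- (r / 2)))\<^sup>2 = x\<^sup>2 - x * r + (r / 2)\<^sup>2" "(x + r / 2)\<^sup>2 = x\<^sup>2 + x * r + (r / 2)\<^sup>2"
        "(\<bar>x\<bar> + r / 2)\<^sup>2 = x\<^sup>2 + \<bar>x\<bar> * r + (r / 2)\<^sup>2"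
        by (simp_all add: power2_eq_square algebra_simps)
      show ?thesis
        unfolding e using mult_nonneg_nonneg[OF _ r, of x] mult_nonneg_nonneg[OF _ r, of "- x"]
        by (cases "0 \<le> x") auto
    qed
    then show "?I (vector [r, 0]) (vector [x + (- (r / 2)), y]) = indicator {y. y\<^sup>2 < s\<^sup>2 - (\<bar>x\<bar> + r / 2)\<^sup>2} y"
      unfolding sh by (auto simp: indicator_def nrm)
  qed
  also have "\<dots> = (\<integral>\<^sup>+ x. ennreal (2 * sqrt (max 0 (s\<^sup>2 - (\<bar>x\<bar> + r / 2)\<^sup>2))) \<partial>lborel)"
    by (intro nn_integral_cong) (subst nn_integral_indicator, measurable, rule emeasure_square_less)
  also have "\<dots> = (\<integral>\<^sup>+ x. indicator {0..} x * ennreal (2 * sqrt (max 0 (s\<^sup>2 - (x + r / 2)\<^sup>2)))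
      + indicator {0<..} (- x) * ennreal (2 * sqrt (max 0 (s\<^sup>2 - (- x + r / 2)\<^sup>2))) \<partial>lborel)"
    by (intro nn_integral_cong) (auto simp: indicator_def)
  also have "\<dots> = (\<integral>\<^sup>+ x. indicator {0..} x * ennreal (2 * sqrt (max 0 (s\<^sup>2 - (x + r / 2)\<^sup>2))) \<partial>lborel)
      + (\<integral>\<^sup>+ x. indicator {0<..} (- x) * ennreal (2 * sqrt (max 0 (s\<^sup>2 - (- x + r / 2)\<^sup>2))) \<partial>lborel)"
    by (rule nn_integral_add) measurable
  also have "(\<integral>\<^sup>+ x. indicator {0<..} (- x) * ennreal (2 * sqrt (max 0 (s\<^sup>2 - (- x + r / 2)\<^sup>2))) \<partial>lborel)
      = (\<integral>\<^sup>+ x. indicator {0<..} x * ennreal (2 * sqrt (max 0 (s\<^sup>2 - (x + r / 2)\<^sup>2))) \<partial>lborel)"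
    by (rule nn_integral_lborel_uminus) measurable
  also have "\<dots> = (\<integral>\<^sup>+ x. indicator {0..} x * ennreal (2 * sqrt (max 0 (s\<^sup>2 - (x + r / 2)\<^sup>2))) \<partial>lborel)"
    by (intro nn_integral_cong_AE, use AE_lborel_singleton[of 0] in eventually_elim) (auto simp: indicator_def)
  also have "(\<integral>\<^sup>+ x. indicator {0..} x * ennreal (2 * sqrt (max 0 (s\<^sup>2 - (x + r / 2)\<^sup>2))) \<partial>lborel)
      = (\<integral>\<^sup>+ x. indicator {r / 2..} (x + r / 2) * ennreal (2 * sqrt (max 0 (s\<^sup>2 - (x + r / 2)\<^sup>2))) \<partial>lborel)"
    by (intro nn_integral_cong) (auto simp: indicator_def)
  also have "\<dots> = (\<integral>\<^sup>+ t. indicator {r / 2..} t * ennreal (2 * sqrt (max 0 (s\<^sup>2 - t\<^sup>2))) \<partial>lborel)"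
    by (rule nn_integral_lborel_translate) measurable
  also have "\<dots> = (\<integral>\<^sup>+ t. 2 * (indicator {r / 2..} t * ennreal (sqrt (max 0 (s\<^sup>2 - t\<^sup>2)))) \<partial>lborel)"
    by (intro nn_integral_cong) (auto simp: ennreal_mult mult_ac)
  also have "\<dots> = 2 * (\<integral>\<^sup>+ t. indicator {r / 2..} t * ennreal (sqrt (max 0 (s\<^sup>2 - t\<^sup>2))) \<partial>lborel)"
    by (rule nn_integral_cmult) measurable
  also have "\<dots> = 2 * ennreal (s\<^sup>2 * lens (r / 2 / s))"
    using s r by (subst nn_integral_half_disc) auto
  finally have "emeasure lborel {y \<in> ball (0::real^2) s. y + z \<in> ball 0 s}
      = 2 * ennreal (s\<^sup>2 * lens (r / 2 / s)) + 2 * ennreal (s\<^sup>2 * lens (r / 2 / s))" .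
  also have "2 * ennreal a + 2 * ennreal a = ennreal (4 * a)" if "0 \<le> a" for a
  proof -
    have "2 * ennreal a = ennreal (2 * a)"
      using ennreal_mult[of 2 a] that by simp
    then show ?thesis
      using ennreal_plus[of "2 * a" "2 * a"] that by simp
  qed
  then have "2 * ennreal (s\<^sup>2 * lens (r / 2 / s)) + 2 * ennreal (s\<^sup>2 * lens (r / 2 / s)) = ennreal (4 * (s\<^sup>2 * lens (r / 2 / s)))"
    by (simp add: lens_nonneg)
  finally show ?thesis
    by (simp add: r_def mult.assoc)
qed

section \<open>Polynomial bounds and moments of the disc overlap\<close>

lemma lens_mono_diff:
  fixes g :: "real \<Rightarrow> real"
  assumes "0 \<le> a" "a \<le> b" "b \<le> 1"
    and g: "\<And>x. a \<le> x \<Longrightarrow> x \<le> b \<Longrightarrow> (g has_real_derivative g' x) (at x)"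
    and le: "\<And>x. a < x \<Longrightarrow> x < b \<Longrightarrow> g' x \<le> - sqrt (1 - x\<^sup>2)"
  shows "g b - g a \<le> lens b - lens a"
proof -
  have "(\<lambda>x. lens x - g x) a \<le> (\<lambda>x. lens x - g x) b"
  proof (rule DERIV_nonneg_imp_increasing_open[OF assms(2)])
    show "\<exists>y. ((\<lambda>x. lens x - g x) has_real_derivative y) (at x) \<and> 0 \<le> y" if "a < x" "x < b" for x
    proof (intro exI[of _ "- sqrt (1 - x\<^sup>2) - g' x"] conjI)
      show "((\<lambda>x. lens x - g x) has_real_derivative - sqrt (1 - x\<^sup>2) - g' x) (at x)"
        using that assms by (intro derivative_intros g) auto
      show "0 \<le> - sqrt (1 - x\<^sup>2) - g' x" using le[OF that] by linarith
    qed
    have "continuous_on {a..b} g"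
      by (meson DERIV_isCont continuous_at_imp_continuous_on g atLeastAtMost_iff)
    then show "continuous_on {a..b} (\<lambda>x. lens x - g x)"
      using assms by (intro continuous_on_diff continuous_on_subset[OF lens_continuous]) auto
  qed
  then show ?thesis by simp
qed

lemma lens_mono_diff':
  fixes g :: "real \<Rightarrow> real"
  assumes "0 \<le> a" "a \<le> b" "b \<le> 1"
    and g: "\<And>x. a \<le> x \<Longrightarrow> x \<le> b \<Longrightarrow> (g has_real_derivative g' x) (at x)"
    and le: "\<And>x. a < x \<Longrightarrow> x < b \<Longrightarrow> - sqrt (1 - x\<^sup>2) \<le> g' x"
  shows "lens b - lens a \<le> g b - g a"
proof -
  have "(\<lambda>x. g x - lens x) a \<le> (\<lambda>x. g x - lens x) b"
  proof (rule DERIV_nonneg_imp_increasing_open[OF assms(2)])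
    show "\<exists>y. ((\<lambda>x. g x - lens x) has_real_derivative y) (at x) \<and> 0 \<le> y" if "a < x" "x < b" for x
    proof (intro exI[of _ "g' x - - sqrt (1 - x\<^sup>2)"] conjI)
      show "((\<lambda>x. g x - lens x) has_real_derivative g' x - - sqrt (1 - x\<^sup>2)) (at x)"
        using that assms by (intro derivative_intros g) auto
      show "0 \<le> g' x - - sqrt (1 - x\<^sup>2)" using le[OF that] by linarith
    qed
    have "continuous_on {a..b} g"
      by (meson DERIV_isCont continuous_at_imp_continuous_on g atLeastAtMost_iff)
    then show "continuous_on {a..b} (\<lambda>x. g x - lens x)"
      using assms by (intro continuous_on_diff continuous_on_subset[OF lens_continuous]) auto
  qed
  then show ?thesis by simp
qed

text \<open>The square of this Taylor polynomial exceeds \<open>1 - y\<close> by terms with positive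
  coefficients only.\<close>

lemma sqrt_taylor_upper:
  fixes y :: real
  assumes "0 \<le> y" "y \<le> 1"
  shows "sqrt (1 - y) \<le> 1 - y / 2 - y\<^sup>2 / 8 - y ^ 3 / 16"
proof (rule real_le_lsqrt)
  have "y\<^sup>2 \<le> 1" "y ^ 3 \<le> 1" using assms by (simp_all add: power_le_one)
  then show "0 \<le> 1 - y / 2 - y\<^sup>2 / 8 - y ^ 3 / 16" using assms by linarith
  have "(1 - y / 2 - y\<^sup>2 / 8 - y ^ 3 / 16)\<^sup>2 = 1 - y + 5 / 64 * y ^ 4 + y ^ 5 / 64 + y ^ 6 / 256"
    by (simp add: power2_eq_square field_simps) (simp add: algebra_simps eval_nat_numeral)
  then show "1 - y \<le> (1 - y / 2 - y\<^sup>2 / 8 - y ^ 3 / 16)\<^sup>2" using assms by simp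
qed

text \<open>Integrates \<open>sqrt_taylor_upper\<close> at \<open>y = t\<^sup>2\<close>. Each of the
  three higher terms enlarges the self-interaction of a ball and so helps in the final
  comparison.\<close>

lemma lens_ge:
  assumes "0 \<le> x" "x \<le> 1"
  shows "pi / 4 - x + x ^ 3 / 6 + x ^ 5 / 40 + x ^ 7 / 112 \<le> lens x"
proof -
  define g where "g x = - x + x ^ 3 / 6 + x ^ 5 / 40 + x ^ 7 / 112" for x :: real
  have "g x - g 0 \<le> lens x - lens 0"
  proof (rule lens_mono_diff[where g'="\<lambda>x. - (1 - x\<^sup>2 / 2 - (x\<^sup>2)\<^sup>2 / 8 - (x\<^sup>2) ^ 3 / 16)"])
    fix t assume "0 < t" "t < x"
    then show "- (1 - t\<^sup>2 / 2 - (t\<^sup>2)\<^sup>2 / 8 - (t\<^sup>2) ^ 3 / 16) \<le> - sqrt (1 - t\<^sup>2)"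
      using sqrt_taylor_upper[of "t\<^sup>2"] assms by (simp add: power_le_one_iff)
  next
    fix t :: real
    show "(g has_real_derivative - (1 - t\<^sup>2 / 2 - (t\<^sup>2)\<^sup>2 / 8 - (t\<^sup>2) ^ 3 / 16)) (at t)"
      unfolding g_def by (auto intro!: derivative_eq_intros simp: field_simps eval_nat_numeral)
  qed (use assms in auto)
  then show ?thesis by (simp add: g_def)
qed

lemma lens_ge_linear: "0 \<le> x \<Longrightarrow> pi / 4 - x \<le> lens x"
proof (cases "x \<le> 1")
  case True
  assume "0 \<le> x"
  then have "pi / 4 - x + x ^ 3 / 6 + x ^ 5 / 40 + x ^ 7 / 112 \<le> lens x" "0 \<le> x ^ 3" "0 \<le> x ^ 5" "0 \<le> x ^ 7"
    using True by (auto intro: lens_ge)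
  then show ?thesis by linarith
qed (use pi_less_4 in \<open>simp add: lens_ge_1\<close>)

text \<open>Two nearly tangent discs overlap only to the order 3/2 in the remaining distance. Hence
  balls that touch do not influence the one-sided derivative of the autocorrelation at 0.\<close>

lemma lens_le_near_1:
  assumes "0 \<le> x" "x \<le> 1"
  shows "lens x \<le> (1 - x) * sqrt (2 * (1 - x))"
proof (cases "x = 1")
  case False
  then have x: "x < 1" using assms by simp
  have "lens 1 - lens x \<ge> (\<lambda>t. - sqrt (2 * (1 - x)) * t) 1 - (\<lambda>t. - sqrt (2 * (1 - x)) * t) x"
  proof (rule lens_mono_diff[where g'="\<lambda>_. - sqrt (2 * (1 - x))"])
    fix t assume t: "x < t" "t < 1"
    have "1 - t\<^sup>2 = (1 - t) * (1 + t)" by (simp add: power2_eq_square algebra_simps)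
    also have "\<dots> \<le> (1 - x) * 2" using t assms by (intro mult_mono) auto
    finally show "- sqrt (2 * (1 - x)) \<le> - sqrt (1 - t\<^sup>2)" by (simp add: mult.commute)
  qed (use assms in \<open>auto intro!: derivative_eq_intros\<close>)
  then show ?thesis by (simp add: lens_ge_1 algebra_simps)
qed (simp add: lens_ge_1)

lemma lens_antimono:
  assumes "0 \<le> x" "x \<le> y"
  shows "lens y \<le> lens x"
proof (cases "y \<le> 1")
  case True
  have "lens y - lens x \<le> (\<lambda>_. 0) y - (\<lambda>_. 0) x"
    using True assms by (intro lens_mono_diff'[where g'="\<lambda>_. 0"]) (auto simp: power_le_one_iff)
  then show ?thesis by simp
qed (simp add: lens_ge_1 lens_nonneg)

text \<open>The fifth Taylor coefficient is \<open>1 / 40\<close>, with which the polynomial is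
  already negative at 1. The larger \<open>3 / 50\<close> makes the bound true for all nonnegative
  \<open>x\<close>, also beyond 1, where \<open>lens\<close> vanishes. Such arguments occur:
  \<open>r / (2 * s)\<close> with \<open>r \<le> 1\<close> exceeds 1 when
  \<open>2 * s < r\<close>.\<close>

lemma lens_le:
  assumes "0 \<le> x"
  shows "lens x \<le> pi / 4 - x + x ^ 3 / 6 + 3 / 50 * x ^ 5"
proof -
  define g where "g x = - x + x ^ 3 / 6 + 3 / 50 * x ^ 5" for x :: real
  define g' where "g' y = - (1 - y / 2 - 3 / 10 * y\<^sup>2)" for y :: real
  have g: "(g has_real_derivative g' (t\<^sup>2)) (at t)" for t
    unfolding g_def g'_def by (auto intro!: derivative_eq_intros simp: field_simps eval_nat_numeral)
  have sq: "(1 - y / 2 - 3 / 10 * y\<^sup>2)\<^sup>2 = 1 - y - y\<^sup>2 * (7 / 20 - 3 / 10 * y - 9 / 100 * y\<^sup>2)" for y :: real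
    by (simp add: power2_eq_square field_simps)
  \<comment> \<open>The sign of the bracket in \<open>sq\<close>, which decides whether
    \<open>lens - g\<close> rises or falls. It changes once, from not bad to bad, so
    \<open>lens - g\<close> first falls and then rises; points of the first kind are compared with 0
    and points of the second kind with 1.\<close>
  define bad where "bad t \<longleftrightarrow> 7 / 20 \<le> 3 / 10 * t\<^sup>2 + 9 / 100 * (t\<^sup>2)\<^sup>2" for t :: real
  have bad_mono: "bad b" if "bad a" "0 \<le> a" "a \<le> b" for a b
  proof -
    have "a\<^sup>2 \<le> b\<^sup>2" "(a\<^sup>2)\<^sup>2 \<le> (b\<^sup>2)\<^sup>2" using that by (simp_all add: power_mono)
    then show ?thesis using that(1) by (simp add: bad_def)
  qed
  have pi: "pi / 4 \<ge> 0.7853" using pi_approx(1) by simp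
  consider "1 \<le> x" | "x < 1" "bad x" | "x < 1" "\<not> bad x" by linarith
  then show ?thesis
  proof cases
    case 1
    have "x - x ^ 3 / 6 - 3 / 50 * x ^ 5 \<le> 0.7853"
    proof -
      have "x ^ 3 - a ^ 3 - 3 * a\<^sup>2 * (x - a) \<ge> 0" "x ^ 5 - a ^ 5 - 5 * a ^ 4 * (x - a) \<ge> 0" if "0 \<le> a" for a
      proof -
        have "(x - a)\<^sup>2 * (x + 2 * a) = x ^ 3 - a ^ 3 - 3 * a\<^sup>2 * (x - a)"
          "(x - a)\<^sup>2 * (x ^ 3 + 2 * a * x\<^sup>2 + 3 * a\<^sup>2 * x + 4 * a ^ 3) = x ^ 5 - a ^ 5 - 5 * a ^ 4 * (x - a)"
          by (simp_all add: eval_nat_numeral algebra_simps)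
        moreover have "0 \<le> (x - a)\<^sup>2 * (x + 2 * a)" "0 \<le> (x - a)\<^sup>2 * (x ^ 3 + 2 * a * x\<^sup>2 + 3 * a\<^sup>2 * x + 4 * a ^ 3)"
          using assms that by (intro mult_nonneg_nonneg add_nonneg_nonneg zero_le_power zero_le_power2; simp)+
        ultimately show "x ^ 3 - a ^ 3 - 3 * a\<^sup>2 * (x - a) \<ge> 0" "x ^ 5 - a ^ 5 - 5 * a ^ 4 * (x - a) \<ge> 0"
          by simp_all
      qed
      \<comment> \<open>The powers are bounded below by their tangents at \<open>13 / 12\<close>,
        which is almost the point where \<open>x - x ^ 3 / 6 - 3 / 50 * x ^ 5\<close> is largest, so
        the resulting line is nearly horizontal.\<close>
      from this[of "13 / 12"] show ?thesis
        using 1 by (simp add: power_divide)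
    qed
    then show ?thesis using 1 pi by (simp add: lens_ge_1)
  next
    case 2
    have "lens 1 - lens x \<ge> g 1 - g x"
    proof (rule lens_mono_diff[where g'="\<lambda>t. g' (t\<^sup>2)"])
      fix t assume t: "x < t" "t < 1"
      have t2: "t\<^sup>2 \<le> 1" "(t\<^sup>2)\<^sup>2 \<le> 1" using t assms by (auto simp: power_le_one)
      have "bad t" using bad_mono[OF 2(2)] t assms by simp
      then have "(t\<^sup>2)\<^sup>2 * (7 / 20 - 3 / 10 * t\<^sup>2 - 9 / 100 * (t\<^sup>2)\<^sup>2) \<le> 0"
        unfolding bad_def by (intro mult_nonneg_nonpos) auto
      then have "1 - t\<^sup>2 \<le> (1 - t\<^sup>2 / 2 - 3 / 10 * (t\<^sup>2)\<^sup>2)\<^sup>2"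
        using sq[of "t\<^sup>2"] by linarith
      moreover have "0 \<le> 1 - t\<^sup>2 / 2 - 3 / 10 * (t\<^sup>2)\<^sup>2" using t2 by linarith
      ultimately have "sqrt (1 - t\<^sup>2) \<le> 1 - t\<^sup>2 / 2 - 3 / 10 * (t\<^sup>2)\<^sup>2"
        by (intro real_le_lsqrt)
      then show "g' (t\<^sup>2) \<le> - sqrt (1 - t\<^sup>2)" by (simp add: g'_def)
    qed (use g assms 2 in auto)
    then have "lens x \<le> - g 1 + g x" by (simp add: lens_ge_1)
    then show ?thesis using pi by (simp add: g_def)
  next
    case 3
    have "lens x - lens 0 \<le> g x - g 0"
    proof (rule lens_mono_diff'[where g'="\<lambda>t. g' (t\<^sup>2)"])
      fix t assume t: "0 < t" "t < x"
      have t2: "t\<^sup>2 \<le> 1" "(t\<^sup>2)\<^sup>2 \<le> 1" using t 3 by (auto simp: power_le_one)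
      have "\<not> bad t" using bad_mono[of t x] 3(2) t by auto
      then have "0 \<le> (t\<^sup>2)\<^sup>2 * (7 / 20 - 3 / 10 * t\<^sup>2 - 9 / 100 * (t\<^sup>2)\<^sup>2)"
        unfolding bad_def by (intro mult_nonneg_nonneg) auto
      then have "(1 - t\<^sup>2 / 2 - 3 / 10 * (t\<^sup>2)\<^sup>2)\<^sup>2 \<le> 1 - t\<^sup>2"
        using sq[of "t\<^sup>2"] by linarith
      then have "1 - t\<^sup>2 / 2 - 3 / 10 * (t\<^sup>2)\<^sup>2 \<le> sqrt (1 - t\<^sup>2)"
        by (rule real_le_rsqrt)
      then show "- sqrt (1 - t\<^sup>2) \<le> g' (t\<^sup>2)" by (simp add: g'_def)
    qed (use g assms 3 in auto)
    then show ?thesis by (simp add: g_def)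
  qed
qed

text \<open>Integration by parts: the derivative of \<open>lens\<close> is minus a square root, and
  the boundary terms vanish because \<open>lens 1 = 0\<close> and the power of \<open>x\<close> is
  positive.\<close>

lemma has_bochner_integral_lens_moment:
  assumes S: "continuous_on {0..1} S"
    and S': "\<And>x. 0 < x \<Longrightarrow> x < 1 \<Longrightarrow> (S has_real_derivative x ^ Suc n * sqrt (1 - x\<^sup>2)) (at x)"
  shows "has_bochner_integral lborel (\<lambda>x. indicator {0..1} x * (lens x * x ^ n)) ((S 1 - S 0) / real (Suc n))"
proof -
  define G where "G x = (x ^ Suc n * lens x + S x) / real (Suc n)" for x
  have "has_bochner_integral lborel (\<lambda>x. indicator {0..1} x * (lens x * x ^ n)) (G 1 - G 0)"
  proof (rule has_bochner_integral_FTC_interior)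
    show "continuous_on {0..1} G"
      unfolding G_def by (intro continuous_intros S lens_continuous) auto
    fix x :: real assume x: "0 < x" "x < 1"
    have "((\<lambda>x. x ^ Suc n * lens x + S x) has_real_derivative
      (real (Suc n) * x ^ n * lens x + x ^ Suc n * (- sqrt (1 - x\<^sup>2)) + x ^ Suc n * sqrt (1 - x\<^sup>2))) (at x)"
      using x DERIV_pow[of "Suc n" x]
      by (auto intro!: derivative_eq_intros S' simp del: power_Suc)
    from DERIV_cdivide[OF this, of "real (Suc n)"]
    show "(G has_real_derivative lens x * x ^ n) (at x)"
      unfolding G_def by (simp add: mult.commute del: of_nat_Suc)
  qed (auto intro!: mult_nonneg_nonneg lens_nonneg)
  then show ?thesis by (simp add: G_def lens_ge_1 diff_divide_distrib)
qed

lemma DERIV_sqrt_1_minus_square: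
  assumes "0 < x" "x < 1"
  shows "((\<lambda>x. sqrt (1 - x\<^sup>2)) has_real_derivative - x / sqrt (1 - x\<^sup>2)) (at x)"
    "sqrt (1 - x\<^sup>2) > 0" "(sqrt (1 - x\<^sup>2))\<^sup>2 = 1 - x\<^sup>2"
proof -
  have "x\<^sup>2 < 1" using assms by (simp add: power_less_one_iff)
  then show "((\<lambda>x. sqrt (1 - x\<^sup>2)) has_real_derivative - x / sqrt (1 - x\<^sup>2)) (at x)"
    by (auto intro!: derivative_eq_intros simp: divide_simps)
  show "sqrt (1 - x\<^sup>2) > 0" "(sqrt (1 - x\<^sup>2))\<^sup>2 = 1 - x\<^sup>2" using \<open>x\<^sup>2 < 1\<close> by auto
qed

lemma lens_moments:
  "has_bochner_integral lborel (\<lambda>x. indicator {0..1} x * (lens x * x ^ 1)) (pi / 32)"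
  "has_bochner_integral lborel (\<lambda>x. indicator {0..1} x * (lens x * x ^ 2)) (2 / 45)"
  "has_bochner_integral lborel (\<lambda>x. indicator {0..1} x * (lens x * x ^ 4)) (8 / 525)"
  "has_bochner_integral lborel (\<lambda>x. indicator {0..1} x * (lens x * x ^ 6)) (16 / 2205)"
proof -
  let ?w = "\<lambda>x::real. sqrt (1 - x\<^sup>2)"
  \<comment> \<open>With \<open>x = sin t\<close> the antiderivative is
    \<open>(t - sin (4 * t) / 4) / 8\<close>.\<close>
  have 1: "((\<lambda>x. (arcsin x - x * ?w x * (1 - 2 * x\<^sup>2)) / 8) has_real_derivative x ^ Suc 1 * ?w x) (at x)"
    if "0 < x" "x < 1" for x
  proof -
    note w = DERIV_sqrt_1_minus_square[OF that]
    have p: "((\<lambda>x::real. 1 - 2 * x\<^sup>2) has_real_derivative - 4 * x) (at x)"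
      by (auto intro!: derivative_eq_intros)
    have a: "(arcsin has_real_derivative inverse (?w x)) (at x)"
      using that by (intro DERIV_arcsin) auto
    have "((\<lambda>x. (arcsin x - x * ?w x * (1 - 2 * x\<^sup>2)) / 8) has_real_derivative
      (inverse (?w x) - ((1 * ?w x + - x / ?w x * x) * (1 - 2 * x\<^sup>2) + - 4 * x * (x * ?w x))) / 8) (at x)"
      by (rule DERIV_cdivide[OF DERIV_diff[OF a DERIV_mult[OF DERIV_mult[OF DERIV_ident w(1)] p]]])
    also have "(inverse (?w x) - ((1 * ?w x + - x / ?w x * x) * (1 - 2 * x\<^sup>2) + - 4 * x * (x * ?w x))) / 8
      = (inverse (?w x) - ((?w x + x * (- x / ?w x)) * (1 - 2 * x\<^sup>2) + x * ?w x * (- 4 * x))) / 8"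
      by (simp only: mult_ac mult_1)
    also have "(inverse (?w x) - ((?w x + x * (- x / ?w x)) * (1 - 2 * x\<^sup>2) + x * ?w x * (- 4 * x))) / 8 = x ^ Suc 1 * ?w x"
    proof -
      define w where "w = ?w x"
      have ww: "w > 0" "w * w = 1 - x * x" using w(2,3) by (simp_all add: w_def power2_eq_square)
      have xx: "x * (- x / w) = - ((1 - w * w) / w)" "x * w * (- 4 * x) = - 4 * ((1 - w * w) * w)"
        "x\<^sup>2 = 1 - w * w" "x ^ Suc 1 * w = (1 - w * w) * w"
        using ww by (simp_all add: power2_eq_square)
      show ?thesis
        unfolding w_def[symmetric] xx using ww(1) by (simp add: field_simps) (use ww(2) in algebra)
    qed
    finally show ?thesis .
  qed
  have "has_bochner_integral lborel (\<lambda>x. indicator {0..1} x * (lens x * x ^ 1))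
     (((arcsin 1 - 1 * ?w 1 * (1 - 2 * 1\<^sup>2)) / 8 - (arcsin 0 - 0 * ?w 0 * (1 - 2 * 0\<^sup>2)) / 8) / real (Suc 1))"
    by (rule has_bochner_integral_lens_moment[OF _ 1]) (auto intro!: continuous_intros)
  then show "has_bochner_integral lborel (\<lambda>x. indicator {0..1} x * (lens x * x ^ 1)) (pi / 32)"
    by simp
  \<comment> \<open>For odd powers of \<open>x\<close> the substitution of \<open>w\<close> for
    \<open>sqrt (1 - x\<^sup>2)\<close> leaves the polynomial
    \<open>(1 - w\<^sup>2) ^ k * w\<^sup>2\<close>. The parameters \<open>a\<close>,
    \<open>b\<close>, \<open>c\<close> cover the cases \<open>k = 1, 2, 3\<close> at once.\<close>
  have W: "((\<lambda>x. - (W x ^ 3 / 3 - a * W x ^ 5 + b * W x ^ 7 - c * W x ^ 9)) has_real_derivative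
      - (W x ^ 2 * W' - a * (5 * W x ^ 4 * W') + b * (7 * W x ^ 6 * W') - c * (9 * W x ^ 8 * W'))) (at x)"
    if "(W has_real_derivative W') (at x)" for W :: "real \<Rightarrow> real" and W' x a b c
    using that by (auto intro!: derivative_eq_intros)
  have odd: "((\<lambda>x. - (?w x ^ 3 / 3 - a * ?w x ^ 5 + b * ?w x ^ 7 - c * ?w x ^ 9)) has_real_derivative
      x * ?w x * (1 - 5 * a * ?w x ^ 2 + 7 * b * ?w x ^ 4 - 9 * c * ?w x ^ 6)) (at x)"
    if "0 < x" "x < 1" for x a b c
  proof -
    note w = DERIV_sqrt_1_minus_square[OF that]
    have "((\<lambda>x. - (?w x ^ 3 / 3 - a * ?w x ^ 5 + b * ?w x ^ 7 - c * ?w x ^ 9)) has_real_derivative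
      - (?w x ^ 2 * (- x / ?w x) - a * (5 * ?w x ^ 4 * (- x / ?w x)) + b * (7 * ?w x ^ 6 * (- x / ?w x)) - c * (9 * ?w x ^ 8 * (- x / ?w x)))) (at x)"
      by (rule W[OF w(1)])
    also have "- (?w x ^ 2 * (- x / ?w x) - a * (5 * ?w x ^ 4 * (- x / ?w x)) + b * (7 * ?w x ^ 6 * (- x / ?w x)) - c * (9 * ?w x ^ 8 * (- x / ?w x)))
       = x * ?w x * (1 - 5 * a * ?w x ^ 2 + 7 * b * ?w x ^ 4 - 9 * c * ?w x ^ 6)"
    proof -
      define w where "w = ?w x"
      have "w \<noteq> 0" using w(2) by (simp add: w_def)
      then show ?thesis unfolding w_def[symmetric] by (simp add: field_simps power2_eq_square eval_nat_numeral)
    qed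
    finally show ?thesis .
  qed
  have cont: "continuous_on {0..1} (\<lambda>x. - (?w x ^ 3 / 3 - a * ?w x ^ 5 + b * ?w x ^ 7 - c * ?w x ^ 9))" for a b c
    by (intro continuous_intros) auto
  have w2: "?w x ^ 2 = 1 - x ^ 2" "?w x ^ 4 = (1 - x ^ 2) ^ 2" "?w x ^ 6 = (1 - x ^ 2) ^ 3" if "0 < x" "x < 1" for x
    using DERIV_sqrt_1_minus_square(3)[OF that] power_mult[of "?w x" 2 2] power_mult[of "?w x" 2 3] by auto
  have m: "((\<lambda>x. - (?w x ^ 3 / 3 - (1 / 5) * ?w x ^ 5 + 0 * ?w x ^ 7 - 0 * ?w x ^ 9)) has_real_derivative x ^ Suc 2 * ?w x) (at x)"
    "((\<lambda>x. - (?w x ^ 3 / 3 - (2 / 5) * ?w x ^ 5 + (1 / 7) * ?w x ^ 7 - 0 * ?w x ^ 9)) has_real_derivative x ^ Suc 4 * ?w x) (at x)"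
    "((\<lambda>x. - (?w x ^ 3 / 3 - (3 / 5) * ?w x ^ 5 + (3 / 7) * ?w x ^ 7 - (1 / 9) * ?w x ^ 9)) has_real_derivative x ^ Suc 6 * ?w x) (at x)"
    if x: "0 < x" "x < 1" for x
  proof -
    have eq: "x * ?w x * (1 - 5 * (1 / 5) * ?w x ^ 2 + 7 * 0 * ?w x ^ 4 - 9 * 0 * ?w x ^ 6) = x ^ Suc 2 * ?w x"
      "x * ?w x * (1 - 5 * (2 / 5) * ?w x ^ 2 + 7 * (1 / 7) * ?w x ^ 4 - 9 * 0 * ?w x ^ 6) = x ^ Suc 4 * ?w x"
      "x * ?w x * (1 - 5 * (3 / 5) * ?w x ^ 2 + 7 * (3 / 7) * ?w x ^ 4 - 9 * (1 / 9) * ?w x ^ 6) = x ^ Suc 6 * ?w x"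
      unfolding w2[OF x] by (simp_all add: algebra_simps eval_nat_numeral)
    show "((\<lambda>x. - (?w x ^ 3 / 3 - (1 / 5) * ?w x ^ 5 + 0 * ?w x ^ 7 - 0 * ?w x ^ 9)) has_real_derivative x ^ Suc 2 * ?w x) (at x)"
      "((\<lambda>x. - (?w x ^ 3 / 3 - (2 / 5) * ?w x ^ 5 + (1 / 7) * ?w x ^ 7 - 0 * ?w x ^ 9)) has_real_derivative x ^ Suc 4 * ?w x) (at x)"
      "((\<lambda>x. - (?w x ^ 3 / 3 - (3 / 5) * ?w x ^ 5 + (3 / 7) * ?w x ^ 7 - (1 / 9) * ?w x ^ 9)) has_real_derivative x ^ Suc 6 * ?w x) (at x)"
      by (rule DERIV_cong[OF odd[OF x] eq(1)] DERIV_cong[OF odd[OF x] eq(2)] DERIV_cong[OF odd[OF x] eq(3)])+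
  qed
  show "has_bochner_integral lborel (\<lambda>x. indicator {0..1} x * (lens x * x ^ 2)) (2 / 45)"
    using has_bochner_integral_lens_moment[OF cont m(1)] by simp
  show "has_bochner_integral lborel (\<lambda>x. indicator {0..1} x * (lens x * x ^ 4)) (8 / 525)"
    using has_bochner_integral_lens_moment[OF cont m(2)] by simp
  show "has_bochner_integral lborel (\<lambda>x. indicator {0..1} x * (lens x * x ^ 6)) (16 / 2205)"
    using has_bochner_integral_lens_moment[OF cont m(3)] by simp
qed

section \<open>Balls\<close>

lemma emeasure_half_ball_overlap:
  "emeasure lborel {y \<in> ball (0::real^2) (1/2). y + z \<in> ball 0 (1/2)} = ennreal (lens (norm z))"
  using emeasure_ball_overlap[of "1/2" z] by (simp add: power2_eq_square)

text \<open>Every ball configuration is, up to scaling, one with radius \<open>1/2\<close>.\<close>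

locale ball_lattice = planar_lattice +
  assumes admissible: "admissible_radius \<Lambda> (1/2)"
begin

abbreviation B :: "(real^2) set" where "B \<equiv> ball 0 (1/2)"
definition C :: "real^2 \<Rightarrow> real" where "C = autocorrelation (indicat_real (balls \<Lambda> (1/2)))"
definition vf :: real where "vf = pi / 4 / covol"

lemma vf_pos: "0 < vf" using covol_pos by (simp add: vf_def)

lemma inverse_covol: "1 / covol = 4 * vf / pi" using covol_pos by (simp add: vf_def)

lemma balls_eq_spread: "balls \<Lambda> (1/2) = spread B"
  by (auto simp: balls_def spread_def dist_norm norm_minus_commute)

lemma norm_lattice_ge_1: "q \<in> \<Lambda> \<Longrightarrow> q \<noteq> 0 \<Longrightarrow> 1 \<le> norm q"
  using admissible zero_in by (force simp: admissible_radius_def dist_norm)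

lemma packing_ball: "packing B"
proof -
  have "q = 0" if "x \<in> B" "q \<in> \<Lambda>" "x + q \<in> B" for x q
  proof (rule ccontr)
    assume "q \<noteq> 0"
    then have "1 \<le> norm q" using that norm_lattice_ge_1 by blast
    moreover have "norm q \<le> norm (x + q) + norm x"
      using norm_triangle_ineq4[of "x + q" x] by simp
    ultimately show False using that by simp
  qed
  then show ?thesis by (auto simp: packing_def)
qed

lemma measure_B: "measure lborel B = pi / 4"
  by (simp add: measure_def emeasure_ball_vec2 power2_eq_square)

lemma C_0: "C 0 = vf"
  unfolding C_def balls_eq_spread autocorrelation_spread_0[OF packing_ball] measure_B vf_def ..

lemma C_measurable [measurable]: "C \<in> borel_measurable borel"
  unfolding C_def balls_eq_spread by (rule autocorrelation_spread_measurable[OF packing_ball])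

lemma C_bounds: "0 \<le> C z" "C z \<le> C 0"
  unfolding C_def balls_eq_spread by (rule autocorrelation_spread_bounds[OF packing_ball])+

lemma C_eq: "C z = measure lborel {x \<in> B. x + z \<in> spread B} / covol"
  unfolding C_def balls_eq_spread by (rule autocorrelation_spread[OF packing_ball])

lemma measure_half_ball_overlap: "measure lborel {y \<in> B. y + z \<in> B} = lens (norm z)"
  by (simp only: measure_def emeasure_half_ball_overlap enn2real_ennreal[OF lens_nonneg])

lemma spread_B_measurable [measurable]: "spread B \<in> sets borel"
  by (rule spread_borel) simp

lemma fmeasurable_overlap: "{x \<in> B. x + z \<in> S} \<in> fmeasurable lborel" if [measurable]: "S \<in> sets borel"
proof (rule fmeasurableI2)
  show "B \<in> fmeasurable lborel" by (auto simp: fmeasurable_def emeasure_ball_vec2)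
  have [measurable]: "B \<in> sets borel" by simp
  show "{x \<in> B. x + z \<in> S} \<in> sets lborel" by simp
qed auto

lemma C_ge: "lens (norm z) / covol \<le> C z"
proof -
  have "measure lborel {y \<in> B. y + z \<in> B} \<le> measure lborel {x \<in> B. x + z \<in> spread B}"
    by (intro measure_mono_fmeasurable fmeasurable_overlap)
      (auto intro!: fmeasurable_overlap[THEN fmeasurableD] subsetD[OF subset_spread])
  then show ?thesis
    unfolding C_eq measure_half_ball_overlap using covol_pos by (intro divide_right_mono) auto
qed

text \<open>By the triangle inequality, \<open>1/2 + 1 + 1/2\<close>, only these neighbours can meet
  a ball that is shifted by a vector shorter than 1.\<close>

definition near :: "(real^2) set" where "near = {q \<in> \<Lambda>. q \<noteq> 0 \<and> norm q \<le> 2}"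

lemma finite_near: "finite near"
proof -
  have "uniform_discrete near"
    using admissible by (intro uniformI2[of 1]) (force simp: near_def admissible_radius_def)+
  moreover have "bounded near" by (auto simp: near_def bounded_iff)
  ultimately show ?thesis using uniform_discrete_finite_iff by blast
qed

text \<open>An admissible radius allows touching balls, so neighbours can contribute for arbitrarily
  small \<open>z\<close>. By \<open>lens_le_near_1\<close> each contribution has the order 3/2 in
  \<open>norm z\<close>, and there are finitely many neighbours.\<close>

lemma C_le:
  assumes "norm z < 1"
  shows "C z \<le> (lens (norm z) + real (card near) * (norm z * sqrt (2 * norm z))) / covol"
proof -
  have sub: "{x \<in> B. x + z \<in> spread B} \<subseteq> {x \<in> B. x + z \<in> B} \<union> (\<Union>q\<in>near. {x \<in> B. x + (z - q) \<in> B})"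
  proof
    fix x assume "x \<in> {x \<in> B. x + z \<in> spread B}"
    then obtain q where q: "x \<in> B" "q \<in> \<Lambda>" "x + z - q \<in> B" by (auto simp: spread_def)
    have "norm q \<le> norm (x + z) + norm (x + z - q)"
      using norm_triangle_ineq4[of "x + z" "x + z - q"] by simp
    also have "norm (x + z) \<le> norm x + norm z" by (rule norm_triangle_ineq)
    finally have "norm q \<le> 2" using q assms by simp
    with q show "x \<in> {x \<in> B. x + z \<in> B} \<union> (\<Union>q\<in>near. {x \<in> B. x + (z - q) \<in> B})"
      by (cases "q = 0") (auto simp: near_def add_diff_eq)
  qed
  have "measure lborel {x \<in> B. x + z \<in> spread B}
      \<le> measure lborel ({x \<in> B. x + z \<in> B} \<union> (\<Union>q\<in>near. {x \<in> B. x + (z - q) \<in> B}))"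
    using sub finite_near
    by (intro measure_mono_fmeasurable fmeasurable.Un fmeasurable.finite_UN fmeasurable_overlap)
      (auto intro!: fmeasurable_overlap[THEN fmeasurableD])
  also have "\<dots> \<le> measure lborel {x \<in> B. x + z \<in> B} + measure lborel (\<Union>q\<in>near. {x \<in> B. x + (z - q) \<in> B})"
    using finite_near by (intro measure_Un_le sets.finite_UN) (auto intro!: fmeasurable_overlap[THEN fmeasurableD])
  also have "measure lborel (\<Union>q\<in>near. {x \<in> B. x + (z - q) \<in> B}) \<le> (\<Sum>q\<in>near. measure lborel {x \<in> B. x + (z - q) \<in> B})"
    using finite_near by (intro measure_UNION_le) (auto intro!: fmeasurable_overlap[THEN fmeasurableD])
  also have "\<dots> \<le> (\<Sum>q\<in>near. norm z * sqrt (2 * norm z))"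
  proof (rule sum_mono)
    fix q assume "q \<in> near"
    then have "1 \<le> norm q" using norm_lattice_ge_1 by (auto simp: near_def)
    moreover have "norm q - norm z \<le> norm (z - q)" using norm_triangle_ineq2[of q z] by (simp add: norm_minus_commute)
    ultimately have "lens (norm (z - q)) \<le> lens (1 - norm z)"
      using assms by (intro lens_antimono) auto
    also have "\<dots> \<le> norm z * sqrt (2 * norm z)"
      using lens_le_near_1[of "1 - norm z"] assms by simp
    finally show "measure lborel {x \<in> B. x + (z - q) \<in> B} \<le> norm z * sqrt (2 * norm z)"
      by (simp only: measure_half_ball_overlap)
  qed
  finally show ?thesis
    unfolding C_eq measure_half_ball_overlap using covol_pos by (intro divide_right_mono) auto
qed

text \<open>The difference quotient is squeezed between the linear bound for the overlap of a ball
  with itself and \<open>C_le\<close>, whose excess over the linear term tends to 0 with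
  \<open>t\<close>.\<close>

lemma one_sided_deriv0_C: "one_sided_deriv0 C z = - norm z / covol"
  unfolding one_sided_deriv0_def
proof (rule tendsto_Lim)
  define n where "n = norm z"
  define h where "h t = (- n + t\<^sup>2 * n ^ 3 / 6 + 3 / 50 * t ^ 4 * n ^ 5 + real (card near) * (n * sqrt (2 * (t * n)))) / covol" for t
  show "((\<lambda>t. (C (t *\<^sub>R z) - C 0) / t) \<longlongrightarrow> - norm z / covol) (at_right 0)"
  proof (rule tendsto_sandwich[of "\<lambda>_. - n / covol" _ _ h])
    have ev: "eventually (\<lambda>t::real. 0 < t \<and> t < 1 / (n + 1)) (at_right 0)"
      using norm_ge_zero[of z] by (intro eventually_at_rightI[of 0 "1 / (n + 1)"]) (auto simp: n_def add_nonneg_pos)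
    show "eventually (\<lambda>t. - n / covol \<le> (C (t *\<^sub>R z) - C 0) / t) (at_right 0)"
      using ev
    proof eventually_elim
      case (elim t)
      have "(pi / 4 - t * n) / covol \<le> lens (norm (t *\<^sub>R z)) / covol"
        using elim covol_pos lens_ge_linear[of "t * n"] by (intro divide_right_mono) (auto simp: n_def)
      also have "\<dots> \<le> C (t *\<^sub>R z)" by (rule C_ge)
      finally have "t * (- n / covol) \<le> C (t *\<^sub>R z) - C 0"
        by (simp add: C_0 vf_def diff_divide_distrib)
      then show ?case using elim by (simp add: le_divide_eq mult.commute)
    qed
    show "eventually (\<lambda>t. (C (t *\<^sub>R z) - C 0) / t \<le> h t) (at_right 0)"
      using ev
    proof eventually_elim
      case (elim t)
      have n: "n \<ge> 0" by (simp add: n_def)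
      have "t * (n + 1) < 1" using elim n by (simp add: less_divide_eq)
      then have "norm (t *\<^sub>R z) < 1" using elim by (simp add: n_def algebra_simps)
      from C_le[OF this] have "C (t *\<^sub>R z) \<le> (lens (t * n) + real (card near) * (t * n * sqrt (2 * (t * n)))) / covol"
        using elim by (simp add: n_def)
      also have "\<dots> \<le> (pi / 4 - t * n + (t * n) ^ 3 / 6 + 3 / 50 * (t * n) ^ 5 + real (card near) * (t * n * sqrt (2 * (t * n)))) / covol"
        using elim n covol_pos lens_le[of "t * n"] by (intro divide_right_mono) auto
      also have "pi / 4 - t * n + (t * n) ^ 3 / 6 + 3 / 50 * (t * n) ^ 5 + real (card near) * (t * n * sqrt (2 * (t * n)))
        = pi / 4 + t * (- n + t\<^sup>2 * n ^ 3 / 6 + 3 / 50 * t ^ 4 * n ^ 5 + real (card near) * (n * sqrt (2 * (t * n))))"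
        by (simp add: field_simps eval_nat_numeral)
      also have "\<dots> / covol = C 0 + t * h t"
        by (subst add_divide_distrib) (simp only: C_0 vf_def h_def times_divide_eq_right)
      finally have "C (t *\<^sub>R z) - C 0 \<le> t * h t" by simp
      then show ?case using elim by (simp add: divide_le_eq mult.commute)
    qed
    have "(h \<longlongrightarrow> h 0) (at_right 0)"
      unfolding h_def using covol_pos by (intro tendsto_intros) auto
    then show "(h \<longlongrightarrow> - norm z / covol) (at_right 0)"
      by (simp add: h_def n_def)
  qed (simp add: n_def)
qed simp

text \<open>The coefficient \<open>8 * vf\<close> is \<open>2 * pi / covol\<close>, the full angle
  times the slope of the autocorrelation at 0. This is twice the perimeter per unit area.\<close>

sublocale radial_profile "indicat_real (balls \<Lambda> (1/2))" "8 * vf" "2 * pi * vf"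
proof (unfold_locales, fold C_def)
  show "indicat_real (balls \<Lambda> (1/2)) \<in> borel_measurable borel"
    unfolding balls_eq_spread by measurable
  show "has_bochner_integral lborel (\<lambda>\<theta>. indicator {0..2 * pi} \<theta> * one_sided_deriv0 C (polar r \<theta>)) (- (8 * vf * r))"
    if "0 < r" for r
  proof -
    have "has_bochner_integral lborel (\<lambda>\<theta>. indicator {0..2 * pi} \<theta> * (- r / covol)) (2 * pi * (- r / covol))"
      by (intro has_bochner_integral_mult_left) (auto simp: has_bochner_integral_iff)
    moreover have "2 * pi * (- r / covol) = - (8 * vf * r)"
      by (simp add: vf_def)
    ultimately show ?thesis using that by (simp add: one_sided_deriv0_C)
  qed
  show "C 0 + one_sided_deriv0 C z \<le> C z" for z
  proof -
    have "(pi / 4 - norm z) / covol \<le> lens (norm z) / covol"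
      using covol_pos lens_ge_linear[of "norm z"] by (intro divide_right_mono) auto
    then show ?thesis
      using C_ge[of z] by (simp add: one_sided_deriv0_C C_0 vf_def diff_divide_distrib)
  qed
qed (use C_bounds vf_pos C_0 in auto)

end

section \<open>Lower bound for the energy of balls\<close>

lemma has_bochner_integral_imp_nn_integral:
  fixes c :: real
  assumes "has_bochner_integral M f c" and "\<And>x. 0 \<le> f x"
  shows "(\<integral>\<^sup>+ x. ennreal (f x) \<partial>M) = ennreal c"
  using assms nn_integral_eq_integral[of M f] by (auto simp: has_bochner_integral_iff)

lemma has_bochner_integral_cube_sqrt:
  "has_bochner_integral lborel (\<lambda>t. indicator {0..1} t * (t ^ 3 * sqrt (1 - t\<^sup>2))) (2 / 15)"
proof -
  let ?w = "\<lambda>x::real. sqrt (1 - x\<^sup>2)"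
  have "has_bochner_integral lborel (\<lambda>t. indicator {0..1} t * (t ^ 3 * ?w t))
    (- (?w 1 ^ 3 / 3 - ?w 1 ^ 5 / 5) - - (?w 0 ^ 3 / 3 - ?w 0 ^ 5 / 5))"
  proof (rule has_bochner_integral_FTC_interior)
    show "continuous_on {0..1} (\<lambda>x. - (?w x ^ 3 / 3 - ?w x ^ 5 / 5))"
      by (intro continuous_intros) auto
    fix x :: real assume x: "0 < x" "x < 1"
    note w = DERIV_sqrt_1_minus_square[OF x]
    have W: "((\<lambda>x. - (W x ^ 3 / 3 - W x ^ 5 / 5)) has_real_derivative - (W x ^ 2 * W' - W x ^ 4 * W')) (at x)"
      if "(W has_real_derivative W') (at x)" for W :: "real \<Rightarrow> real" and W'
      using that by (auto intro!: derivative_eq_intros)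
    have "- (?w x ^ 2 * (- x / ?w x) - ?w x ^ 4 * (- x / ?w x)) = x ^ 3 * ?w x"
    proof -
      define w where "w = ?w x"
      have ww: "w > 0" "x * x = 1 - w * w" using w(2,3) by (simp_all add: w_def power2_eq_square)
      have "- (w ^ 2 * (- x / w) - w ^ 4 * (- x / w)) = x * (1 - w * w) * w"
        using ww(1) by (simp add: field_simps eval_nat_numeral)
      also have "\<dots> = x ^ 3 * w"
        unfolding ww(2)[symmetric] by (simp add: power3_eq_cube)
      finally show ?thesis unfolding w_def .
    qed
    with W[OF w(1)] show "((\<lambda>x. - (?w x ^ 3 / 3 - ?w x ^ 5 / 5)) has_real_derivative x ^ 3 * ?w x) (at x)"
      by (simp only:)
  qed (auto simp: power_le_one_iff)
  then show ?thesis by simp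
qed

text \<open>In the limit \<open>s0 = 0\<close> this is an equality, which represents \<open>|z| powi (-3)\<close> as a superposition of the
  autocorrelations of discs of radius \<open>s\<close>.\<close>

lemma disc_kernel_superposition:
  assumes r: "0 < r" and s0: "0 < s0"
  shows "(\<integral>\<^sup>+ s. indicator {s0..} s * ennreal (45 / 64 / s ^ 6 * (4 * s\<^sup>2 * lens (r / (2 * s)))) \<partial>lborel) \<le> ennreal (1 / r ^ 3)"
proof -
  have lens_nn: "ennreal (lens x) = (\<integral>\<^sup>+ t. ennreal (indicator {x..1} t * sqrt (1 - t\<^sup>2)) \<partial>lborel)" if "0 \<le> x" for x
  proof (cases "x \<le> 1")
    case True
    have I: "has_bochner_integral lborel (\<lambda>t. indicator {x..1} t * sqrt (1 - t\<^sup>2)) (lens x)"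
      using True that by (intro has_bochner_integral_lens)
    have nn: "0 \<le> indicator {x..1} t * sqrt (1 - t\<^sup>2)" for t
      using that by (auto simp: indicator_def power_le_one_iff)
    show ?thesis
      using I nn_integral_eq_integral[of lborel "\<lambda>t. indicator {x..1} t * sqrt (1 - t\<^sup>2)"] nn
      by (auto simp: has_bochner_integral_iff)
  qed (simp add: lens_ge_1)
  \<comment> \<open>With \<open>lens\<close> written as an integral over \<open>t\<close>, the
    integral over \<open>s\<close> can be done first. The condition
    \<open>r / (2 * s) \<le> t\<close> becomes \<open>r / (2 * t) \<le> s\<close>, and the power of
    \<open>s\<close> integrates to \<open>8 * t ^ 3 / (3 * r ^ 3)\<close>. The remaining moment
    \<open>2 / 15\<close> is what fixes the constant \<open>45 / 64\<close>.\<close>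
  define F where "F s t = ennreal (indicator {0<..} s * (indicator {r / (2 * s)..1} t * (45 / 16 / s ^ 4 * sqrt (1 - t\<^sup>2))))" for s t :: real
  have F: "F s t = ennreal (if 0 < s \<and> r / (2 * s) \<le> t \<and> t \<le> 1 then 45 / 16 / s ^ 4 * sqrt (1 - t\<^sup>2) else 0)" for s t
    by (simp add: F_def indicator_def)
  have [measurable]: "case_prod F \<in> borel_measurable (lborel \<Otimes>\<^sub>M lborel)"
    unfolding F by measurable
  have "(\<integral>\<^sup>+ s. indicator {s0..} s * ennreal (45 / 64 / s ^ 6 * (4 * s\<^sup>2 * lens (r / (2 * s)))) \<partial>lborel)
     \<le> (\<integral>\<^sup>+ s. \<integral>\<^sup>+ t. F s t \<partial>lborel \<partial>lborel)"
  proof (rule nn_integral_mono)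
    fix s :: real
    have "ennreal (45 / 64 / s ^ 6 * (4 * s\<^sup>2 * lens (r / (2 * s)))) = (\<integral>\<^sup>+ t. F s t \<partial>lborel)" if s: "0 < s"
    proof -
      have "45 / 64 / s ^ 6 * (4 * s\<^sup>2 * lens (r / (2 * s))) = 45 / 16 / s ^ 4 * lens (r / (2 * s))"
        using s by (simp add: field_simps eval_nat_numeral)
      then have "ennreal (45 / 64 / s ^ 6 * (4 * s\<^sup>2 * lens (r / (2 * s)))) = ennreal (45 / 16 / s ^ 4 * lens (r / (2 * s)))"
        by (simp only:)
      also have "\<dots> = ennreal (45 / 16 / s ^ 4) * ennreal (lens (r / (2 * s)))"
        using s by (intro ennreal_mult lens_nonneg) auto
      also have "\<dots> = ennreal (45 / 16 / s ^ 4) * (\<integral>\<^sup>+ t. ennreal (indicator {r / (2 * s)..1} t * sqrt (1 - t\<^sup>2)) \<partial>lborel)"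
        using s r by (subst lens_nn) auto
      also have "\<dots> = (\<integral>\<^sup>+ t. ennreal (45 / 16 / s ^ 4) * ennreal (indicator {r / (2 * s)..1} t * sqrt (1 - t\<^sup>2)) \<partial>lborel)"
        by (rule nn_integral_cmult[symmetric]) measurable
      also have "\<dots> = (\<integral>\<^sup>+ t. F s t \<partial>lborel)"
      proof (rule nn_integral_cong)
        fix t
        have "F s t = ennreal (45 / 16 / s ^ 4 * (indicator {r / (2 * s)..1} t * sqrt (1 - t\<^sup>2)))"
          unfolding F_def using s by (intro arg_cong[where f=ennreal]) simp
        moreover have "0 \<le> 45 / 16 / s ^ 4" using s by simp
        ultimately show "ennreal (45 / 16 / s ^ 4) * ennreal (indicator {r / (2 * s)..1} t * sqrt (1 - t\<^sup>2)) = F s t"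
          by (simp only: ennreal_mult')
      qed
      finally show ?thesis .
    qed
    then show "indicator {s0..} s * ennreal (45 / 64 / s ^ 6 * (4 * s\<^sup>2 * lens (r / (2 * s)))) \<le> (\<integral>\<^sup>+ t. F s t \<partial>lborel)"
      using s0 by (simp add: indicator_def)
  qed
  also have "\<dots> = (\<integral>\<^sup>+ t. \<integral>\<^sup>+ s. F s t \<partial>lborel \<partial>lborel)"
    by (rule lborel_pair.Fubini') measurable
  also have "\<dots> = (\<integral>\<^sup>+ t. ennreal (indicator {0..1} t * (15 / (2 * r ^ 3) * (t ^ 3 * sqrt (1 - t\<^sup>2)))) \<partial>lborel)"
  proof (rule nn_integral_cong_AE, use AE_lborel_singleton[of 0] in eventually_elim)
    fix t :: real assume t0: "t \<noteq> 0"
    show "(\<integral>\<^sup>+ s. F s t \<partial>lborel) = ennreal (indicator {0..1} t * (15 / (2 * r ^ 3) * (t ^ 3 * sqrt (1 - t\<^sup>2))))"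
    proof (cases "0 < t \<and> t \<le> 1")
      case True
      have sq: "0 \<le> sqrt (1 - t\<^sup>2)" using True by (simp add: power_le_one_iff)
      have "F s t = ennreal (45 / 16 * sqrt (1 - t\<^sup>2)) * ennreal (indicator {r / (2 * t)..} s * (1 / s ^ Suc (Suc 2)))" for s
      proof -
        have pos: "0 < r / (2 * t)" using r True by simp
        have "(0 < s \<and> r / (2 * s) \<le> t) \<longleftrightarrow> r / (2 * t) \<le> s"
        proof (cases "0 < s")
          case s: True
          then show ?thesis using True by (simp add: divide_le_eq mult_ac)
        next
          case False
          then show ?thesis using pos by linarith
        qed
        then show ?thesis
          using True sq by (simp add: F ennreal_mult'[symmetric] indicator_def eval_nat_numeral)
      qed
      then have "(\<integral>\<^sup>+ s. F s t \<partial>lborel)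
         = ennreal (45 / 16 * sqrt (1 - t\<^sup>2)) * (\<integral>\<^sup>+ s. ennreal (indicator {r / (2 * t)..} s * (1 / s ^ Suc (Suc 2))) \<partial>lborel)"
        by (simp add: nn_integral_cmult)
      also have "(\<integral>\<^sup>+ s. ennreal (indicator {r / (2 * t)..} s * (1 / s ^ Suc (Suc 2))) \<partial>lborel) = ennreal (1 / (real (Suc 2) * (r / (2 * t)) ^ Suc 2))"
      proof -
        have I: "has_bochner_integral lborel (\<lambda>s. indicator {r / (2 * t)..} s * (1 / s ^ Suc (Suc 2))) (1 / (real (Suc 2) * (r / (2 * t)) ^ Suc 2))"
          using True r by (intro has_bochner_integral_tail_power) auto
        have "0 \<le> s" if "r / (2 * t) \<le> s" for s
          using that True r order_trans[of 0 "r / (2 * t)" s] by simp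
        then have nn: "0 \<le> indicator {r / (2 * t)..} s * (1 / s ^ Suc (Suc 2))" for s :: real
          by (simp add: indicator_def)
        show ?thesis
          by (rule has_bochner_integral_imp_nn_integral[OF I nn])
      qed
      also have "ennreal (45 / 16 * sqrt (1 - t\<^sup>2)) * ennreal (1 / (real (Suc 2) * (r / (2 * t)) ^ Suc 2))
         = ennreal (15 / (2 * r ^ 3) * (t ^ 3 * sqrt (1 - t\<^sup>2)))"
        using True r sq by (subst ennreal_mult'[symmetric]) (auto simp: field_simps eval_nat_numeral)
      finally show ?thesis using True by simp
    next
      case False
      have "F s t = 0" for s
      proof -
        have "0 < r / (2 * s)" if "0 < s" using that r by simp
        then show ?thesis using False t0 by (force simp: F)
      qed
      then show ?thesis using False t0 by simp
    qed
  qed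
  also have "\<dots> = (\<integral>\<^sup>+ t. ennreal (15 / (2 * r ^ 3)) * ennreal (indicator {0..1} t * (t ^ 3 * sqrt (1 - t\<^sup>2))) \<partial>lborel)"
    using r by (intro nn_integral_cong) (simp add: ennreal_mult'[symmetric] mult_ac)
  also have "\<dots> = ennreal (15 / (2 * r ^ 3)) * (\<integral>\<^sup>+ t. ennreal (indicator {0..1} t * (t ^ 3 * sqrt (1 - t\<^sup>2))) \<partial>lborel)"
    by (rule nn_integral_cmult) measurable
  also have "(\<integral>\<^sup>+ t. ennreal (indicator {0..1} t * (t ^ 3 * sqrt (1 - t\<^sup>2))) \<partial>lborel) = ennreal (2 / 15)"
  proof -
    have nn: "0 \<le> indicator {0..1} t * (t ^ 3 * sqrt (1 - t\<^sup>2))" for t :: real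
      by (auto simp: indicator_def power_le_one_iff)
    show ?thesis
      using has_bochner_integral_cube_sqrt nn_integral_eq_integral[of lborel "\<lambda>t. indicator {0..1} t * (t ^ 3 * sqrt (1 - t\<^sup>2))"] nn
      by (auto simp: has_bochner_integral_iff)
  qed
  also have "ennreal (15 / (2 * r ^ 3)) * ennreal (2 / 15) = ennreal (1 / r ^ 3)"
    using r by (subst ennreal_mult'[symmetric]) (auto simp: field_simps)
  finally show ?thesis .
qed

text \<open>\<open>overlap_bound s\<close> is an upper bound for \<open>2 \<pi>\<close> times the integral of \<open>r * lens r * L r\<close>, where \<open>L r\<close> is the
  overlap of two discs of radius \<open>s\<close> at distance \<open>r\<close>.\<close>

definition overlap_bound :: "real \<Rightarrow> real" where
  "overlap_bound s = 2 * pi * (pi\<^sup>2 * s\<^sup>2 / 32 - 4 * s / 45 + 2 / (1575 * s) + 1 / (18375 * s ^ 3))"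

text \<open>Only the overlap of the discs of radius \<open>s\<close> is replaced by its polynomial
  bound \<open>p\<close>. The factor \<open>lens\<close> stays exact, so the integral is a
  combination of the four moments in \<open>lens_moments\<close>.\<close>

lemma nn_integral_lens_overlap:
  assumes s: "0 < s"
  shows "(\<integral>\<^sup>+ z. ennreal (lens (norm z)) * ennreal (4 * s\<^sup>2 * lens (norm z / (2 * s))) \<partial>(lborel :: (real^2) measure))
    \<le> ennreal (overlap_bound s)"
proof -
  define p where "p r = pi * s\<^sup>2 - 2 * s * r + r ^ 3 / (12 * s) + 3 / 400 * r ^ 5 / s ^ 3" for r
  have p: "4 * s\<^sup>2 * lens (r / (2 * s)) \<le> p r" if "0 \<le> r" for r
  proof -
    have "4 * s\<^sup>2 * lens (r / (2 * s)) \<le> 4 * s\<^sup>2 * (pi / 4 - r / (2 * s) + (r / (2 * s)) ^ 3 / 6 + 3 / 50 * (r / (2 * s)) ^ 5)"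
      using s that by (intro mult_left_mono lens_le) auto
    also have "\<dots> = p r"
      using s by (simp add: p_def power_divide field_simps eval_nat_numeral)
    finally show ?thesis .
  qed
  have p_nonneg: "0 \<le> p r" if "0 \<le> r" for r
    using p[OF that] lens_nonneg[of "r / (2 * s)"] s by (meson order_trans mult_nonneg_nonneg zero_le_numeral zero_le_power2)
  have I: "has_bochner_integral lborel (\<lambda>r. 2 * pi * (pi * s\<^sup>2 * (indicator {0..1} r * (lens r * r ^ 1)) - 2 * s * (indicator {0..1} r * (lens r * r ^ 2))
      + 1 / (12 * s) * (indicator {0..1} r * (lens r * r ^ 4)) + 3 / 400 / s ^ 3 * (indicator {0..1} r * (lens r * r ^ 6))))
     (2 * pi * (pi * s\<^sup>2 * (pi / 32) - 2 * s * (2 / 45) + 1 / (12 * s) * (8 / 525) + 3 / 400 / s ^ 3 * (16 / 2205)))"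
    by (intro has_bochner_integral_mult_right has_bochner_integral_add has_bochner_integral_diff lens_moments)
  have Ieq: "2 * pi * (pi * s\<^sup>2 * (indicator {0..1} r * (lens r * r ^ 1)) - 2 * s * (indicator {0..1} r * (lens r * r ^ 2))
      + 1 / (12 * s) * (indicator {0..1} r * (lens r * r ^ 4)) + 3 / 400 / s ^ 3 * (indicator {0..1} r * (lens r * r ^ 6)))
     = indicator {0..1} r * (2 * pi * r * (lens r * p r))" for r
    using s by (auto simp: indicator_def p_def field_simps eval_nat_numeral)
  have val: "2 * pi * (pi * s\<^sup>2 * (pi / 32) - 2 * s * (2 / 45) + 1 / (12 * s) * (8 / 525) + 3 / 400 / s ^ 3 * (16 / 2205)) = overlap_bound s"
    using s by (simp add: overlap_bound_def power2_eq_square field_simps)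
  have "(\<integral>\<^sup>+ z. ennreal (lens (norm z)) * ennreal (4 * s\<^sup>2 * lens (norm z / (2 * s))) \<partial>(lborel :: (real^2) measure))
     = (\<integral>\<^sup>+ r. ennreal (2 * pi * r) * indicator {0<..} r * (ennreal (lens r) * ennreal (4 * s\<^sup>2 * lens (r / (2 * s)))) \<partial>lborel)"
    by (rule nn_integral_radial[where G="\<lambda>r. ennreal (lens r) * ennreal (4 * s\<^sup>2 * lens (r / (2 * s)))"]) measurable
  also have "\<dots> \<le> (\<integral>\<^sup>+ r. ennreal (indicator {0..1} r * (2 * pi * r * (lens r * p r))) \<partial>lborel)"
  proof (rule nn_integral_mono)
    fix r :: real
    show "ennreal (2 * pi * r) * indicator {0<..} r * (ennreal (lens r) * ennreal (4 * s\<^sup>2 * lens (r / (2 * s))))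
      \<le> ennreal (indicator {0..1} r * (2 * pi * r * (lens r * p r)))"
    proof (cases "0 < r \<and> r \<le> 1")
      case True
      have "2 * pi * r * (lens r * (4 * s\<^sup>2 * lens (r / (2 * s)))) \<le> 2 * pi * r * (lens r * p r)"
        using True p[of r] by (intro mult_left_mono) (auto simp: lens_nonneg)
      then show ?thesis
        using True lens_nonneg[of r] lens_nonneg[of "r / (2 * s)"]
        by (simp add: ennreal_mult'[symmetric] ennreal_leI del: ennreal_le_iff)
    next
      case False
      then show ?thesis by (auto simp: indicator_def lens_ge_1)
    qed
  qed
  also have "\<dots> = ennreal (overlap_bound s)"
  proof -
    have nn: "0 \<le> indicator {0..1} r * (2 * pi * r * (lens r * p r))" for r
      using p_nonneg by (auto simp: indicator_def lens_nonneg)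
    show ?thesis
      using I[unfolded Ieq val] nn_integral_eq_integral[of lborel "\<lambda>r. indicator {0..1} r * (2 * pi * r * (lens r * p r))"] nn
      by (auto simp: has_bochner_integral_iff)
  qed
  finally show ?thesis .
qed

text \<open>Meant for integrands that may change sign: on the right their negative values count as
  0.\<close>

lemma integral_le_nn_integral:
  fixes f :: "'a \<Rightarrow> real"
  assumes "integrable M f"
  shows "ennreal (integral\<^sup>L M f) \<le> (\<integral>\<^sup>+ x. ennreal (f x) \<partial>M)"
proof -
  have "ennreal (integral\<^sup>L M f) \<le> ennreal (\<integral>x. max 0 (f x) \<partial>M)"
    using assms by (intro ennreal_leI integral_mono) auto
  also have "\<dots> = (\<integral>\<^sup>+ x. ennreal (max 0 (f x)) \<partial>M)"
    using assms by (intro nn_integral_eq_integral[symmetric]) auto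
  also have "\<dots> = (\<integral>\<^sup>+ x. ennreal (f x) \<partial>M)"
    by (intro nn_integral_cong) (simp add: max_def ennreal_neg)
  finally show ?thesis .
qed

text \<open>The mass of the central peak inside a disc, from the terms of \<open>lens_ge\<close> up
  to the cubic one. It bounds the cross term of \<open>correlation_inequality\<close>.\<close>

lemma nn_integral_lens_disc:
  assumes s: "0 \<le> s" "s \<le> 1"
  shows "ennreal (2 * pi * (pi * s\<^sup>2 / 8 - s ^ 3 / 3 + s ^ 5 / 30))
    \<le> (\<integral>\<^sup>+ z. ennreal (lens (norm z)) * indicator (ball 0 s) z \<partial>(lborel :: (real^2) measure))"
proof -
  have "ennreal (2 * pi * (pi * s\<^sup>2 / 8 - s ^ 3 / 3 + s ^ 5 / 30) - 2 * pi * (pi * 0\<^sup>2 / 8 - 0 ^ 3 / 3 + 0 ^ 5 / 30))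
    \<le> (\<integral>\<^sup>+ r. ennreal (indicator {0..s} r * (2 * pi * r * (pi / 4 - r + r ^ 3 / 6))) \<partial>lborel)"
  proof -
    have I: "has_bochner_integral lborel (\<lambda>r. (2 * pi * r * (pi / 4 - r + r ^ 3 / 6)) * indicator {0..s} r)
      (2 * pi * (pi * s\<^sup>2 / 8 - s ^ 3 / 3 + s ^ 5 / 30) - 2 * pi * (pi * 0\<^sup>2 / 8 - 0 ^ 3 / 3 + 0 ^ 5 / 30))"
      by (rule has_bochner_integral_FTC_Icc_real[OF s(1)])
        (auto intro!: derivative_eq_intros continuous_intros simp: field_simps eval_nat_numeral)
    have "ennreal (LINT r|lborel. (2 * pi * r * (pi / 4 - r + r ^ 3 / 6)) * indicator {0..s} r)
       \<le> (\<integral>\<^sup>+ r. ennreal ((2 * pi * r * (pi / 4 - r + r ^ 3 / 6)) * indicator {0..s} r) \<partial>lborel)"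
      using I by (intro integral_le_nn_integral) (simp add: has_bochner_integral_iff)
    then show ?thesis using I by (simp add: has_bochner_integral_iff mult.commute)
  qed
  also have "\<dots> \<le> (\<integral>\<^sup>+ r. ennreal (2 * pi * r) * indicator {0<..} r * (ennreal (lens r) * indicator {..<s} r) \<partial>lborel)"
  proof (rule nn_integral_mono_AE, use AE_lborel_singleton[of s] AE_lborel_singleton[of 0] in eventually_elim)
    fix r :: real assume "r \<noteq> s" "r \<noteq> 0"
    show "ennreal (indicator {0..s} r * (2 * pi * r * (pi / 4 - r + r ^ 3 / 6)))
      \<le> ennreal (2 * pi * r) * indicator {0<..} r * (ennreal (lens r) * indicator {..<s} r)"
    proof (cases "0 < r \<and> r < s")
      case True
      have "0 \<le> r ^ 5" "0 \<le> r ^ 7" using True by auto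
      then have "pi / 4 - r + r ^ 3 / 6 \<le> lens r" using lens_ge[of r] True s by linarith
      then have "2 * pi * r * (pi / 4 - r + r ^ 3 / 6) \<le> 2 * pi * r * lens r"
        using True by (intro mult_left_mono) auto
      then show ?thesis
        using True lens_nonneg[of r] by (simp add: ennreal_mult'[symmetric] ennreal_leI del: ennreal_le_iff)
    next
      case False
      then show ?thesis using \<open>r \<noteq> s\<close> \<open>r \<noteq> 0\<close> by (auto simp: indicator_def)
    qed
  qed
  also have "\<dots> = (\<integral>\<^sup>+ z. ennreal (lens (norm z)) * indicator {..<s} (norm z) \<partial>(lborel :: (real^2) measure))"
    by (rule nn_integral_radial[symmetric, where G="\<lambda>r. ennreal (lens r) * indicator {..<s} r"]) measurable
  also have "\<dots> = (\<integral>\<^sup>+ z. ennreal (lens (norm z)) * indicator (ball 0 s) z \<partial>(lborel :: (real^2) measure))"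
    by (intro nn_integral_cong) (simp add: indicator_def)
  finally show ?thesis by simp
qed

text \<open>For \<open>k \<ge> 2\<close> this is the integral of \<open>1 / r ^ k\<close> over the
  ray from \<open>s\<close>.\<close>

definition tail_pow :: "nat \<Rightarrow> real \<Rightarrow> real" where
  "tail_pow k s = 1 / (real (k - 1) * s ^ (k - 1))"

lemma has_bochner_integral_tail_pow:
  assumes "0 < s" "2 \<le> k"
  shows "has_bochner_integral lborel (\<lambda>r::real. indicator {s..} r * (1 / r ^ k)) (tail_pow k s)"
proof -
  obtain j where "k = 2 + j" using le_Suc_ex[OF assms(2)] by blast
  then have k: "k = Suc (Suc j)" by simp
  show ?thesis
    using has_bochner_integral_tail_power[OF assms(1), of j] by (simp only: k tail_pow_def diff_Suc_1)
qed

lemma has_bochner_integral_pow_interval: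
  assumes "0 < s" "s \<le> s'" "2 \<le> k"
  shows "has_bochner_integral lborel (\<lambda>r::real. indicator {s..<s'} r * (1 / r ^ k)) (tail_pow k s - tail_pow k s')"
proof -
  have "has_bochner_integral lborel (\<lambda>r::real. indicator {s..} r * (1 / r ^ k) - indicator {s'..} r * (1 / r ^ k))
      (tail_pow k s - tail_pow k s')"
    using assms by (intro has_bochner_integral_diff has_bochner_integral_tail_pow) auto
  moreover have "(\<lambda>r::real. indicator {s..} r * (1 / r ^ k) - indicator {s'..} r * (1 / r ^ k))
     = (\<lambda>r. indicator {s..<s'} r * (1 / r ^ k))"
    using assms(2) by (intro ext) (simp add: indicator_def)
  ultimately show ?thesis by (simp only:)
qed

lemma has_bochner_integral_le_nn_integral:
  fixes c :: real
  shows "has_bochner_integral M f c \<Longrightarrow> ennreal c \<le> (\<integral>\<^sup>+ x. ennreal (f x) \<partial>M)"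
  using integral_le_nn_integral[of M f] by (auto simp: has_bochner_integral_iff)

text \<open>This is what the lemma \<open>correlation_inequality\<close> yields for the discs of radius \<open>s \<ge> 2/5\<close>, with \<open>\<epsilon> = 3/20\<close> for
  \<open>s < 11/20\<close> and \<open>\<epsilon> = 0\<close> otherwise; these numbers are near the maximiser at volume fraction \<open>1/2\<close>.\<close>

definition interaction_bound :: "real \<Rightarrow> real" where
  "interaction_bound \<nu> = 45 / 64 *
    (\<nu>\<^sup>2 * pi\<^sup>2 * tail_pow 2 (2/5)
     - 8 * \<nu> * (pi\<^sup>2 / 32 * tail_pow 4 (2/5) - 4 / 45 * tail_pow 5 (2/5)
         + 2 / 1575 * tail_pow 7 (2/5) + 1 / 18375 * tail_pow 9 (2/5))
     + (3 / 10 * (8 * \<nu> * pi / 8 - \<nu>\<^sup>2 * pi) * (tail_pow 4 (2/5) - tail_pow 4 (11/20))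
        - 3 / 10 * 8 * \<nu> / 3 * (tail_pow 3 (2/5) - tail_pow 3 (11/20))
        + 3 / 10 * 8 * \<nu> / 75 * (tail_pow 2 (2/5) - tail_pow 2 (11/20))
        - 9 / 400 * (\<nu> - \<nu>\<^sup>2) * (tail_pow 6 (2/5) - tail_pow 6 (11/20))))"

context ball_lattice
begin

definition G :: "real^2 \<Rightarrow> real" where "G z = C z - lens (norm z) / covol"

lemma G_nonneg: "0 \<le> G z" using C_ge by (simp add: G_def)

lemma G_measurable [measurable]: "G \<in> borel_measurable borel"
  unfolding G_def by measurable

definition weight :: "real \<Rightarrow> real" where "weight s = (if s < 11/20 then 3/20 else 0)"

text \<open>In \<open>correlation_inequality\<close> the mean square \<open>X\<close> is the sum of
  the part from \<open>G\<close> and the part from self-overlap; the latter is removed with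
  \<open>overlap_bound\<close>. Of the cross term \<open>Y\<close> only the self-overlap is kept,
  which is a lower bound because \<open>G\<close> is nonnegative.\<close>

lemma disc_interaction:
  assumes s: "2/5 \<le> s"
  shows "ennreal (vf\<^sup>2 * pi\<^sup>2 * s ^ 4 - 4 * vf / pi * overlap_bound s
      + 2 * weight s * (8 * vf * (pi * s\<^sup>2 / 8 - s ^ 3 / 3 + s ^ 4 / 75) - vf\<^sup>2 * pi * s\<^sup>2) - (weight s)\<^sup>2 * (vf - vf\<^sup>2))
    \<le> (\<integral>\<^sup>+ z. ennreal (G z) * ennreal (4 * s\<^sup>2 * lens (norm z / (2 * s))) \<partial>lborel)"
proof -
  define \<epsilon> where "\<epsilon> = weight s"
  have \<epsilon>: "0 \<le> \<epsilon>" by (simp add: \<epsilon>_def weight_def)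
  have s0: "0 < s" using s by simp
  let ?D = "ball (0::real^2) s"
  let ?h = "\<lambda>z::real^2. 4 * s\<^sup>2 * lens (norm z / (2 * s))"
  define X where "X = (\<integral>\<^sup>+ z. ennreal (C z) * emeasure lborel {y \<in> ?D. y + z \<in> ?D} \<partial>lborel)"
  define Y where "Y = (\<integral>\<^sup>+ z. ennreal (C z) * indicator ?D z \<partial>lborel)"
  have D: "measure lborel ?D = pi * s\<^sup>2" "emeasure lborel ?D < \<infinity>" "?D \<in> sets borel"
    using s0 by (auto simp: measure_def emeasure_ball_vec2)
  have ci: "X < \<infinity>" "vf\<^sup>2 * (pi * s\<^sup>2 - \<epsilon>)\<^sup>2 + 2 * \<epsilon> * enn2real Y \<le> enn2real X + \<epsilon>\<^sup>2 * vf"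
    using correlation_inequality[OF packing_ball D(3) D(2) \<epsilon>]
    unfolding balls_eq_spread[symmetric] C_def[symmetric] X_def[symmetric] Y_def[symmetric] C_0 D(1) by auto
  have X: "X = (\<integral>\<^sup>+ z. ennreal (C z) * ennreal (?h z) \<partial>lborel)"
    unfolding X_def by (intro nn_integral_cong) (simp only: emeasure_ball_overlap[OF s0])
  have h: "0 \<le> ?h z" for z by (simp add: lens_nonneg)
  define J where "J = (\<integral>\<^sup>+ z. ennreal (lens (norm z)) * ennreal (?h z) \<partial>(lborel :: (real^2) measure))"
  have Jle: "J \<le> ennreal (overlap_bound s)"
    unfolding J_def by (rule nn_integral_lens_overlap[OF s0])
  define I where "I = (\<integral>\<^sup>+ z. ennreal (G z) * ennreal (?h z) \<partial>lborel)"
  have split: "X = I + ennreal (1 / covol) * J"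
  proof -
    have "X = (\<integral>\<^sup>+ z. ennreal (G z) * ennreal (?h z) + ennreal (1 / covol) * (ennreal (lens (norm z)) * ennreal (?h z)) \<partial>lborel)"
      unfolding X
    proof (rule nn_integral_cong)
      fix z
      have "C z = G z + 1 / covol * lens (norm z)" by (simp add: G_def)
      then have "ennreal (C z) = ennreal (G z) + ennreal (1 / covol) * ennreal (lens (norm z))"
        using covol_pos G_nonneg lens_nonneg by (simp add: ennreal_plus ennreal_mult'[symmetric])
      then show "ennreal (C z) * ennreal (?h z)
        = ennreal (G z) * ennreal (?h z) + ennreal (1 / covol) * (ennreal (lens (norm z)) * ennreal (?h z))"
        by (simp only: distrib_right mult.assoc)
    qed
    also have "\<dots> = I + ennreal (1 / covol) * J"
      unfolding I_def J_def by (subst nn_integral_add) (auto simp: nn_integral_cmult)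
    finally show ?thesis .
  qed
  have "I < \<infinity>" using ci(1) split by (auto simp: less_top)
  obtain i where i: "I = ennreal i" "0 \<le> i" using \<open>I < \<infinity>\<close> by (cases I) auto
  obtain j where j: "J = ennreal j" "0 \<le> j" using le_less_trans[OF Jle ennreal_less_top] by (cases J) auto
  \<comment> \<open>Since \<open>ennreal\<close> sends negative numbers to 0, the inequality
    \<open>Jle\<close> yields a real inequality only once \<open>overlap_bound s\<close> is known to
    be nonnegative. This holds for radii \<open>s \<ge> 2/5\<close>.\<close>
  have jle: "j \<le> overlap_bound s"
  proof (cases "0 \<le> overlap_bound s")
    case False
    then have "j = 0" "overlap_bound s < 0" using Jle j by (auto simp: ennreal_neg)
    moreover have "0 \<le> overlap_bound s"
    proof -
      have "0 \<le> pi\<^sup>2 * s\<^sup>2 / 32 - 4 * s / 45"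
      proof -
        have "9 \<le> pi\<^sup>2" using pi_gt3 power_mono[of 3 pi 2] by simp
        then have "9 * s * s \<le> pi\<^sup>2 * s * s" using s0 by (intro mult_right_mono) auto
        moreover have "9 * (2/5) * s \<le> 9 * s * s" using s s0 by (intro mult_right_mono) auto
        moreover have "pi\<^sup>2 * s\<^sup>2 / 32 = (pi\<^sup>2 * s * s) / 32" by (simp add: power2_eq_square)
        ultimately show ?thesis using s0 by linarith
      qed
      then show ?thesis using s0 by (simp add: overlap_bound_def)
    qed
    ultimately show ?thesis by simp
  qed (use Jle j in \<open>simp\<close>)
  have XE: "X = ennreal (i + 1 / covol * j)"
  proof -
    have "ennreal (1 / covol) * ennreal j = ennreal (1 / covol * j)"
      using covol_pos j by (intro ennreal_mult[symmetric]) auto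
    moreover have "ennreal i + ennreal (1 / covol * j) = ennreal (i + 1 / covol * j)"
      using covol_pos i j by (intro ennreal_plus[symmetric]) auto
    ultimately show ?thesis using split i(1) j(1) by simp
  qed
  have x: "enn2real X = i + 4 * vf / pi * j"
    using covol_pos i j unfolding XE inverse_covol[symmetric] by (intro enn2real_ennreal) auto
  have Ylow: "8 * vf * (pi * s\<^sup>2 / 8 - s ^ 3 / 3 + s ^ 4 / 75) \<le> enn2real Y" if "s < 11/20"
  proof -
    have "ennreal (1 / covol) * ennreal (2 * pi * (pi * s\<^sup>2 / 8 - s ^ 3 / 3 + s ^ 5 / 30))
      \<le> ennreal (1 / covol) * (\<integral>\<^sup>+ z. ennreal (lens (norm z)) * indicator ?D z \<partial>lborel)"
      using that s0 by (intro mult_left_mono nn_integral_lens_disc) auto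
    also have "\<dots> = (\<integral>\<^sup>+ z. ennreal (1 / covol) * (ennreal (lens (norm z)) * indicator ?D z) \<partial>lborel)"
      using D(3)[measurable] by (intro nn_integral_cmult[symmetric]) measurable
    also have "\<dots> \<le> Y"
      unfolding Y_def
    proof (rule nn_integral_mono)
      fix z
      have "ennreal (1 / covol) * ennreal (lens (norm z)) \<le> ennreal (C z)"
        using C_ge[of z] covol_pos lens_nonneg[of "norm z"]
        by (subst ennreal_mult[symmetric]) (auto intro!: ennreal_leI)
      then show "ennreal (1 / covol) * (ennreal (lens (norm z)) * indicator ?D z) \<le> ennreal (C z) * indicator ?D z"
        by (simp add: mult_right_mono flip: mult.assoc)
    qed
    finally have *: "ennreal (1 / covol) * ennreal (2 * pi * (pi * s\<^sup>2 / 8 - s ^ 3 / 3 + s ^ 5 / 30)) \<le> Y" .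
    have "Y \<le> (\<integral>\<^sup>+ z. ennreal (C 0) * indicator ?D z \<partial>lborel)"
      unfolding Y_def using C_bounds by (intro nn_integral_mono mult_right_mono ennreal_leI) auto
    also have "\<dots> < \<infinity>"
      using D(2,3) by (subst nn_integral_cmult_indicator) (auto simp: ennreal_mult_less_top)
    finally have "Y < \<infinity>" .
    then obtain y where y: "Y = ennreal y" "0 \<le> y" by (cases Y) auto
    have "ennreal (1 / covol * (2 * pi * (pi * s\<^sup>2 / 8 - s ^ 3 / 3 + s ^ 5 / 30))) \<le> ennreal y"
      using * covol_pos unfolding y(1) by (subst ennreal_mult') auto
    then have "1 / covol * (2 * pi * (pi * s\<^sup>2 / 8 - s ^ 3 / 3 + s ^ 5 / 30)) \<le> y"
      using y(2) by (auto simp: ennreal_le_iff)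
    then have "8 * vf * (pi * s\<^sup>2 / 8 - s ^ 3 / 3 + s ^ 5 / 30) \<le> y"
      unfolding inverse_covol by simp
    \<comment> \<open>Trading one factor \<open>s\<close> for \<open>2/5\<close> keeps the later
      integrand a sum of powers \<open>1 / s ^ k\<close> with \<open>k \<ge> 2\<close>. The term
      \<open>s ^ 5 / s ^ 6\<close> would bring in a logarithm.\<close>
    moreover have "2/5 * s ^ 4 \<le> s * s ^ 4" using s by (intro mult_right_mono) auto
    then have "s ^ 4 / 75 \<le> s ^ 5 / 30" by (simp add: eval_nat_numeral)
    then have "8 * vf * (pi * s\<^sup>2 / 8 - s ^ 3 / 3 + s ^ 4 / 75) \<le> 8 * vf * (pi * s\<^sup>2 / 8 - s ^ 3 / 3 + s ^ 5 / 30)"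
      using vf_pos by (intro mult_left_mono) auto
    ultimately show ?thesis using y by simp
  qed
  have "\<epsilon> * (8 * vf * (pi * s\<^sup>2 / 8 - s ^ 3 / 3 + s ^ 4 / 75)) \<le> \<epsilon> * enn2real Y"
    using Ylow by (cases "s < 11/20") (auto simp: \<epsilon>_def weight_def)
  moreover have "4 * vf / pi * j \<le> 4 * vf / pi * overlap_bound s"
    using jle vf_pos by (intro mult_left_mono) auto
  moreover have "vf\<^sup>2 * (pi * s\<^sup>2 - \<epsilon>)\<^sup>2 = vf\<^sup>2 * pi\<^sup>2 * s ^ 4 - 2 * (\<epsilon> * (vf\<^sup>2 * pi * s\<^sup>2)) + \<epsilon>\<^sup>2 * vf\<^sup>2"
    by (simp add: power2_eq_square eval_nat_numeral algebra_simps)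
  ultimately have "vf\<^sup>2 * pi\<^sup>2 * s ^ 4 - 4 * vf / pi * overlap_bound s
      + 2 * \<epsilon> * (8 * vf * (pi * s\<^sup>2 / 8 - s ^ 3 / 3 + s ^ 4 / 75) - vf\<^sup>2 * pi * s\<^sup>2) - \<epsilon>\<^sup>2 * (vf - vf\<^sup>2) \<le> i"
    using ci(2) unfolding x by (simp add: right_diff_distrib)
  then show ?thesis
    unfolding I_def[symmetric] i(1) \<epsilon>_def[symmetric] by (rule ennreal_leI)
qed

text \<open>\<open>disc_interaction\<close> is integrated against the weights of
  \<open>disc_kernel_superposition\<close>. Leaving out the radii below \<open>2/5\<close> only
  lowers the kernel, and \<open>G\<close> is nonnegative. At volume fraction \<open>1/2\<close> the
  bound \<open>V\<close> is already slightly negative at \<open>s = 2/5\<close>.\<close>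

lemma interaction_lower_bound:
  "ennreal (interaction_bound vf) \<le> (\<integral>\<^sup>+ z. ennreal (G z / norm z ^ 3) \<partial>lborel)"
proof -
  define k where "k s z = indicator {2/5..} s * ennreal (45 / 64 / s ^ 6 * (4 * s\<^sup>2 * lens (norm z / (2 * s))))"
    for s :: real and z :: "real^2"
  define V where "V s = vf\<^sup>2 * pi\<^sup>2 * s ^ 4 - 4 * vf / pi * overlap_bound s
      + 2 * weight s * (8 * vf * (pi * s\<^sup>2 / 8 - s ^ 3 / 3 + s ^ 4 / 75) - vf\<^sup>2 * pi * s\<^sup>2) - (weight s)\<^sup>2 * (vf - vf\<^sup>2)" for s
  have [measurable]: "(\<lambda>(s, z). ennreal (G z) * k s z) \<in> borel_measurable (lborel \<Otimes>\<^sub>M lborel)"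
    unfolding k_def by measurable
  have fI: "has_bochner_integral lborel (\<lambda>s. 45 / 64 *
    (vf\<^sup>2 * pi\<^sup>2 * (indicator {2/5..} s * (1 / s ^ 2))
     - 8 * vf * (pi\<^sup>2 / 32 * (indicator {2/5..} s * (1 / s ^ 4)) - 4 / 45 * (indicator {2/5..} s * (1 / s ^ 5))
         + 2 / 1575 * (indicator {2/5..} s * (1 / s ^ 7)) + 1 / 18375 * (indicator {2/5..} s * (1 / s ^ 9)))
     + (3 / 10 * (8 * vf * pi / 8 - vf\<^sup>2 * pi) * (indicator {2/5..<11/20} s * (1 / s ^ 4))
        - 3 / 10 * 8 * vf / 3 * (indicator {2/5..<11/20} s * (1 / s ^ 3))
        + 3 / 10 * 8 * vf / 75 * (indicator {2/5..<11/20} s * (1 / s ^ 2))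
        - 9 / 400 * (vf - vf\<^sup>2) * (indicator {2/5..<11/20} s * (1 / s ^ 6))))) (interaction_bound vf)"
    unfolding interaction_bound_def
    by (intro has_bochner_integral_mult_right has_bochner_integral_add has_bochner_integral_diff
        has_bochner_integral_tail_pow has_bochner_integral_pow_interval) auto
  have feq: "45 / 64 *
    (vf\<^sup>2 * pi\<^sup>2 * (indicator {2/5..} s * (1 / s ^ 2))
     - 8 * vf * (pi\<^sup>2 / 32 * (indicator {2/5..} s * (1 / s ^ 4)) - 4 / 45 * (indicator {2/5..} s * (1 / s ^ 5))
         + 2 / 1575 * (indicator {2/5..} s * (1 / s ^ 7)) + 1 / 18375 * (indicator {2/5..} s * (1 / s ^ 9)))
     + (3 / 10 * (8 * vf * pi / 8 - vf\<^sup>2 * pi) * (indicator {2/5..<11/20} s * (1 / s ^ 4))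
        - 3 / 10 * 8 * vf / 3 * (indicator {2/5..<11/20} s * (1 / s ^ 3))
        + 3 / 10 * 8 * vf / 75 * (indicator {2/5..<11/20} s * (1 / s ^ 2))
        - 9 / 400 * (vf - vf\<^sup>2) * (indicator {2/5..<11/20} s * (1 / s ^ 6))))
    = indicator {2/5..} s * (45 / 64 / s ^ 6 * V s)" for s :: real
  proof (cases "2/5 \<le> s")
    case True
    then have s: "0 < s" by simp
    \<comment> \<open>In terms of \<open>x\<close> both sides of \<open>feq\<close> become
      polynomials, once mixed products such as \<open>s ^ 4 * x ^ 6\<close> are reduced.\<close>
    define x where "x = 1 / s"
    have sx: "s * x = 1" using s by (simp add: x_def)
    have inv: "1 / s ^ n = x ^ n" for n by (simp add: x_def power_one_over)
    have mono: "s ^ 4 * x ^ 6 = x ^ 2" "s ^ 2 * x ^ 6 = x ^ 4" "s * x ^ 6 = x ^ 5" "s ^ 3 * x ^ 6 = x ^ 3"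
    proof -
      have "s ^ n * x ^ (n + m) = x ^ m" for n m
        using sx by (simp add: power_add flip: mult.assoc power_mult_distrib)
      from this[of 4 2] this[of 2 4] this[of 1 5] this[of 3 3]
      show "s ^ 4 * x ^ 6 = x ^ 2" "s ^ 2 * x ^ 6 = x ^ 4" "s * x ^ 6 = x ^ 5" "s ^ 3 * x ^ 6 = x ^ 3" by simp_all
    qed
    have high: "x * x ^ 6 = x ^ 7" "x ^ 3 * x ^ 6 = x ^ 9" by (simp_all add: power_add[symmetric] flip: power_Suc)
    have ob: "4 * vf / pi * overlap_bound s = 8 * vf * (pi\<^sup>2 / 32 * s ^ 2 - 4 / 45 * s + 2 / 1575 * x + 1 / 18375 * x ^ 3)"
      by (simp add: overlap_bound_def x_def power_one_over)
    have "x ^ 6 * V s = vf\<^sup>2 * pi\<^sup>2 * (s ^ 4 * x ^ 6)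
        - 8 * vf * (pi\<^sup>2 / 32 * (s ^ 2 * x ^ 6) - 4 / 45 * (s * x ^ 6) + 2 / 1575 * (x * x ^ 6) + 1 / 18375 * (x ^ 3 * x ^ 6))
        + 2 * weight s * (8 * vf * (pi / 8 * (s ^ 2 * x ^ 6) - (s ^ 3 * x ^ 6) / 3 + (s ^ 4 * x ^ 6) / 75) - vf\<^sup>2 * pi * (s ^ 2 * x ^ 6))
        - (weight s)\<^sup>2 * (vf - vf\<^sup>2) * x ^ 6"
      unfolding V_def ob by (simp add: algebra_simps)
    then have V: "x ^ 6 * V s = vf\<^sup>2 * pi\<^sup>2 * x ^ 2
        - 8 * vf * (pi\<^sup>2 / 32 * x ^ 4 - 4 / 45 * x ^ 5 + 2 / 1575 * x ^ 7 + 1 / 18375 * x ^ 9)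
        + 2 * weight s * (8 * vf * (pi / 8 * x ^ 4 - x ^ 3 / 3 + x ^ 2 / 75) - vf\<^sup>2 * pi * x ^ 4)
        - (weight s)\<^sup>2 * (vf - vf\<^sup>2) * x ^ 6"
      unfolding mono high .
    have R: "45 / 64 / s ^ 6 * V s = 45 / 64 * (x ^ 6 * V s)"
      by (simp add: inv[symmetric])
    show ?thesis
      unfolding R V inv using True
      by (cases "s < 11/20") (simp_all add: weight_def algebra_simps power2_eq_square)
  qed (simp add: indicator_def)
  have "ennreal (interaction_bound vf) \<le> (\<integral>\<^sup>+ s. ennreal (indicator {2/5..} s * (45 / 64 / s ^ 6 * V s)) \<partial>lborel)"
    using fI[unfolded feq] integral_le_nn_integral[of lborel "\<lambda>s. indicator {2/5..} s * (45 / 64 / s ^ 6 * V s)"]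
    by (simp add: has_bochner_integral_iff)
  also have "\<dots> \<le> (\<integral>\<^sup>+ s. \<integral>\<^sup>+ z. ennreal (G z) * k s z \<partial>lborel \<partial>lborel)"
  proof (rule nn_integral_mono)
    fix s :: real
    show "ennreal (indicator {2/5..} s * (45 / 64 / s ^ 6 * V s)) \<le> (\<integral>\<^sup>+ z. ennreal (G z) * k s z \<partial>lborel)"
    proof (cases "2/5 \<le> s")
      case True
      have "ennreal (45 / 64 / s ^ 6) * ennreal (V s)
        \<le> ennreal (45 / 64 / s ^ 6) * (\<integral>\<^sup>+ z. ennreal (G z) * ennreal (4 * s\<^sup>2 * lens (norm z / (2 * s))) \<partial>lborel)"
        using disc_interaction[OF True] by (intro mult_left_mono) (auto simp: V_def)
      also have "\<dots> = (\<integral>\<^sup>+ z. ennreal (45 / 64 / s ^ 6) * (ennreal (G z) * ennreal (4 * s\<^sup>2 * lens (norm z / (2 * s)))) \<partial>lborel)"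
        by (rule nn_integral_cmult[symmetric]) measurable
      also have "\<dots> = (\<integral>\<^sup>+ z. ennreal (G z) * k s z \<partial>lborel)"
      proof (rule nn_integral_cong)
        fix z :: "real^2"
        have "k s z = ennreal (45 / 64 / s ^ 6) * ennreal (4 * s\<^sup>2 * lens (norm z / (2 * s)))"
          unfolding k_def using True by (subst ennreal_mult'[symmetric]) auto
        then show "ennreal (45 / 64 / s ^ 6) * (ennreal (G z) * ennreal (4 * s\<^sup>2 * lens (norm z / (2 * s)))) = ennreal (G z) * k s z"
          by (simp only: mult_ac)
      qed
      also have "ennreal (45 / 64 / s ^ 6) * ennreal (V s) = ennreal (indicator {2/5..} s * (45 / 64 / s ^ 6 * V s))"
        using True by (subst ennreal_mult'[symmetric]) auto
      finally show ?thesis .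
    qed simp
  qed
  also have "\<dots> = (\<integral>\<^sup>+ z. \<integral>\<^sup>+ s. ennreal (G z) * k s z \<partial>lborel \<partial>lborel)"
    by (rule lborel_pair.Fubini') measurable
  also have "\<dots> \<le> (\<integral>\<^sup>+ z. ennreal (G z / norm z ^ 3) \<partial>lborel)"
  proof (rule nn_integral_mono_AE, use AE_lborel_singleton[of "0::real^2"] in eventually_elim)
    fix z :: "real^2" assume "z \<noteq> 0"
    have "(\<integral>\<^sup>+ s. ennreal (G z) * k s z \<partial>lborel) = ennreal (G z) * (\<integral>\<^sup>+ s. k s z \<partial>lborel)"
      unfolding k_def by (rule nn_integral_cmult) measurable
    also have "\<dots> \<le> ennreal (G z) * ennreal (1 / norm z ^ 3)"
      unfolding k_def using \<open>z \<noteq> 0\<close> by (intro mult_left_mono disc_kernel_superposition) auto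
    also have "\<dots> = ennreal (G z / norm z ^ 3)"
      using G_nonneg by (subst ennreal_mult[symmetric]) auto
    finally show "(\<integral>\<^sup>+ s. ennreal (G z) * k s z \<partial>lborel) \<le> ennreal (G z / norm z ^ 3)" .
  qed
  finally show ?thesis .
qed

text \<open>All renormalizing terms are given to the self-overlap, which stays nonnegative by
  \<open>lens_ge_linear\<close>, while the rest is the plane integral of
  \<open>G z / norm z ^ 3\<close> in polar coordinates. The three fractions integrate
  \<open>r / 6 + r ^ 3 / 40 + r ^ 5 / 112\<close> from 0 to 1, the polynomial of
  \<open>lens_ge\<close> after renormalization and division by \<open>r\<^sup>2\<close>.\<close>

lemma renormalized_energy_ge:
  assumes "0 \<le> interaction_bound vf"
  shows "ennreal (8 * vf * (1 / 12 + 1 / 160 + 1 / 672) + interaction_bound vf) \<le> renormalized_energy"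
proof -
  define self where "self r = 8 * vf * (lens r - pi / 4 + (if r < 1 then r else pi / 4)) / r\<^sup>2" for r
  have self_nonneg: "0 \<le> self r" if "0 < r" for r
    using lens_ge_linear[of r] lens_nonneg[of r] that vf_pos by (auto simp: self_def)
  have int: "(\<integral>\<^sup>+ \<theta>. ennreal (G (polar r \<theta>) / r\<^sup>2) * indicator {0..2 * pi} \<theta> \<partial>lborel)
      = ennreal ((profile r + 2 * pi * vf - 8 * vf * lens r) / r\<^sup>2)" if r: "0 < r" for r
  proof -
    have "has_bochner_integral lborel (\<lambda>\<theta>. (indicator {0..2 * pi} \<theta> * (C (polar r \<theta>) - C 0)
        + indicator {0..2 * pi} \<theta> * (C 0 - lens r / covol)) * (1 / r\<^sup>2))
      ((profile r + 2 * pi * (C 0 - lens r / covol)) * (1 / r\<^sup>2))"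
      unfolding profile_def C_def[symmetric]
      by (intro has_bochner_integral_mult_left has_bochner_integral_add has_bochner_integral_integrable
          integrable_C[folded C_def]) (auto simp: has_bochner_integral_iff)
    moreover have "(indicator {0..2 * pi} \<theta> * (C (polar r \<theta>) - C 0)
        + indicator {0..2 * pi} \<theta> * (C 0 - lens r / covol)) * (1 / r\<^sup>2) = indicator {0..2 * pi} \<theta> * (G (polar r \<theta>) / r\<^sup>2)" for \<theta>
      using r by (simp add: G_def algebra_simps diff_divide_distrib)
    moreover have "(profile r + 2 * pi * (C 0 - lens r / covol)) * (1 / r\<^sup>2) = (profile r + 2 * pi * vf - 8 * vf * lens r) / r\<^sup>2"
    proof -
      have "2 * pi * (lens r / covol) = 8 * vf * lens r"
        using inverse_covol by (simp add: vf_def)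
      then have "profile r + 2 * pi * (C 0 - lens r / covol) = profile r + 2 * pi * vf - 8 * vf * lens r"
        by (simp add: C_0 right_diff_distrib)
      then show ?thesis by (simp only: mult_1_right times_divide_eq_right)
    qed
    ultimately have I: "has_bochner_integral lborel (\<lambda>\<theta>. indicator {0..2 * pi} \<theta> * (G (polar r \<theta>) / r\<^sup>2))
      ((profile r + 2 * pi * vf - 8 * vf * lens r) / r\<^sup>2)" by (simp only:)
    have "(\<integral>\<^sup>+ \<theta>. ennreal (indicator {0..2 * pi} \<theta> * (G (polar r \<theta>) / r\<^sup>2)) \<partial>lborel)
      = ennreal ((profile r + 2 * pi * vf - 8 * vf * lens r) / r\<^sup>2)"
      using I nn_integral_eq_integral[of lborel "\<lambda>\<theta>. indicator {0..2 * pi} \<theta> * (G (polar r \<theta>) / r\<^sup>2)"] G_nonneg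
      by (auto simp: has_bochner_integral_iff)
    moreover have "(\<integral>\<^sup>+ \<theta>. ennreal (indicator {0..2 * pi} \<theta> * (G (polar r \<theta>) / r\<^sup>2)) \<partial>lborel)
      = (\<integral>\<^sup>+ \<theta>. ennreal (G (polar r \<theta>) / r\<^sup>2) * indicator {0..2 * pi} \<theta> \<partial>lborel)"
      by (intro nn_integral_cong) (simp add: indicator_def)
    ultimately show ?thesis by simp
  qed
  have nonneg_int: "0 \<le> profile r + 2 * pi * vf - 8 * vf * lens r" for r
  proof -
    have "(LINT \<theta>|lborel. indicator {0..2 * pi} \<theta> * (lens \<bar>r\<bar> / covol - C 0)) \<le> profile r"
      unfolding profile_def C_def[symmetric]
      by (intro integral_mono integrable_C[folded C_def] integrable_mult_left)
        (use C_ge[of "polar r _"] in \<open>auto split: split_indicator\<close>)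
    moreover have "lens r \<le> lens \<bar>r\<bar>" by (cases "0 \<le> r") (auto simp: lens_nonneg lens_def[of r] lens_nonneg)
    then have "8 * vf * lens r \<le> 8 * vf * lens \<bar>r\<bar>" using vf_pos by (intro mult_left_mono) auto
    moreover have "2 * pi * (lens \<bar>r\<bar> / covol) = 8 * vf * lens \<bar>r\<bar>" by (simp add: vf_def)
    ultimately show ?thesis by (simp add: C_0 right_diff_distrib)
  qed
  have polar: "(\<integral>\<^sup>+ z. ennreal (G z / norm z ^ 3) \<partial>lborel)
     = (\<integral>\<^sup>+ r. indicator {0<..} r * ennreal ((profile r + 2 * pi * vf - 8 * vf * lens r) / r\<^sup>2) \<partial>lborel)"
  proof -
    have "(\<integral>\<^sup>+ z. ennreal (G z / norm z ^ 3) \<partial>lborel) = (\<integral>\<^sup>+ r. ennreal r * indicator {0<..} r *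
      (\<integral>\<^sup>+ \<theta>. ennreal (G (polar r \<theta>) / norm (polar r \<theta>) ^ 3) * indicator {0..2 * pi} \<theta> \<partial>lborel) \<partial>lborel)"
      by (rule nn_integral_polar) measurable
    also have "\<dots> = (\<integral>\<^sup>+ r. indicator {0<..} r * ennreal ((profile r + 2 * pi * vf - 8 * vf * lens r) / r\<^sup>2) \<partial>lborel)"
    proof (rule nn_integral_cong)
      fix r :: real
      show "ennreal r * indicator {0<..} r * (\<integral>\<^sup>+ \<theta>. ennreal (G (polar r \<theta>) / norm (polar r \<theta>) ^ 3) * indicator {0..2 * pi} \<theta> \<partial>lborel)
        = indicator {0<..} r * ennreal ((profile r + 2 * pi * vf - 8 * vf * lens r) / r\<^sup>2)"
      proof (cases "0 < r")
        case True
        have "ennreal r * (\<integral>\<^sup>+ \<theta>. ennreal (G (polar r \<theta>) / norm (polar r \<theta>) ^ 3) * indicator {0..2 * pi} \<theta> \<partial>lborel)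
          = (\<integral>\<^sup>+ \<theta>. ennreal r * (ennreal (G (polar r \<theta>) / norm (polar r \<theta>) ^ 3) * indicator {0..2 * pi} \<theta>) \<partial>lborel)"
          by (rule nn_integral_cmult[symmetric]) measurable
        also have "\<dots> = (\<integral>\<^sup>+ \<theta>. ennreal (G (polar r \<theta>) / r\<^sup>2) * indicator {0..2 * pi} \<theta> \<partial>lborel)"
        proof (rule nn_integral_cong)
          fix \<theta>
          have "ennreal r * ennreal (G (polar r \<theta>) / r ^ 3) = ennreal (G (polar r \<theta>) / r\<^sup>2)"
            using True G_nonneg by (subst ennreal_mult[symmetric]) (auto simp: field_simps eval_nat_numeral)
          then show "ennreal r * (ennreal (G (polar r \<theta>) / norm (polar r \<theta>) ^ 3) * indicator {0..2 * pi} \<theta>)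
            = ennreal (G (polar r \<theta>) / r\<^sup>2) * indicator {0..2 * pi} \<theta>"
            using True by (simp flip: mult.assoc)
        qed
        finally show ?thesis using True int[OF True] by simp
      qed simp
    qed
    finally show ?thesis .
  qed
  have "renormalized_energy = (\<integral>\<^sup>+ r. indicator {0<..} r * ennreal (self r)
      + indicator {0<..} r * ennreal ((profile r + 2 * pi * vf - 8 * vf * lens r) / r\<^sup>2) \<partial>lborel)"
    unfolding renormalized_energy_def
  proof (rule nn_integral_cong)
    fix r :: real
    have "(profile r + (if r < 1 then 8 * vf * r else 2 * pi * vf)) / r\<^sup>2
      = self r + (profile r + 2 * pi * vf - 8 * vf * lens r) / r\<^sup>2"
      by (auto simp: self_def add_divide_distrib[symmetric] algebra_simps)
    then have eq: "ennreal ((profile r + (if r < 1 then 8 * vf * r else 2 * pi * vf)) / r\<^sup>2)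
      = ennreal (self r) + ennreal ((profile r + 2 * pi * vf - 8 * vf * lens r) / r\<^sup>2)" if "0 < r"
      using self_nonneg[OF that] nonneg_int[of r] by (simp add: ennreal_plus)
    show "indicator {0<..} r * ennreal ((profile r + (if r < 1 then 8 * vf * r else 2 * pi * vf)) / r\<^sup>2)
      = indicator {0<..} r * ennreal (self r) + indicator {0<..} r * ennreal ((profile r + 2 * pi * vf - 8 * vf * lens r) / r\<^sup>2)"
    proof (cases "0 < r")
      case True
      then have "indicator {0<..} r = (1 :: ennreal)" by simp
      with eq[OF True] show ?thesis by (simp only: mult_1)
    qed simp
  qed
  also have "\<dots> = (\<integral>\<^sup>+ r. indicator {0<..} r * ennreal (self r) \<partial>lborel) + (\<integral>\<^sup>+ z. ennreal (G z / norm z ^ 3) \<partial>lborel)"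
    unfolding polar self_def by (rule nn_integral_add) measurable
  finally have J: "renormalized_energy = (\<integral>\<^sup>+ r. indicator {0<..} r * ennreal (self r) \<partial>lborel) + (\<integral>\<^sup>+ z. ennreal (G z / norm z ^ 3) \<partial>lborel)" .
  have "ennreal (8 * vf * (1 / 12 + 1 / 160 + 1 / 672)) \<le> (\<integral>\<^sup>+ r. indicator {0<..} r * ennreal (self r) \<partial>lborel)"
  proof -
    have "has_bochner_integral lborel (\<lambda>r. (8 * vf * (r / 6 + r ^ 3 / 40 + r ^ 5 / 112)) * indicator {0..1} r)
      (8 * vf * (1\<^sup>2 / 12 + 1 ^ 4 / 160 + 1 ^ 6 / 672) - 8 * vf * (0\<^sup>2 / 12 + 0 ^ 4 / 160 + 0 ^ 6 / 672))"
      by (rule has_bochner_integral_FTC_Icc_real)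
        (auto intro!: derivative_eq_intros continuous_intros simp: field_simps eval_nat_numeral)
    from has_bochner_integral_le_nn_integral[OF this]
    have "ennreal (8 * vf * (1 / 12 + 1 / 160 + 1 / 672)) \<le> (\<integral>\<^sup>+ r. ennreal ((8 * vf * (r / 6 + r ^ 3 / 40 + r ^ 5 / 112)) * indicator {0..1} r) \<partial>lborel)"
      by simp
    also have "\<dots> \<le> (\<integral>\<^sup>+ r. indicator {0<..} r * ennreal (self r) \<partial>lborel)"
    proof (rule nn_integral_mono_AE, use AE_lborel_singleton[of 0] AE_lborel_singleton[of 1] in eventually_elim)
      fix r :: real assume "r \<noteq> 0" "r \<noteq> 1"
      show "ennreal ((8 * vf * (r / 6 + r ^ 3 / 40 + r ^ 5 / 112)) * indicator {0..1} r) \<le> indicator {0<..} r * ennreal (self r)"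
      proof (cases "0 < r \<and> r < 1")
        case True
        have "8 * vf * (r ^ 3 / 6 + r ^ 5 / 40 + r ^ 7 / 112) \<le> 8 * vf * (lens r - pi / 4 + r)"
          using lens_ge[of r] True vf_pos by (intro mult_left_mono) auto
        then have "8 * vf * (r ^ 3 / 6 + r ^ 5 / 40 + r ^ 7 / 112) / r\<^sup>2 \<le> self r"
          unfolding self_def using True by (simp add: divide_right_mono)
        moreover have "8 * vf * (r ^ 3 / 6 + r ^ 5 / 40 + r ^ 7 / 112) / r\<^sup>2 = 8 * vf * (r / 6 + r ^ 3 / 40 + r ^ 5 / 112)"
          using True by (simp add: field_simps eval_nat_numeral)
        ultimately show ?thesis using True by (simp add: ennreal_leI)
      qed (use \<open>r \<noteq> 0\<close> \<open>r \<noteq> 1\<close> in auto)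
    qed
    finally show ?thesis .
  qed
  moreover have "ennreal (8 * vf * (1 / 12 + 1 / 160 + 1 / 672) + interaction_bound vf)
    = ennreal (8 * vf * (1 / 12 + 1 / 160 + 1 / 672)) + ennreal (interaction_bound vf)"
    using vf_pos assms by (intro ennreal_plus) auto
  ultimately show ?thesis
    unfolding J using interaction_lower_bound by (simp only: add_mono)
qed

end

section \<open>Stripes\<close>

text \<open>The four quarter turns are images of the first under shifts and reflections that
  preserve \<open>\<bar>cos \<theta>\<bar>\<close>. The function \<open>\<phi>\<close> is arbitrary
  because stripes feel a direction only through this number.\<close>

lemma nn_integral_abs_cos:
  fixes \<phi> :: "real \<Rightarrow> ennreal"
  assumes [measurable]: "\<phi> \<in> borel_measurable borel"
  shows "(\<integral>\<^sup>+ \<theta>. indicator {0..2 * pi} \<theta> * \<phi> \<bar>cos \<theta>\<bar> \<partial>lborel)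
    = 4 * (\<integral>\<^sup>+ \<theta>. indicator {0..pi / 2} \<theta> * \<phi> (cos \<theta>) \<partial>lborel)"
proof -
  let ?Q = "\<integral>\<^sup>+ \<theta>. indicator {0..pi / 2} \<theta> * \<phi> (cos \<theta>) \<partial>lborel"
  have piece: "(\<integral>\<^sup>+ \<theta>. indicator S \<theta> * \<phi> \<bar>cos \<theta>\<bar> \<partial>lborel) = ?Q"
    if S [measurable]: "S \<in> sets borel" and c: "c = 1 \<or> c = -1" and cos: "\<And>\<theta>. \<bar>cos (t + c * \<theta>)\<bar> = \<bar>cos \<theta>\<bar>"
      and mem: "\<And>\<theta>. t + c * \<theta> \<in> S \<longleftrightarrow> \<theta> \<in> {0..pi / 2}" for S and t c :: real
  proof -
    have "(\<integral>\<^sup>+ \<theta>. indicator S \<theta> * \<phi> \<bar>cos \<theta>\<bar> \<partial>lborel)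
      = \<bar>c\<bar> * (\<integral>\<^sup>+ \<theta>. indicator S (t + c * \<theta>) * \<phi> \<bar>cos (t + c * \<theta>)\<bar> \<partial>lborel)"
      using c by (intro nn_integral_real_affine) auto
    also have "\<dots> = (\<integral>\<^sup>+ \<theta>. indicator {0..pi / 2} \<theta> * \<phi> (cos \<theta>) \<partial>lborel)"
      using c by (auto intro!: nn_integral_cong simp: cos mem indicator_def cos_ge_zero)
    finally show ?thesis .
  qed
  have "(\<integral>\<^sup>+ \<theta>. indicator {0..2 * pi} \<theta> * \<phi> \<bar>cos \<theta>\<bar> \<partial>lborel)
    = (\<integral>\<^sup>+ \<theta>. indicator {0..pi / 2} \<theta> * \<phi> \<bar>cos \<theta>\<bar> + indicator {pi / 2..pi} \<theta> * \<phi> \<bar>cos \<theta>\<bar>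
      + indicator {pi..3 * pi / 2} \<theta> * \<phi> \<bar>cos \<theta>\<bar> + indicator {3 * pi / 2..2 * pi} \<theta> * \<phi> \<bar>cos \<theta>\<bar> \<partial>lborel)"
    by (intro nn_integral_cong_AE, use AE_lborel_singleton[of "pi / 2"] AE_lborel_singleton[of pi]
        AE_lborel_singleton[of "3 * pi / 2"] in eventually_elim) (auto simp: indicator_def)
  also have "\<dots> = ?Q + ?Q + ?Q + ?Q"
  proof -
    have "(\<integral>\<^sup>+ \<theta>. indicator {0..pi / 2} \<theta> * \<phi> \<bar>cos \<theta>\<bar> \<partial>lborel) = ?Q"
      by (rule piece[of _ 1 0]) auto
    moreover have "(\<integral>\<^sup>+ \<theta>. indicator {pi / 2..pi} \<theta> * \<phi> \<bar>cos \<theta>\<bar> \<partial>lborel) = ?Q"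
      by (rule piece[of _ "-1" pi]) auto
    moreover have "(\<integral>\<^sup>+ \<theta>. indicator {pi..3 * pi / 2} \<theta> * \<phi> \<bar>cos \<theta>\<bar> \<partial>lborel) = ?Q"
      by (rule piece[of _ 1 pi]) (auto simp: cos_add)
    moreover have "(\<integral>\<^sup>+ \<theta>. indicator {3 * pi / 2..2 * pi} \<theta> * \<phi> \<bar>cos \<theta>\<bar> \<partial>lborel) = ?Q"
      by (rule piece[of _ "-1" "2 * pi"]) (auto simp: cos_diff)
    ultimately show ?thesis by (simp add: nn_integral_add)
  qed
  also have "\<dots> = 4 * ?Q"
  proof -
    have "4 = (1 + 1 + 1 + 1 :: ennreal)" by simp
    then show ?thesis by (simp only: distrib_right mult_1)
  qed
  finally show ?thesis .
qed

lemma has_bochner_integral_abs_cos: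
  "has_bochner_integral lborel (\<lambda>\<theta>. indicator {0..2 * pi} \<theta> * \<bar>cos \<theta>\<bar>) 4"
proof (rule has_bochner_integral_nn_integral)
  have I: "has_bochner_integral lborel (\<lambda>\<theta>. indicator {0..pi / 2} \<theta> * cos \<theta>) (sin (pi / 2) - sin 0)"
    by (rule has_bochner_integral_FTC_interior) (auto intro!: continuous_intros derivative_eq_intros cos_ge_zero)
  have nn: "0 \<le> indicator {0..pi / 2} \<theta> * cos \<theta>" for \<theta> :: real
    by (auto simp: indicator_def cos_ge_zero)
  have "(\<integral>\<^sup>+ \<theta>. ennreal (indicator {0..2 * pi} \<theta> * \<bar>cos \<theta>\<bar>) \<partial>lborel)
    = (\<integral>\<^sup>+ \<theta>. indicator {0..2 * pi} \<theta> * ennreal \<bar>cos \<theta>\<bar> \<partial>lborel)"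
    by (intro nn_integral_cong) (simp add: indicator_def)
  also have "\<dots> = 4 * (\<integral>\<^sup>+ \<theta>. indicator {0..pi / 2} \<theta> * ennreal (cos \<theta>) \<partial>lborel)"
    by (rule nn_integral_abs_cos) measurable
  also have "(\<integral>\<^sup>+ \<theta>. indicator {0..pi / 2} \<theta> * ennreal (cos \<theta>) \<partial>lborel) = (\<integral>\<^sup>+ \<theta>. ennreal (indicator {0..pi / 2} \<theta> * cos \<theta>) \<partial>lborel)"
    by (intro nn_integral_cong) (simp add: indicator_def)
  also have "\<dots> = 1"
    using has_bochner_integral_imp_nn_integral[OF I nn] by simp
  finally show "(\<integral>\<^sup>+ \<theta>. ennreal (indicator {0..2 * pi} \<theta> * \<bar>cos \<theta>\<bar>) \<partial>lborel) = ennreal 4" by simp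
qed auto

text \<open>The antiderivative of \<open>cos x * ln (cos x)\<close>, usually written
  \<open>sin x * ln (cos x) + ln ((1 + sin x) / cos x) - sin x\<close>, is regrouped so that the
  singular logarithm carries the factor \<open>sin x - 1\<close>, which makes it continuous at
  \<open>pi / 2\<close>. The terms with \<open>m\<close> and \<open>l\<close> are included to have a
  nonnegative integrand.\<close>

lemma has_bochner_integral_cos_ln_cos:
  fixes m l :: real
  assumes nonneg: "\<And>\<theta>. 0 \<le> \<theta> \<Longrightarrow> \<theta> \<le> pi / 2 \<Longrightarrow> 0 \<le> cos \<theta> * ln (cos \<theta>) + m * cos \<theta> + l"
  shows "has_bochner_integral lborel (\<lambda>\<theta>. indicator {0..pi / 2} \<theta> * (cos \<theta> * ln (cos \<theta>) + m * cos \<theta> + l))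
    (ln 2 - 1 + m + l * pi / 2)"
proof -
  define k where "k \<theta> = (sin \<theta> - 1) * ln (cos \<theta>)" for \<theta> :: real
  define F where "F \<theta> = k \<theta> + ln (1 + sin \<theta>) - sin \<theta> + m * sin \<theta> + l * \<theta>" for \<theta>
  have cpos: "0 < cos \<theta>" "0 \<le> sin \<theta>" if "0 \<le> \<theta>" "\<theta> < pi / 2" for \<theta>
    using that by (auto intro!: cos_gt_zero_pi sin_ge_zero)
  \<comment> \<open>The factor \<open>1 - sin \<theta>\<close> is at most the square of the cosine,
    while \<open>- ln (cos \<theta>)\<close> is at most its reciprocal.\<close>
  have kbound: "\<bar>k \<theta>\<bar> \<le> cos \<theta>" if "0 \<le> \<theta>" "\<theta> \<le> pi / 2" for \<theta>
  proof (cases "\<theta> = pi / 2")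
    case False
    then have c: "0 < cos \<theta>" "0 \<le> sin \<theta>" using cpos that by auto
    have "(1 - sin \<theta>) * (1 + sin \<theta>) = (cos \<theta>)\<^sup>2"
      using sin_cos_squared_add[of \<theta>] by (simp add: power2_eq_square algebra_simps)
    moreover have "(1 - sin \<theta>) * 1 \<le> (1 - sin \<theta>) * (1 + sin \<theta>)"
      using c by (intro mult_left_mono) auto
    ultimately have s: "1 - sin \<theta> \<le> (cos \<theta>)\<^sup>2" by simp
    have "ln (1 / cos \<theta>) \<le> 1 / cos \<theta> - 1" using c by (intro ln_le_minus_one) auto
    then have ln: "- ln (cos \<theta>) \<le> 1 / cos \<theta>" "ln (cos \<theta>) \<le> 0" using c by (auto simp: ln_div)
    have "\<bar>k \<theta>\<bar> = (1 - sin \<theta>) * (- ln (cos \<theta>))"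
      using ln(2) by (simp add: k_def abs_mult)
    also have "\<dots> \<le> (cos \<theta>)\<^sup>2 * (1 / cos \<theta>)"
      using s ln by (intro mult_mono) auto
    also have "\<dots> = cos \<theta>" using c by (simp add: power2_eq_square)
    finally show ?thesis .
  next
    case True
    show ?thesis unfolding k_def True by simp
  qed
  have kcont: "continuous_on {0..pi / 2} k"
  proof (unfold continuous_on_eq_continuous_within, intro ballI)
    fix \<theta> assume \<theta>: "\<theta> \<in> {0..pi / 2}"
    show "continuous (at \<theta> within {0..pi / 2}) k"
    proof (cases "\<theta> = pi / 2")
      case True
      have "((\<lambda>x. k x) \<longlongrightarrow> 0) (at \<theta> within {0..pi / 2})"
      proof (rule Lim_null_comparison)
        show "eventually (\<lambda>x. norm (k x) \<le> cos x) (at \<theta> within {0..pi / 2})"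
          using kbound by (auto simp: eventually_at_filter)
        have "((\<lambda>x. cos x) \<longlongrightarrow> cos \<theta>) (at \<theta> within {0..pi / 2})" by (intro tendsto_intros)
        then show "((\<lambda>x. cos x) \<longlongrightarrow> 0) (at \<theta> within {0..pi / 2})" by (simp only: True cos_pi_half)
      qed
      moreover have "k \<theta> = 0" unfolding k_def True by simp
      ultimately show ?thesis by (simp only: continuous_within)
    next
      case False
      then have "0 < cos \<theta>" using \<theta> cpos by auto
      then show ?thesis unfolding k_def by (intro continuous_intros) auto
    qed
  qed
  have "has_bochner_integral lborel (\<lambda>\<theta>. indicator {0..pi / 2} \<theta> * (cos \<theta> * ln (cos \<theta>) + m * cos \<theta> + l)) (F (pi / 2) - F 0)"
  proof (rule has_bochner_integral_FTC_interior)
    show "continuous_on {0..pi / 2} F"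
      unfolding F_def
    proof (intro continuous_intros kcont ballI)
      fix \<theta> assume "\<theta> \<in> {0..pi / 2}"
      then have "0 \<le> sin \<theta>" by (intro sin_ge_zero) auto
      then show "1 + sin \<theta> \<noteq> 0" by simp
    qed
    fix \<theta> assume \<theta>: "0 < \<theta>" "\<theta> < pi / 2"
    then have c: "0 < cos \<theta>" "0 \<le> sin \<theta>" using cpos by auto
    have "(F has_real_derivative (cos \<theta> * ln (cos \<theta>) + (- sin \<theta> / cos \<theta>) * (sin \<theta> - 1)) + cos \<theta> / (1 + sin \<theta>) - cos \<theta> + m * cos \<theta> + l) (at \<theta>)"
    proof -
      have d0: "((\<lambda>x. sin x - 1) has_real_derivative cos \<theta>) (at \<theta>)"
        by (auto intro!: derivative_eq_intros)
      have d1: "((\<lambda>x. ln (cos x)) has_real_derivative - sin \<theta> / cos \<theta>) (at \<theta>)"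
        using c by (auto intro!: derivative_eq_intros)
      have d2: "((\<lambda>x. ln (1 + sin x)) has_real_derivative cos \<theta> / (1 + sin \<theta>)) (at \<theta>)"
        using c by (auto intro!: derivative_eq_intros)
      have d3: "((\<lambda>x. l * x) has_real_derivative l) (at \<theta>)"
        by (auto intro!: derivative_eq_intros)
      show ?thesis
        unfolding F_def k_def
        by (rule DERIV_add[OF DERIV_add[OF DERIV_diff[OF DERIV_add[OF DERIV_mult[OF d0 d1] d2] DERIV_sin] DERIV_cmult[OF DERIV_sin]] d3])
    qed
    moreover have "(- sin \<theta> / cos \<theta>) * (sin \<theta> - 1) + cos \<theta> / (1 + sin \<theta>) - cos \<theta> = 0"
    proof -
      have "cos \<theta> * cos \<theta> = (1 - sin \<theta>) * (1 + sin \<theta>)"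
        using sin_cos_squared_add[of \<theta>] by (simp add: power2_eq_square algebra_simps)
      then have "cos \<theta> / (1 + sin \<theta>) = (1 - sin \<theta>) / cos \<theta>" "cos \<theta> = (1 - sin \<theta>) * (1 + sin \<theta>) / cos \<theta>"
        using c by (auto simp: field_simps)
      then have "(- sin \<theta> / cos \<theta>) * (sin \<theta> - 1) + cos \<theta> / (1 + sin \<theta>) - cos \<theta>
        = (sin \<theta> * (1 - sin \<theta>) + (1 - sin \<theta>) - (1 - sin \<theta>) * (1 + sin \<theta>)) / cos \<theta>"
        by (simp add: add_divide_distrib diff_divide_distrib algebra_simps)
      then show ?thesis by (simp add: algebra_simps)
    qed
    ultimately show "(F has_real_derivative cos \<theta> * ln (cos \<theta>) + m * cos \<theta> + l) (at \<theta>)"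
      by (simp add: algebra_simps)
  qed (use nonneg in auto)
  then show ?thesis by (simp add: F_def k_def algebra_simps)
qed

text \<open>The contribution of the \<open>n\<close>-th neighbouring stripe. For integer
  \<open>n\<close> it is minus the logarithm of a factor in Euler's product for the sine.\<close>

lemma nn_integral_tent:
  fixes n l :: real
  assumes "0 < l" "l < n"
  shows "(\<integral>\<^sup>+ t. indicator {0<..} t * ennreal (max 0 (l - \<bar>t - n\<bar>) / t\<^sup>2) \<partial>lborel) = ennreal (- ln (1 - l\<^sup>2 / n\<^sup>2))"
proof -
  have I1: "has_bochner_integral lborel (\<lambda>t. indicator {n - l..n} t * ((t - (n - l)) / t\<^sup>2))
    ((ln n + (n - l) / n) - (ln (n - l) + (n - l) / (n - l)))"
    using assms by (intro has_bochner_integral_FTC_interior)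
      (auto intro!: continuous_intros derivative_eq_intros simp: field_simps power2_eq_square)
  have I2: "has_bochner_integral lborel (\<lambda>t. indicator {n..n + l} t * ((n + l - t) / t\<^sup>2))
    ((- (n + l) / (n + l) - ln (n + l)) - (- (n + l) / n - ln n))"
    using assms by (intro has_bochner_integral_FTC_interior)
      (auto intro!: continuous_intros derivative_eq_intros simp: field_simps power2_eq_square)
  have nn1: "0 \<le> indicator {n - l..n} t * ((t - (n - l)) / t\<^sup>2)" for t by (auto simp: indicator_def)
  have nn2: "0 \<le> indicator {n..n + l} t * ((n + l - t) / t\<^sup>2)" for t by (auto simp: indicator_def)
  have "(\<integral>\<^sup>+ t. indicator {0<..} t * ennreal (max 0 (l - \<bar>t - n\<bar>) / t\<^sup>2) \<partial>lborel)
    = (\<integral>\<^sup>+ t. ennreal (indicator {n - l..n} t * ((t - (n - l)) / t\<^sup>2) + indicator {n..n + l} t * ((n + l - t) / t\<^sup>2)) \<partial>lborel)"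
    by (intro nn_integral_cong_AE, use AE_lborel_singleton[of n] in eventually_elim)
      (use assms in \<open>auto simp: indicator_def max_def abs_if algebra_simps\<close>)
  also have "\<dots> = ennreal (((ln n + (n - l) / n) - (ln (n - l) + (n - l) / (n - l)))
     + ((- (n + l) / (n + l) - ln (n + l)) - (- (n + l) / n - ln n)))"
    using nn1 nn2 by (intro has_bochner_integral_imp_nn_integral has_bochner_integral_add I1 I2) auto
  also have "((ln n + (n - l) / n) - (ln (n - l) + (n - l) / (n - l)))
     + ((- (n + l) / (n + l) - ln (n + l)) - (- (n + l) / n - ln n)) = - ln (1 - l\<^sup>2 / n\<^sup>2)"
  proof -
    have "1 - l\<^sup>2 / n\<^sup>2 = (n - l) * (n + l) / (n * n)"
      using assms by (simp add: field_simps power2_eq_square)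
    then have "ln (1 - l\<^sup>2 / n\<^sup>2) = ln (n - l) + ln (n + l) - (ln n + ln n)"
      using assms by (simp add: ln_mult ln_div)
    moreover have "(n - l) / (n - l) = 1" "(n + l) / (n + l) = 1" using assms by auto
    then have "(n - l) / (n - l) = 1" "- (n + l) / (n + l) = - 1" by (simp_all only: minus_divide_left[symmetric])
    moreover have "(n - l) / n - (- (n + l) / n) = 2" using assms by (simp add: field_simps)
    ultimately show ?thesis by simp
  qed
  finally show ?thesis .
qed

text \<open>The overlap of a stripe with itself together with the renormalizing terms. They cancel
  outside the interval between \<open>l\<close> and \<open>c\<close>, and the result is the same
  whichever of the two is larger.\<close>

lemma nn_integral_first_tent:
  fixes c l :: real
  assumes "0 < l" "0 < c"
  shows "(\<integral>\<^sup>+ t. indicator {0<..} t * ennreal ((max 0 (l - t) - l + (if t < c then t else l)) / t\<^sup>2) \<partial>lborel)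
    = ennreal (ln (c / l) - 1 + l / c)"
proof (cases "l \<le> c")
  case True
  have I: "has_bochner_integral lborel (\<lambda>t. indicator {l..c} t * ((t - l) / t\<^sup>2)) ((ln c + l / c) - (ln l + l / l))"
    using assms True by (intro has_bochner_integral_FTC_interior)
      (auto intro!: continuous_intros derivative_eq_intros simp: field_simps power2_eq_square)
  have "(\<integral>\<^sup>+ t. indicator {0<..} t * ennreal ((max 0 (l - t) - l + (if t < c then t else l)) / t\<^sup>2) \<partial>lborel)
    = (\<integral>\<^sup>+ t. ennreal (indicator {l..c} t * ((t - l) / t\<^sup>2)) \<partial>lborel)"
    by (intro nn_integral_cong_AE, use AE_lborel_singleton[of c] in eventually_elim)
      (use assms True in \<open>auto simp: indicator_def max_def\<close>)
  also have "\<dots> = ennreal ((ln c + l / c) - (ln l + l / l))"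
    by (intro has_bochner_integral_imp_nn_integral I) (auto simp: indicator_def)
  finally show ?thesis using assms by (simp add: ln_div algebra_simps)
next
  case False
  have I: "has_bochner_integral lborel (\<lambda>t. indicator {c..l} t * ((l - t) / t\<^sup>2)) ((- l / l - ln l) - (- l / c - ln c))"
    using assms False by (intro has_bochner_integral_FTC_interior)
      (auto intro!: continuous_intros derivative_eq_intros simp: field_simps power2_eq_square)
  have "(\<integral>\<^sup>+ t. indicator {0<..} t * ennreal ((max 0 (l - t) - l + (if t < c then t else l)) / t\<^sup>2) \<partial>lborel)
    = (\<integral>\<^sup>+ t. ennreal (indicator {c..l} t * ((l - t) / t\<^sup>2)) \<partial>lborel)"
    by (intro nn_integral_cong) (use assms False in \<open>auto simp: indicator_def max_def\<close>)
  also have "\<dots> = ennreal ((- l / l - ln l) - (- l / c - ln c))"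
    by (intro has_bochner_integral_imp_nn_integral I) (auto simp: indicator_def)
  finally show ?thesis using assms by (simp add: ln_div algebra_simps)
qed

lemma suminf_ln_sin_product:
  fixes l :: real
  assumes "0 < l" "l < 1"
  shows "(\<Sum>n. ennreal (- ln (1 - l\<^sup>2 / (real (Suc n))\<^sup>2))) = ennreal (- ln (sin (pi * l) / (pi * l)))"
proof -
  have lt: "l\<^sup>2 / (real (Suc n))\<^sup>2 < 1" "0 \<le> l\<^sup>2 / (real (Suc n))\<^sup>2" for n
  proof -
    have "l < real (Suc n)" using assms by simp
    then have "l\<^sup>2 < (real (Suc n))\<^sup>2" using assms by (intro power_strict_mono) auto
    then show "l\<^sup>2 / (real (Suc n))\<^sup>2 < 1" by (simp add: divide_less_eq del: of_nat_Suc)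
  qed simp
  have gt: "0 < 1 - l\<^sup>2 / (real (Suc n))\<^sup>2" for n
    using lt(1)[of n] by (simp del: of_nat_Suc)
  have pos: "0 < sin (pi * l) / (pi * l)"
    using assms sin_gt_zero[of "pi * l"] by simp
  have "(\<lambda>n. \<Prod>k=1..n. 1 - l\<^sup>2 / (real k)\<^sup>2) \<longlonglongrightarrow> sin (pi * l) / (pi * l)"
    using sin_product_formula_real'[of l] assms by simp
  then have "(\<lambda>n. - ln (\<Prod>k=1..n. 1 - l\<^sup>2 / (real k)\<^sup>2)) \<longlonglongrightarrow> - ln (sin (pi * l) / (pi * l))"
    using pos by (intro tendsto_intros) auto
  moreover have "- ln (\<Prod>k=1..n. 1 - l\<^sup>2 / (real k)\<^sup>2) = (\<Sum>k<n. - ln (1 - l\<^sup>2 / (real (Suc k))\<^sup>2))" for n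
  proof -
    have "(\<Prod>k=1..n. 1 - l\<^sup>2 / (real k)\<^sup>2) = (\<Prod>k<n. 1 - l\<^sup>2 / (real (Suc k))\<^sup>2)"
      by (rule prod.reindex_bij_witness[of _ Suc "\<lambda>k. k - 1"]) auto
    moreover have "ln (\<Prod>k<n. 1 - l\<^sup>2 / (real (Suc k))\<^sup>2) = (\<Sum>k<n. ln (1 - l\<^sup>2 / (real (Suc k))\<^sup>2))"
      by (intro ln_prod) (simp_all only: gt less_imp_neq[OF gt, THEN not_sym] finite_lessThan not_False_eq_True)
    ultimately show ?thesis by (simp add: sum_negf)
  qed
  ultimately have sums: "(\<lambda>k. - ln (1 - l\<^sup>2 / (real (Suc k))\<^sup>2)) sums (- ln (sin (pi * l) / (pi * l)))"
    by (simp add: sums_def)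
  have nn: "0 \<le> - ln (1 - l\<^sup>2 / (real (Suc k))\<^sup>2)" for k
    using lt[of k] by (simp del: of_nat_Suc)
  show ?thesis
    using suminf_ennreal2[OF nn sums_summable[OF sums]] sums_unique[OF sums] by simp
qed

section \<open>Stripes as a set periodic under the integer lattice\<close>

definition int_lattice :: "(real^2) set" where
  "int_lattice = {of_int m *\<^sub>R axis 1 1 + of_int n *\<^sub>R axis 2 1 | m n :: int. True}"

lemma lattice_basis_int_lattice: "lattice_basis int_lattice (axis 1 1) (axis 2 1)"
proof -
  have "independent {axis 1 1, axis 2 1 :: real^2}"
    using independent_Basis Basis_vec2 by metis
  then show ?thesis
    using axis_neq_vec2 by (simp add: lattice_basis_def int_lattice_def)
qed

lemma int_lattice_iff: "q \<in> int_lattice \<longleftrightarrow> q $ 1 \<in> \<int> \<and> q $ 2 \<in> \<int>"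
proof
  assume "q \<in> int_lattice"
  then show "q $ 1 \<in> \<int> \<and> q $ 2 \<in> \<int>" by (auto simp: int_lattice_def axis_def)
next
  assume "q $ 1 \<in> \<int> \<and> q $ 2 \<in> \<int>"
  then obtain m n :: int where "q $ 1 = of_int m" "q $ 2 = of_int n" by (auto elim!: Ints_cases)
  then have "q = of_int m *\<^sub>R axis 1 1 + of_int n *\<^sub>R axis 2 1"
    by (simp add: vec_eq_iff forall_2 axis_def)
  then show "q \<in> int_lattice" by (auto simp: int_lattice_def)
qed

text \<open>Stripes of period 1 and volume fraction \<open>l\<close>. They are invariant under every
  shift along the second axis; taking 1 as the period in that direction makes the lattice results
  applicable, with \<open>B\<close> a piece of one stripe.\<close>

locale stripe_pattern =
  fixes l :: real
  assumes l: "0 < l" "l < 1"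
begin

sublocale planar_lattice int_lattice "axis 1 1" "axis 2 1"
  by unfold_locales (rule lattice_basis_int_lattice)

definition B :: "(real^2) set" where "B = {x. 0 < x $ 1 \<and> x $ 1 < l \<and> 0 \<le> x $ 2 \<and> x $ 2 < 1}"
definition C :: "real^2 \<Rightarrow> real" where "C = autocorrelation (indicat_real (stripes l (1 - l)))"

lemma spread_B: "spread B = stripes l (1 - l)"
proof (intro set_eqI iffI)
  fix x assume "x \<in> spread B"
  then obtain q where q: "q $ 1 \<in> \<int>" "x - q \<in> B" by (auto simp: spread_def int_lattice_iff)
  then obtain j :: int where "q $ 1 = of_int j" by (auto elim!: Ints_cases)
  with q have "of_int j < x $ 1 \<and> x $ 1 < of_int j + l" by (auto simp: B_def)
  then show "x \<in> stripes l (1 - l)" by (auto simp: stripes_def)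
next
  fix x assume "x \<in> stripes l (1 - l)"
  then obtain j :: int where j: "of_int j < x $ 1" "x $ 1 < of_int j + l" by (auto simp: stripes_def)
  define q :: "real^2" where "q = vector [of_int j, of_int \<lfloor>x $ 2\<rfloor>]"
  have "x - q \<in> B" using j by (simp add: B_def q_def) linarith
  moreover have "q \<in> int_lattice" by (simp add: int_lattice_iff q_def)
  ultimately show "x \<in> spread B" by (auto simp: spread_def)
qed

lemma B_borel [measurable]: "B \<in> sets borel"
  unfolding B_def by measurable

lemma packing_B: "packing B"
proof -
  have "q = 0" if xq: "x \<in> B" "q \<in> int_lattice" "x + q \<in> B" for x q
  proof -
    obtain m n :: int where q: "q $ 1 = of_int m" "q $ 2 = of_int n"
      using xq(2) by (auto simp: int_lattice_iff elim!: Ints_cases)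
    have "\<bar>of_int m :: real\<bar> < 1" "\<bar>of_int n :: real\<bar> < 1" using xq(1,3) l by (auto simp: B_def q)
    then have "m = 0" "n = 0" by linarith+
    then show ?thesis using q by (simp add: vec_eq_iff forall_2)
  qed
  then show ?thesis by (auto simp: packing_def)
qed

lemma emeasure_strip:
  assumes [measurable]: "S \<in> sets borel"
  shows "emeasure lborel {x::real^2. x $ 1 \<in> S \<and> 0 \<le> x $ 2 \<and> x $ 2 < 1} = emeasure lborel S"
proof -
  have "emeasure lborel {x::real^2. x $ 1 \<in> S \<and> 0 \<le> x $ 2 \<and> x $ 2 < 1}
    = (\<integral>\<^sup>+ x. indicator {x::real^2. x $ 1 \<in> S \<and> 0 \<le> x $ 2 \<and> x $ 2 < 1} x \<partial>lborel)"
    by (rule nn_integral_indicator[symmetric]) measurable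
  also have "\<dots> = (\<integral>\<^sup>+ x. \<integral>\<^sup>+ y. indicator {x::real^2. x $ 1 \<in> S \<and> 0 \<le> x $ 2 \<and> x $ 2 < 1} (vector [x, y]) \<partial>lborel \<partial>lborel)"
    by (rule nn_integral_vec2) measurable
  also have "\<dots> = (\<integral>\<^sup>+ x. \<integral>\<^sup>+ y. indicator S x * indicator {0..<1::real} y \<partial>lborel \<partial>lborel)"
    by (intro nn_integral_cong) (simp add: indicator_def)
  also have "\<dots> = emeasure lborel S"
    by (simp add: nn_integral_cmult)
  finally show ?thesis .
qed

lemma covol_1: "covol = 1"
proof -
  have "cell = {x::real^2. x $ 1 \<in> {0..<1} \<and> 0 \<le> x $ 2 \<and> x $ 2 < 1}"
  proof -
    have "coord1 x = x $ 1" "coord2 x = x $ 2" for x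
      unfolding coord1_def coord2_def det2_def by (simp_all add: axis_def)
    then show ?thesis by (auto simp: cell_iff)
  qed
  then have "emeasure lborel cell = 1"
    by (simp only: emeasure_strip[OF atLeastLessThan_borel]) simp
  then show ?thesis by (simp add: measure_def)
qed

text \<open>The autocorrelation, per unit length, of the union of the intervals from
  \<open>j\<close> to \<open>j + l\<close> on the line.\<close>

definition g :: "real \<Rightarrow> real" where
  "g t = measure lborel {x. 0 < x \<and> x < l \<and> (\<exists>j::int. of_int j < x + t \<and> x + t < of_int j + l)}"

lemma slice_borel [measurable]: "{x. 0 < x \<and> x < l \<and> (\<exists>j::int. of_int j < x + t \<and> x + t < of_int j + l)} \<in> sets borel"
  by measurable

lemma C_eq: "C z = g (z $ 1)"
proof -
  have "{x \<in> B. x + z \<in> spread B}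
    = {x::real^2. x $ 1 \<in> {x. 0 < x \<and> x < l \<and> (\<exists>j::int. of_int j < x + z $ 1 \<and> x + z $ 1 < of_int j + l)} \<and> 0 \<le> x $ 2 \<and> x $ 2 < 1}"
    unfolding spread_B by (auto simp: B_def stripes_def)
  then have "measure lborel {x \<in> B. x + z \<in> spread B} = g (z $ 1)"
    by (simp only: measure_def g_def emeasure_strip[OF slice_borel])
  then show ?thesis
    unfolding C_def spread_B[symmetric] autocorrelation_spread[OF packing_B] covol_1 by simp
qed

lemma C_measurable [measurable]: "C \<in> borel_measurable borel"
  unfolding C_def spread_B[symmetric] by (rule autocorrelation_spread_measurable[OF packing_B])

lemma C_bounds: "0 \<le> C z" "C z \<le> C 0"
  unfolding C_def spread_B[symmetric] by (rule autocorrelation_spread_bounds[OF packing_B])+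

lemma slice_interval:
  fixes a b :: real
  shows "measure lborel {x. 0 < x \<and> x < l \<and> a < x \<and> x < a + l} = max 0 (l - \<bar>a\<bar>)"
proof -
  have "{x. 0 < x \<and> x < l \<and> a < x \<and> x < a + l} = {max 0 a<..<min l (a + l)}" by auto
  then show ?thesis by (cases "0 \<le> a") (auto simp: max_def min_def)
qed

lemma g_0: "g 0 = l"
proof -
  have "{x. 0 < x \<and> x < l \<and> (\<exists>j::int. of_int j < x + 0 \<and> x + 0 < of_int j + l)} = {0<..<l}"
    by (auto intro!: exI[of _ 0])
  then show ?thesis using l by (simp add: g_def)
qed

lemma slice_fmeasurable:
  "{x. 0 < x \<and> x < l \<and> (\<exists>j::int. of_int j < x + t \<and> x + t < of_int j + l)} \<in> fmeasurable lborel"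
proof (rule fmeasurableI2)
  show "{0<..<l} \<in> fmeasurable lborel" using l by (simp add: fmeasurable_def)
  show "{x. 0 < x \<and> x < l \<and> (\<exists>j::int. of_int j < x + t \<and> x + t < of_int j + l)} \<in> sets lborel"
    using slice_borel[of t] by simp
  show "{x. 0 < x \<and> x < l \<and> (\<exists>j::int. of_int j < x + t \<and> x + t < of_int j + l)} \<subseteq> {0<..<l}" by auto
qed

lemma g_ge: "l - \<bar>t\<bar> \<le> g t"
proof -
  have "measure lborel {x. 0 < x \<and> x < l \<and> - t < x \<and> x < - t + l} \<le> g t"
    unfolding g_def by (intro measure_mono_fmeasurable slice_fmeasurable) (auto intro!: exI[of _ 0])
  then show ?thesis unfolding slice_interval by simp
qed

definition tents :: "real \<Rightarrow> ennreal" where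
  "tents t = (\<Sum>n. ennreal (max 0 (l - \<bar>t - real (Suc n)\<bar>)))"

text \<open>A shifted interval can meet only its own place and the translates on the side to which
  it moves, which is what the sign \<open>e\<close> records. Each translate contributes one tent,
  and countable subadditivity adds them up to an upper bound.\<close>

lemma g_le: "ennreal (g t) \<le> ennreal (max 0 (l - \<bar>t\<bar>)) + tents \<bar>t\<bar>"
proof -
  define e :: real where "e = (if 0 \<le> t then 1 else - 1)"
  define T where "T n = {x. 0 < x \<and> x < l \<and> e * real n - t < x \<and> x < (e * real n - t) + l}" for n
  have T [measurable]: "T n \<in> sets borel" for n unfolding T_def by measurable
  have "emeasure lborel (T n) = ennreal (max 0 (l - \<bar>\<bar>t\<bar> - real n\<bar>))" for n
  proof -
    have "T n \<in> fmeasurable lborel"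
    proof (rule fmeasurableI2)
      show "{0<..<l} \<in> fmeasurable lborel" using l by (simp add: fmeasurable_def)
      show "T n \<subseteq> {0<..<l}" by (auto simp: T_def)
    qed simp
    then have "emeasure lborel (T n) = ennreal (measure lborel (T n))"
      by (simp add: emeasure_eq_measure2)
    also have "measure lborel (T n) = max 0 (l - \<bar>e * real n - t\<bar>)"
      unfolding T_def by (rule slice_interval)
    also have "\<bar>e * real n - t\<bar> = \<bar>\<bar>t\<bar> - real n\<bar>" by (auto simp: e_def)
    finally show ?thesis .
  qed
  note T_measure = this
  have "{x. 0 < x \<and> x < l \<and> (\<exists>j::int. of_int j < x + t \<and> x + t < of_int j + l)} \<subseteq> (\<Union>n. T n)"
  proof
    fix x assume "x \<in> {x. 0 < x \<and> x < l \<and> (\<exists>j::int. of_int j < x + t \<and> x + t < of_int j + l)}"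
    then obtain j :: int where j: "0 < x" "x < l" "of_int j < x + t" "x + t < of_int j + l" by auto
    have "e * real (nat \<bar>j\<bar>) = of_int j"
    proof (cases "0 \<le> t")
      case True
      with j l have "- 1 < (of_int j :: real)" by linarith
      then have "0 \<le> j" by linarith
      then show ?thesis using True by (simp add: e_def)
    next
      case False
      with j l have "(of_int j :: real) < 1" by linarith
      then have "j \<le> 0" by linarith
      then show ?thesis using False by (simp add: e_def)
    qed
    then have "x \<in> T (nat \<bar>j\<bar>)" using j by (simp add: T_def)
    then show "x \<in> (\<Union>n. T n)" by blast
  qed
  then have "emeasure lborel {x. 0 < x \<and> x < l \<and> (\<exists>j::int. of_int j < x + t \<and> x + t < of_int j + l)}
      \<le> emeasure lborel (\<Union>n. T n)"
    by (rule emeasure_mono) measurable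
  then have "ennreal (g t) \<le> emeasure lborel (\<Union>n. T n)"
    by (simp only: g_def emeasure_eq_measure2[OF slice_fmeasurable])
  also have "\<dots> \<le> (\<Sum>n. emeasure lborel (T n))"
    by (rule emeasure_subadditive_countably) (simp add: image_subset_iff)
  also have "\<dots> = (\<Sum>n. emeasure lborel (T (Suc n))) + emeasure lborel (T 0)"
    using suminf_offset[of "\<lambda>n. emeasure lborel (T n)" 1] by (simp add: add.commute)
  finally show ?thesis
    unfolding T_measure tents_def by (simp add: add.commute)
qed

lemma g_near_0:
  assumes "\<bar>t\<bar> \<le> l" "\<bar>t\<bar> \<le> 1 - l"
  shows "g t = l - \<bar>t\<bar>"
proof -
  have "tents \<bar>t\<bar> = 0"
  proof -
    have "l - \<bar>\<bar>t\<bar> - real (Suc n)\<bar> \<le> 0" for n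
    proof -
      have "1 \<le> real (Suc n)" by simp
      then show ?thesis using assms by linarith
    qed
    then have "max 0 (l - \<bar>\<bar>t\<bar> - real (Suc n)\<bar>) = 0" for n by (rule max_absorb1)
    then show ?thesis unfolding tents_def by simp
  qed
  then have "ennreal (g t) \<le> ennreal (max 0 (l - \<bar>t\<bar>))"
    using g_le[of t] by (simp only: add_0_right)
  then have "g t \<le> max 0 (l - \<bar>t\<bar>)"
    by (subst (asm) ennreal_le_iff) auto
  then show ?thesis using g_ge[of t] assms by linarith
qed

lemma one_sided_deriv0_C: "one_sided_deriv0 C z = - \<bar>z $ 1\<bar>"
  unfolding one_sided_deriv0_def
proof (rule tendsto_Lim)
  define m where "m = min l (1 - l) / (\<bar>z $ 1\<bar> + 1)"
  have m: "0 < m" using l by (simp add: m_def add_nonneg_pos)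
  have "eventually (\<lambda>t. (C (t *\<^sub>R z) - C 0) / t = - \<bar>z $ 1\<bar>) (at_right 0)"
  proof (rule eventually_at_rightI[OF _ m])
    fix t assume t: "t \<in> {0<..<m}"
    then have "t * (\<bar>z $ 1\<bar> + 1) < min l (1 - l)"
      by (simp add: m_def less_divide_eq add_nonneg_pos)
    then have "\<bar>t * z $ 1\<bar> \<le> l" "\<bar>t * z $ 1\<bar> \<le> 1 - l"
      using t by (auto simp: abs_mult algebra_simps)
    then show "(C (t *\<^sub>R z) - C 0) / t = - \<bar>z $ 1\<bar>"
      using t by (simp add: C_eq g_near_0 g_0 abs_mult)
  qed
  then show "((\<lambda>t. (C (t *\<^sub>R z) - C 0) / t) \<longlongrightarrow> - \<bar>z $ 1\<bar>) (at_right 0)"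
    by (rule tendsto_eventually)
qed simp

lemma C_0: "C 0 = l" by (simp add: C_eq g_0)

text \<open>The slope of the autocorrelation in direction \<open>z\<close> is
  \<open>- \<bar>z $ 1\<bar>\<close>, and 4 is the integral of
  \<open>\<bar>cos \<theta>\<bar>\<close> over a full turn. As for balls, this is twice the
  perimeter per unit area, which is 2 for every \<open>l\<close>.\<close>

sublocale radial_profile "indicat_real (stripes l (1 - l))" 4 "2 * pi * l"
proof (unfold_locales, fold C_def)
  show "indicat_real (stripes l (1 - l)) \<in> borel_measurable borel"
    unfolding spread_B[symmetric] using spread_borel[OF B_borel] by measurable
  show "has_bochner_integral lborel (\<lambda>\<theta>. indicator {0..2 * pi} \<theta> * one_sided_deriv0 C (polar r \<theta>)) (- (4 * r))"
    if "0 < r" for r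
  proof -
    have "has_bochner_integral lborel (\<lambda>\<theta>. (- r) * (indicator {0..2 * pi} \<theta> * \<bar>cos \<theta>\<bar>)) ((- r) * 4)"
      by (intro has_bochner_integral_mult_right has_bochner_integral_abs_cos)
    then show ?thesis using that by (simp add: one_sided_deriv0_C abs_mult mult_ac)
  qed
  show "C 0 + one_sided_deriv0 C z \<le> C z" for z
    using g_ge[of "z $ 1"] by (simp add: C_0 C_eq[of z] one_sided_deriv0_C)
  show "2 * pi * l = 2 * pi * C 0" by (simp add: C_0)
qed (simp_all add: C_bounds)

section \<open>Upper bound for the energy of stripes\<close>

lemma g_measurable [measurable]: "g \<in> borel_measurable borel"
proof -
  have "(\<lambda>t. C (vector [t, 0])) \<in> borel_measurable borel" by measurable
  then show ?thesis by (simp add: C_eq)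
qed

text \<open>Here \<open>c\<close> stands for \<open>\<bar>cos \<theta>\<bar>\<close>. The
  substitution \<open>t = r * c\<close> reduces a direction to the one-dimensional correlation and
  moves the cutoff from 1 to \<open>c\<close>. Summing the tents gives the logarithm of the sine;
  its denominator \<open>pi * l\<close> combines with the first tent, so that \<open>ln l\<close>
  cancels.\<close>

lemma radial_integral_le:
  assumes c: "0 < c" "c \<le> 1"
  shows "(\<integral>\<^sup>+ r. indicator {0<..} r * ennreal ((g (r * c) - l + (if r < 1 then r * c else l)) / r\<^sup>2) \<partial>lborel)
    \<le> ennreal (c * ln c + (- 1 - ln (sin (pi * l) / pi)) * c + l)"
proof -
  have s: "0 < sin (pi * l)" using l by (intro sin_gt_zero) auto
  have [measurable]: "tents \<in> borel_measurable borel" unfolding tents_def by measurable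
  have nn: "0 \<le> max 0 (l - t) - l + (if t < c then t else l)" if "0 < t" for t
    using that l by (auto simp: max_def)
  define F where "F r = indicator {0<..} r * ennreal ((g (r * c) - l + (if r < 1 then r * c else l)) / r\<^sup>2)" for r
  have [measurable]: "F \<in> borel_measurable borel" unfolding F_def by measurable
  have "(\<integral>\<^sup>+ r. indicator {0<..} r * ennreal ((g (r * c) - l + (if r < 1 then r * c else l)) / r\<^sup>2) \<partial>lborel) = (\<integral>\<^sup>+ r. F r \<partial>lborel)"
    by (simp add: F_def)
  also have "\<dots> = ennreal (1 / c) * (\<integral>\<^sup>+ t. F (t / c) \<partial>lborel)"
    using nn_integral_real_affine[of F "1 / c" 0] c by simp
  also have "\<dots> = ennreal (1 / c) * (\<integral>\<^sup>+ t. ennreal (c\<^sup>2) * (indicator {0<..} t * ennreal ((g t - l + (if t < c then t else l)) / t\<^sup>2)) \<partial>lborel)"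
  proof (rule arg_cong2[where f=times, OF refl], rule nn_integral_cong)
    fix t :: real
    have "(x / (t / c)\<^sup>2) = c\<^sup>2 * (x / t\<^sup>2)" for x using c by (simp add: power_divide)
    then have "F (t / c) = indicator {0<..} t * ennreal (c\<^sup>2 * ((g t - l + (if t < c then t else l)) / t\<^sup>2))"
      using c by (simp add: F_def indicator_def zero_less_divide_iff divide_less_eq cong: if_cong)
    then show "F (t / c)
      = ennreal (c\<^sup>2) * (indicator {0<..} t * ennreal ((g t - l + (if t < c then t else l)) / t\<^sup>2))"
      by (simp only: ennreal_mult'[OF zero_le_power2] mult.left_commute)
  qed
  also have "\<dots> = ennreal c * (\<integral>\<^sup>+ t. indicator {0<..} t * ennreal ((g t - l + (if t < c then t else l)) / t\<^sup>2) \<partial>lborel)"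
    using c by (subst nn_integral_cmult) (auto simp: power2_eq_square simp flip: mult.assoc ennreal_mult)
  also have "\<dots> \<le> ennreal c * (\<integral>\<^sup>+ t. indicator {0<..} t * ennreal ((max 0 (l - t) - l + (if t < c then t else l)) / t\<^sup>2)
      + (\<Sum>n. indicator {0<..} t * ennreal (max 0 (l - \<bar>t - real (Suc n)\<bar>) / t\<^sup>2)) \<partial>lborel)"
  proof (intro mult_left_mono nn_integral_mono)
    fix t :: real
    show "indicator {0<..} t * ennreal ((g t - l + (if t < c then t else l)) / t\<^sup>2)
      \<le> indicator {0<..} t * ennreal ((max 0 (l - t) - l + (if t < c then t else l)) / t\<^sup>2)
      + (\<Sum>n. indicator {0<..} t * ennreal (max 0 (l - \<bar>t - real (Suc n)\<bar>) / t\<^sup>2))"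
    proof (cases "0 < t")
      case True
      define k where "k = (if t < c then t else l) - l"
      have g0: "0 \<le> g t" "0 \<le> g t + k" "0 \<le> max 0 (l - t) + k"
        using g_ge[of t] nn[OF True] True by (auto simp: k_def g_def)
      have "ennreal ((g t + k) / t\<^sup>2) \<le> ennreal ((max 0 (l - t) + k) / t\<^sup>2) + tents t / ennreal (t\<^sup>2)"
      proof (cases "tents t")
        case (real a)
        then have "ennreal (g t) \<le> ennreal (max 0 (l - t) + a)"
          using g_le[of t] True by (simp add: ennreal_plus)
        then have "g t \<le> max 0 (l - t) + a" using real by (subst (asm) ennreal_le_iff) auto
        then have "(g t + k) / t\<^sup>2 \<le> (max 0 (l - t) + k) / t\<^sup>2 + a / t\<^sup>2"
          by (simp add: add_divide_distrib[symmetric] divide_right_mono)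
        then have "ennreal ((g t + k) / t\<^sup>2) \<le> ennreal ((max 0 (l - t) + k) / t\<^sup>2 + a / t\<^sup>2)"
          by (rule ennreal_leI)
        also have "\<dots> = ennreal ((max 0 (l - t) + k) / t\<^sup>2) + ennreal (a / t\<^sup>2)"
          using g0 real by (intro ennreal_plus) auto
        finally show ?thesis using True real by (simp add: divide_ennreal)
      next
        case top
        then show ?thesis using True by (simp add: ennreal_top_divide)
      qed
      moreover have "tents t / ennreal (t\<^sup>2) = (\<Sum>n. ennreal (max 0 (l - \<bar>t - real (Suc n)\<bar>) / t\<^sup>2))"
        unfolding tents_def using True
        by (subst ennreal_suminf_divide[symmetric]) (simp add: divide_ennreal)
      ultimately show ?thesis using True by (simp add: k_def algebra_simps)
    qed simp
  qed simp
  also have "\<dots> = ennreal c * (ennreal (ln (c / l) - 1 + l / c) + ennreal (- ln (sin (pi * l) / (pi * l))))"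
  proof -
    have "(\<integral>\<^sup>+ t. indicator {0<..} t * ennreal ((max 0 (l - t) - l + (if t < c then t else l)) / t\<^sup>2)
      + (\<Sum>n. indicator {0<..} t * ennreal (max 0 (l - \<bar>t - real (Suc n)\<bar>) / t\<^sup>2)) \<partial>lborel)
      = (\<integral>\<^sup>+ t. indicator {0<..} t * ennreal ((max 0 (l - t) - l + (if t < c then t else l)) / t\<^sup>2) \<partial>lborel)
      + (\<integral>\<^sup>+ t. (\<Sum>n. indicator {0<..} t * ennreal (max 0 (l - \<bar>t - real (Suc n)\<bar>) / t\<^sup>2)) \<partial>lborel)"
      by (rule nn_integral_add) measurable
    also have "(\<integral>\<^sup>+ t. (\<Sum>n. indicator {0<..} t * ennreal (max 0 (l - \<bar>t - real (Suc n)\<bar>) / t\<^sup>2)) \<partial>lborel)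
      = (\<Sum>n. \<integral>\<^sup>+ t. indicator {0<..} t * ennreal (max 0 (l - \<bar>t - real (Suc n)\<bar>) / t\<^sup>2) \<partial>lborel)"
      by (rule nn_integral_suminf) measurable
    also have "\<dots> = (\<Sum>n. ennreal (- ln (1 - l\<^sup>2 / (real (Suc n))\<^sup>2)))"
      using l by (intro arg_cong[where f=suminf] ext nn_integral_tent) auto
    also have "\<dots> = ennreal (- ln (sin (pi * l) / (pi * l)))"
      using l by (rule suminf_ln_sin_product)
    also have "(\<integral>\<^sup>+ t. indicator {0<..} t * ennreal ((max 0 (l - t) - l + (if t < c then t else l)) / t\<^sup>2) \<partial>lborel)
      = ennreal (ln (c / l) - 1 + l / c)"
      using l c by (intro nn_integral_first_tent)
    finally show ?thesis by simp
  qed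
  also have "\<dots> = ennreal (c * ((ln (c / l) - 1 + l / c) + - ln (sin (pi * l) / (pi * l))))"
  proof -
    have "ln (l / c) \<le> l / c - 1" using l c by (intro ln_le_minus_one) auto
    then have "0 \<le> ln (c / l) - 1 + l / c" using l c by (simp add: ln_div)
    moreover have "sin (pi * l) \<le> pi * l" using l by (intro sin_x_le_x) auto
    then have "ln (sin (pi * l) / (pi * l)) \<le> 0" using s l by (intro ln_le_zero_iff[THEN iffD2]) (auto simp: divide_le_eq)
    ultimately show ?thesis
      using c by (simp add: ennreal_plus[symmetric] ennreal_mult[symmetric] del: ennreal_plus)
  qed
  also have "c * ((ln (c / l) - 1 + l / c) + - ln (sin (pi * l) / (pi * l))) = c * ln c + (- 1 - ln (sin (pi * l) / pi)) * c + l"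
    using c l s by (simp add: ln_div ln_mult field_simps)
  finally show ?thesis .
qed

text \<open>The reflection \<open>x \<mapsto> l - x\<close> of a stripe reverses the shift.\<close>

lemma g_minus: "g (- t) = g t"
proof -
  define S where "S t = {x. 0 < x \<and> x < l \<and> (\<exists>j::int. of_int j < x + t \<and> x + t < of_int j + l)}" for t
  have S [measurable]: "S t \<in> sets borel" for t unfolding S_def by (rule slice_borel)
  have sub: "x \<in> S (- t)" if "l - x \<in> S t" for x t
  proof -
    from that obtain j :: int where "0 < x" "x < l" "of_int j < l - x + t" "l - x + t < of_int j + l"
      by (auto simp: S_def)
    then show ?thesis by (auto simp: S_def intro!: exI[of _ "- j"])
  qed
  have "l - x \<in> S t \<longleftrightarrow> x \<in> S (- t)" for x
    using sub[of x t] sub[of "l - x" "- t"] by auto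
  then have "emeasure lborel (S t) = emeasure lborel (S (- t))"
    using nn_integral_real_affine[of "indicator (S t)" "-1" l]
    by (simp add: indicator_def[abs_def] flip: nn_integral_indicator)
  then show ?thesis by (simp add: g_def S_def measure_def)
qed

lemma g_abs: "g \<bar>t\<bar> = g t"
  using g_minus[of t] by (simp add: abs_if)

text \<open>Supplies the hypothesis of \<open>has_bochner_integral_cos_ln_cos\<close>. It rests on
  \<open>sin x \<le> x\<close> at \<open>x = pi * l\<close> and on \<open>ln x \<le> x - 1\<close>
  at \<open>x = l / c\<close>.\<close>

lemma radial_bound_nonneg:
  assumes c: "0 \<le> c"
  shows "0 \<le> c * ln c + (- 1 - ln (sin (pi * l) / pi)) * c + l"
proof (cases "c = 0")
  case False
  with c have c: "0 < c" by simp
  have s: "0 < sin (pi * l)" using l by (intro sin_gt_zero) auto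
  have "sin (pi * l) \<le> pi * l" using l by (intro sin_x_le_x) auto
  then have "ln (sin (pi * l) / pi) \<le> ln l"
    using s l by (subst ln_le_cancel_iff) (auto simp: divide_le_eq mult.commute)
  moreover have "ln (l / c) \<le> l / c - 1" using l c by (intro ln_le_minus_one) auto
  then have "ln l \<le> ln c + l / c - 1" using l c by (simp add: ln_div)
  ultimately have "0 \<le> c * (ln c + (- 1 - ln (sin (pi * l) / pi)) + l / c)"
    using c by (intro mult_nonneg_nonneg) auto
  also have "\<dots> = c * ln c + (- 1 - ln (sin (pi * l) / pi)) * c + l"
    using c by (simp add: algebra_simps)
  finally show ?thesis .
qed (use l in simp)

text \<open>The renormalizing terms are distributed over the directions so that the integrand
  \<open>h\<close> is nonnegative; then radius and angle can be exchanged and every direction is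
  covered by \<open>radial_integral_le\<close>. The integral of \<open>cos x * ln (cos x)\<close>
  over a quarter turn is \<open>ln 2 - 1\<close>.\<close>

lemma renormalized_energy_le:
  "renormalized_energy \<le> ennreal (4 * (ln 2 - 2 - ln (sin (pi * l) / pi)) + 2 * pi * l)"
proof -
  define m where "m = - 1 - ln (sin (pi * l) / pi)"
  define h where "h r c = (g (r * c) - l + (if r < 1 then r * c else l)) / r\<^sup>2" for r c
  define \<Phi> where "\<Phi> c = (\<integral>\<^sup>+ r. indicator {0<..} r * ennreal (h r c) \<partial>lborel)" for c
  have [measurable]: "(\<lambda>(r, c). h r c) \<in> borel_measurable (borel \<Otimes>\<^sub>M borel)"
    unfolding h_def by measurable
  have [measurable]: "(\<lambda>x. h (f x) (k x)) \<in> borel_measurable M"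
    if "f \<in> borel_measurable M" "k \<in> borel_measurable M" for f k and M :: "'z measure"
    unfolding h_def using that by measurable
  have [measurable]: "\<Phi> \<in> borel_measurable borel"
    unfolding \<Phi>_def by measurable
  have angular: "ennreal ((profile r + (if r < 1 then 4 * r else 2 * pi * l)) / r\<^sup>2)
    = (\<integral>\<^sup>+ \<theta>. indicator {0..2 * pi} \<theta> * ennreal (h r \<bar>cos \<theta>\<bar>) \<partial>lborel)" if r: "0 < r" for r
  proof -
    have I1: "has_bochner_integral lborel (\<lambda>\<theta>. indicator {0..2 * pi} \<theta> * (C (polar r \<theta>) - C 0)) (profile r)"
      unfolding C_def profile_def by (rule has_bochner_integral_integrable[OF integrable_C])
    have I2: "has_bochner_integral lborel (\<lambda>\<theta>. indicator {0..2 * pi} \<theta> * (if r < 1 then r * \<bar>cos \<theta>\<bar> else l))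
      (if r < 1 then 4 * r else 2 * pi * l)"
    proof (cases "r < 1")
      case True
      then show ?thesis
        using has_bochner_integral_mult_right[OF has_bochner_integral_abs_cos, of r] by (simp add: mult_ac)
    next
      case False
      have "has_bochner_integral lborel (indicat_real {0..2 * pi}) (measure lborel {0..2 * pi})"
        by (rule has_bochner_integral_real_indicator) auto
      then show ?thesis
        using has_bochner_integral_mult_left[of l lborel "indicat_real {0..2 * pi}" "2 * pi"] False by simp
    qed
    have I: "has_bochner_integral lborel (\<lambda>\<theta>. indicator {0..2 * pi} \<theta> * h r \<bar>cos \<theta>\<bar>)
      ((profile r + (if r < 1 then 4 * r else 2 * pi * l)) / r\<^sup>2)"
    proof (rule has_bochner_integral_cong[THEN iffD1, OF _ _ _ has_bochner_integral_divide_zero[OF has_bochner_integral_add[OF I1 I2], of "r\<^sup>2"]])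
      fix \<theta>
      have "g (r * \<bar>cos \<theta>\<bar>) = C (polar r \<theta>)"
        using g_abs[of "r * cos \<theta>"] r by (simp add: C_eq abs_mult)
      then show "(indicator {0..2 * pi} \<theta> * (C (polar r \<theta>) - C 0)
          + indicator {0..2 * pi} \<theta> * (if r < 1 then r * \<bar>cos \<theta>\<bar> else l)) / r\<^sup>2
        = indicator {0..2 * pi} \<theta> * h r \<bar>cos \<theta>\<bar>"
        by (simp add: h_def C_0 indicator_def)
    qed simp_all
    have "0 \<le> h r \<bar>cos \<theta>\<bar>" for \<theta>
      using g_ge[of "r * \<bar>cos \<theta>\<bar>"] r C_bounds(1)[of "polar r \<theta>", folded C_def] g_abs[of "r * cos \<theta>"] by (simp add: h_def C_eq abs_mult)
    then have "(\<integral>\<^sup>+ \<theta>. ennreal (indicator {0..2 * pi} \<theta> * h r \<bar>cos \<theta>\<bar>) \<partial>lborel)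
      = ennreal ((profile r + (if r < 1 then 4 * r else 2 * pi * l)) / r\<^sup>2)"
      by (intro has_bochner_integral_imp_nn_integral[OF I]) auto
    moreover have "(\<integral>\<^sup>+ \<theta>. ennreal (indicator {0..2 * pi} \<theta> * h r \<bar>cos \<theta>\<bar>) \<partial>lborel)
      = (\<integral>\<^sup>+ \<theta>. indicator {0..2 * pi} \<theta> * ennreal (h r \<bar>cos \<theta>\<bar>) \<partial>lborel)"
      by (intro nn_integral_cong) (simp add: indicator_def)
    ultimately show ?thesis by simp
  qed
  have "renormalized_energy
    = (\<integral>\<^sup>+ r. indicator {0<..} r * (\<integral>\<^sup>+ \<theta>. indicator {0..2 * pi} \<theta> * ennreal (h r \<bar>cos \<theta>\<bar>) \<partial>lborel) \<partial>lborel)"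
    unfolding renormalized_energy_def
  proof (rule nn_integral_cong)
    fix r :: real
    show "indicator {0<..} r * ennreal ((profile r + (if r < 1 then 4 * r else 2 * pi * l)) / r\<^sup>2)
      = indicator {0<..} r * (\<integral>\<^sup>+ \<theta>. indicator {0..2 * pi} \<theta> * ennreal (h r \<bar>cos \<theta>\<bar>) \<partial>lborel)"
    proof (cases "0 < r")
      case True
      then show ?thesis by (simp only: angular)
    next
      case False
      then have "indicator {0<..} r = (0 :: ennreal)" by simp
      then show ?thesis by (simp only: mult_zero_left)
    qed
  qed
  also have "\<dots> = (\<integral>\<^sup>+ r. \<integral>\<^sup>+ \<theta>. indicator {0<..} r * (indicator {0..2 * pi} \<theta> * ennreal (h r \<bar>cos \<theta>\<bar>)) \<partial>lborel \<partial>lborel)"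
    by (intro nn_integral_cong nn_integral_cmult[symmetric]) measurable
  also have "\<dots> = (\<integral>\<^sup>+ \<theta>. \<integral>\<^sup>+ r. indicator {0<..} r * (indicator {0..2 * pi} \<theta> * ennreal (h r \<bar>cos \<theta>\<bar>)) \<partial>lborel \<partial>lborel)"
    by (rule lborel_pair.Fubini'[symmetric]) measurable
  also have "\<dots> = (\<integral>\<^sup>+ \<theta>. indicator {0..2 * pi} \<theta> * \<Phi> \<bar>cos \<theta>\<bar> \<partial>lborel)"
    unfolding \<Phi>_def by (intro nn_integral_cong) (subst nn_integral_cmult[symmetric], auto simp: mult_ac)
  also have "\<dots> = 4 * (\<integral>\<^sup>+ \<theta>. indicator {0..pi / 2} \<theta> * \<Phi> (cos \<theta>) \<partial>lborel)"
    by (rule nn_integral_abs_cos) measurable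
  also have "\<dots> \<le> 4 * (\<integral>\<^sup>+ \<theta>. ennreal (indicator {0..pi / 2} \<theta> * (cos \<theta> * ln (cos \<theta>) + m * cos \<theta> + l)) \<partial>lborel)"
  proof (intro mult_left_mono nn_integral_mono_AE, use AE_lborel_singleton[of "pi / 2"] in eventually_elim)
    fix \<theta> :: real assume "\<theta> \<noteq> pi / 2"
    show "indicator {0..pi / 2} \<theta> * \<Phi> (cos \<theta>)
      \<le> ennreal (indicator {0..pi / 2} \<theta> * (cos \<theta> * ln (cos \<theta>) + m * cos \<theta> + l))"
    proof (cases "\<theta> \<in> {0..pi / 2}")
      case True
      with \<open>\<theta> \<noteq> pi / 2\<close> have "0 < cos \<theta>" by (intro cos_gt_zero_pi) auto
      then have "\<Phi> (cos \<theta>) \<le> ennreal (cos \<theta> * ln (cos \<theta>) + m * cos \<theta> + l)"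
        unfolding \<Phi>_def h_def m_def by (intro radial_integral_le) auto
      then show ?thesis using True by simp
    qed simp
  qed simp
  also have "(\<integral>\<^sup>+ \<theta>. ennreal (indicator {0..pi / 2} \<theta> * (cos \<theta> * ln (cos \<theta>) + m * cos \<theta> + l)) \<partial>lborel)
    = ennreal (ln 2 - 1 + m + l * pi / 2)"
  proof (rule has_bochner_integral_imp_nn_integral)
    have nn: "0 \<le> cos \<theta> * ln (cos \<theta>) + m * cos \<theta> + l" if "0 \<le> \<theta>" "\<theta> \<le> pi / 2" for \<theta>
      unfolding m_def using that by (intro radial_bound_nonneg cos_ge_zero) auto
    then show "has_bochner_integral lborel (\<lambda>\<theta>. indicator {0..pi / 2} \<theta> * (cos \<theta> * ln (cos \<theta>) + m * cos \<theta> + l))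
      (ln 2 - 1 + m + l * pi / 2)"
      by (rule has_bochner_integral_cos_ln_cos)
    show "0 \<le> indicator {0..pi / 2} \<theta> * (cos \<theta> * ln (cos \<theta>) + m * cos \<theta> + l)" for \<theta>
      using nn[of \<theta>] by (simp add: indicator_def)
  qed
  also have "4 * ennreal (ln 2 - 1 + m + l * pi / 2) = ennreal (4 * (ln 2 - 1 + m + l * pi / 2))"
    using ennreal_mult'[of 4 "ln 2 - 1 + m + l * pi / 2"] by simp
  also have "4 * (ln 2 - 1 + m + l * pi / 2) = 4 * (ln 2 - 2 - ln (sin (pi * l) / pi)) + 2 * pi * l"
    by (simp add: m_def algebra_simps)
  finally show ?thesis .
qed

lemma indicat_stripes_scaled:
  assumes "0 < s"
  shows "indicat_real (stripes (s * l) (s * (1 - l))) = (\<lambda>x. indicat_real (stripes l (1 - l)) (x /\<^sub>R s))"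
proof -
  have "x \<in> stripes (s * l) (s * (1 - l)) \<longleftrightarrow> x /\<^sub>R s \<in> stripes l (1 - l)" for x
  proof -
    have "of_int j * (s * l + s * (1 - l)) < x $ 1 \<and> x $ 1 < of_int j * (s * l + s * (1 - l)) + s * l
      \<longleftrightarrow> of_int j < x $ 1 / s \<and> x $ 1 / s < of_int j + l" for j :: int
      using assms by (simp add: less_divide_eq divide_less_eq algebra_simps)
    then show ?thesis by (simp add: stripes_def divide_inverse mult.commute)
  qed
  then show ?thesis by (auto simp: indicator_def)
qed

text \<open>The volume fraction determines the stripes up to scaling, so this is
  \<open>least_energy_scaled\<close> with \<open>d = 4\<close>. The summand
  \<open>2 * pi * l\<close> of the energy bound cancels against \<open>K\<close>, and the logarithm
  of the sine comes out of the exponential.\<close>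

lemma e_S_le: "e_S l \<le> ereal (- (2 * exp 1 / pi * sin (pi * l)))"
proof -
  let ?L = "ln (sin (pi * l) / pi)"
  have s: "0 < sin (pi * l)" using l by (intro sin_gt_zero) auto
  have "(\<exists>d0 d1. 0 < d0 \<and> 0 < d1 \<and> l = d0 / (d0 + d1) \<and> e = energy (indicat_real (stripes d0 d1)))
    \<longleftrightarrow> (\<exists>s>0. e = energy (\<lambda>x. indicat_real (stripes l (1 - l)) (x /\<^sub>R s)))" for e
  proof
    assume "\<exists>d0 d1. 0 < d0 \<and> 0 < d1 \<and> l = d0 / (d0 + d1) \<and> e = energy (indicat_real (stripes d0 d1))"
    then obtain d0 d1 where d: "0 < d0" "0 < d1" "l = d0 / (d0 + d1)" "e = energy (indicat_real (stripes d0 d1))" by blast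
    then have "d0 = (d0 + d1) * l" by simp
    then have "d0 = (d0 + d1) * l" "d1 = (d0 + d1) * (1 - l)" by (auto simp: algebra_simps)
    then have "e = energy (\<lambda>x. indicat_real (stripes l (1 - l)) (x /\<^sub>R (d0 + d1)))"
      using d indicat_stripes_scaled[of "d0 + d1"] by simp
    then show "\<exists>s>0. e = energy (\<lambda>x. indicat_real (stripes l (1 - l)) (x /\<^sub>R s))"
      using d by (intro exI[of _ "d0 + d1"]) auto
  next
    assume "\<exists>s>0. e = energy (\<lambda>x. indicat_real (stripes l (1 - l)) (x /\<^sub>R s))"
    then obtain s where "0 < s" "e = energy (\<lambda>x. indicat_real (stripes l (1 - l)) (x /\<^sub>R s))" by blast
    then show "\<exists>d0 d1. 0 < d0 \<and> 0 < d1 \<and> l = d0 / (d0 + d1) \<and> e = energy (indicat_real (stripes d0 d1))"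
      using l indicat_stripes_scaled[of s]
      by (intro exI[of _ "s * l"] exI[of _ "s * (1 - l)"]) (auto simp: distrib_left[symmetric])
  qed
  then have "e_S l = (LEAST e. \<exists>s>0. e = energy (\<lambda>x. indicat_real (stripes l (1 - l)) (x /\<^sub>R s)))"
    unfolding e_S_def by simp
  also have "\<dots> = ereal (- 4 * exp (- 1 - (enn2real renormalized_energy - 2 * pi * l) / 4))"
    using least_energy_scaled renormalized_energy_le by (auto simp: top_unique)
  also have "\<dots> \<le> ereal (- (2 * exp 1 / pi * sin (pi * l)))"
  proof -
    \<comment> \<open>The real upper bound has to be nonnegative before it can be compared with
      \<open>enn2real renormalized_energy\<close>. The estimates used here bound it below by
      \<open>4 * (ln pi - 1)\<close>.\<close>
    have "sin (pi * l) \<le> pi * l" using l by (intro sin_x_le_x) auto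
    then have "?L \<le> ln l"
      using s l by (subst ln_le_cancel_iff) (auto simp: divide_le_eq mult.commute)
    moreover have "ln (l * pi / 2) \<le> l * pi / 2 - 1" using l by (intro ln_le_minus_one) auto
    then have "ln l + ln pi - ln 2 \<le> l * pi / 2 - 1" using l by (simp add: ln_div ln_mult)
    moreover have "1 \<le> ln pi" using exp_le pi_gt3 by (subst ln_ge_iff) auto
    ultimately have "0 \<le> ln 2 - 2 - ?L + l * pi / 2" by linarith
    then have "0 \<le> 4 * (ln 2 - 2 - ?L + l * pi / 2)" by (rule mult_nonneg_nonneg[rotated]) simp
    also have "4 * (ln 2 - 2 - ?L + l * pi / 2) = 4 * (ln 2 - 2 - ?L) + 2 * pi * l"
      by (simp add: algebra_simps)
    finally have "0 \<le> 4 * (ln 2 - 2 - ?L) + 2 * pi * l" .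
    then have "enn2real renormalized_energy \<le> 4 * (ln 2 - 2 - ?L) + 2 * pi * l"
      using renormalized_energy_le by (intro enn2real_leI)
    then have "1 - ln 2 + ?L \<le> - 1 - (enn2real renormalized_energy - 2 * pi * l) / 4"
      by (simp add: field_simps)
    then have "exp (1 - ln 2 + ?L) \<le> exp (- 1 - (enn2real renormalized_energy - 2 * pi * l) / 4)"
      by simp
    moreover have "exp (1 - ln 2 + ?L) = exp 1 * sin (pi * l) / (2 * pi)"
      using s by (simp add: exp_add exp_diff)
    ultimately show ?thesis by simp
  qed
  finally show ?thesis .
qed

end

section \<open>Comparison\<close>

lemma lattice_basis_scaled:
  assumes "lattice_basis \<Lambda> v w" "0 < t"
  shows "lattice_basis ((\<lambda>x. t *\<^sub>R x) ` \<Lambda>) (t *\<^sub>R v) (t *\<^sub>R w)"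
proof -
  have "linear (\<lambda>x. t *\<^sub>R x :: real^2)" by (rule bounded_linear.linear[OF bounded_linear_scaleR_right])
  then have "independent ((\<lambda>x. t *\<^sub>R x) ` {v, w})"
    using assms by (intro linear_independent_injective_image) (auto simp: lattice_basis_def inj_on_def)
  moreover have "(\<lambda>x. t *\<^sub>R x) ` {of_int m *\<^sub>R v + of_int n *\<^sub>R w | m n :: int. True}
    = {of_int m *\<^sub>R (t *\<^sub>R v) + of_int n *\<^sub>R (t *\<^sub>R w) | m n :: int. True}"
    (is "?A = ?B")
  proof -
    have "t *\<^sub>R (of_int m *\<^sub>R v + of_int n *\<^sub>R w) = of_int m *\<^sub>R (t *\<^sub>R v) + of_int n *\<^sub>R (t *\<^sub>R w)" for m n :: int
      by (simp add: scaleR_add_right mult.commute)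
    moreover have "?A = {t *\<^sub>R (of_int m *\<^sub>R v + of_int n *\<^sub>R w) | m n :: int. True}" by blast
    ultimately show ?thesis by simp
  qed
  ultimately show ?thesis using assms by (simp add: lattice_basis_def)
qed

lemma cell_area_scaled:
  assumes "bravais_lattice \<Lambda>" "0 < t"
  shows "cell_area ((\<lambda>x. t *\<^sub>R x) ` \<Lambda>) = t\<^sup>2 * cell_area \<Lambda>"
proof -
  obtain v w where vw: "lattice_basis \<Lambda> v w" using assms by (auto simp: bravais_lattice_def)
  interpret planar_lattice \<Lambda> v w by unfold_locales (rule vw)
  interpret scaled: planar_lattice "(\<lambda>x. t *\<^sub>R x) ` \<Lambda>" "t *\<^sub>R v" "t *\<^sub>R w"
    by unfold_locales (rule lattice_basis_scaled[OF vw \<open>0 < t\<close>])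
  have "periodicity_cell (t *\<^sub>R v) (t *\<^sub>R w) = (\<lambda>x. t *\<^sub>R x + 0) ` periodicity_cell v w"
  proof -
    have "t *\<^sub>R (a *\<^sub>R v + b *\<^sub>R w) + 0 = a *\<^sub>R (t *\<^sub>R v) + b *\<^sub>R (t *\<^sub>R w)" for a b
      by (simp add: scaleR_add_right mult.commute)
    moreover have "(\<lambda>x. t *\<^sub>R x + 0) ` periodicity_cell v w
      = {t *\<^sub>R (a *\<^sub>R v + b *\<^sub>R w) + 0 | a b. 0 \<le> a \<and> a < 1 \<and> 0 \<le> b \<and> b < 1}"
      unfolding periodicity_cell_def by blast
    ultimately show ?thesis by (simp only: periodicity_cell_def)
  qed
  then have "measure lebesgue scaled.cell = t\<^sup>2 * measure lebesgue cell"
    using measure_lebesgue_affine[of t 0 cell] \<open>0 < t\<close> by simp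
  then have "measure lborel scaled.cell = t\<^sup>2 * measure lborel cell"
    using cell_borel scaled.cell_borel by simp
  then show ?thesis
    by (simp only: cell_area_eq[OF vw] cell_area_eq[OF scaled.basis])
qed

lemma admissible_radius_scaled:
  assumes "0 < s"
  shows "admissible_radius ((\<lambda>x. s *\<^sub>R x) ` \<Lambda>) (s * \<rho>) \<longleftrightarrow> admissible_radius \<Lambda> \<rho>"
proof -
  have "dist (s *\<^sub>R p) (s *\<^sub>R q) = s * dist p q" for p q :: "real^2"
    using assms by (simp add: dist_norm flip: scaleR_diff_right)
  then have "s * \<rho> \<le> dist (s *\<^sub>R p) (s *\<^sub>R q) / 2 \<longleftrightarrow> \<rho> \<le> dist p q / 2" for p q :: "real^2"
    using assms by simp
  then show ?thesis
    using assms by (simp add: admissible_radius_def zero_less_mult_iff)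
qed

lemma indicat_balls_scaled:
  assumes "0 < s"
  shows "indicat_real (balls ((\<lambda>x. s *\<^sub>R x) ` \<Lambda>) (s * \<rho>)) = (\<lambda>x. indicat_real (balls \<Lambda> \<rho>) (x /\<^sub>R s))"
proof -
  have "x \<in> balls ((\<lambda>x. s *\<^sub>R x) ` \<Lambda>) (s * \<rho>) \<longleftrightarrow> x /\<^sub>R s \<in> balls \<Lambda> \<rho>" for x
  proof -
    have "dist (s *\<^sub>R q) x = s * dist q (x /\<^sub>R s)" for q
    proof -
      have "s *\<^sub>R q - x = s *\<^sub>R (q - x /\<^sub>R s)" using assms by (simp add: scaleR_diff_right)
      then show ?thesis using assms by (simp add: dist_norm)
    qed
    then show ?thesis using assms by (simp add: balls_def)
  qed
  then show ?thesis by (auto simp: indicator_def)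
qed

text \<open>Lattice shape and volume fraction fix the ratio of radius to lattice constant, so all
  competitors are dilations of one configuration with radius \<open>1/2\<close>. Whether that one is
  admissible decides if the volume fraction is attainable.\<close>

lemma ball_energies_eq:
  assumes "bravais_lattice \<Lambda>0" "cell_area \<Lambda>0 = 1" "0 < \<nu>"
  defines "\<Lambda>1 \<equiv> (\<lambda>x. (1 / (2 * sqrt (\<nu> / pi))) *\<^sub>R x) ` \<Lambda>0"
  shows "ball_energies \<Lambda>0 \<nu> = {e. admissible_radius \<Lambda>1 (1/2) \<and>
    (\<exists>s>0. e = energy (\<lambda>x. indicat_real (balls \<Lambda>1 (1/2)) (x /\<^sub>R s)))}"
proof -
  \<comment> \<open>The radius of the balls when the cell has area 1; dividing the lattice by
    \<open>2 * k\<close> makes it \<open>1/2\<close>.\<close>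
  define k where "k = sqrt (\<nu> / pi)"
  have k: "0 < k" "k\<^sup>2 = \<nu> / pi" using assms by (auto simp: k_def)
  have \<Lambda>1: "(\<lambda>x. s *\<^sub>R x) ` \<Lambda>1 = (\<lambda>x. (s / (2 * k)) *\<^sub>R x) ` \<Lambda>0" for s
    unfolding \<Lambda>1_def k_def[symmetric] image_image by simp
  have fraction: "\<nu> = measure lborel (ball 0 \<rho> :: (real^2) set) / cell_area ((\<lambda>x. a *\<^sub>R x) ` \<Lambda>0) \<longleftrightarrow> a = 2 * \<rho> / (2 * k)"
    if "0 < a" "0 < \<rho>" for a \<rho>
  proof -
    have "measure lborel (ball 0 \<rho> :: (real^2) set) = pi * \<rho>\<^sup>2"
      using that by (simp add: measure_def emeasure_ball_vec2)
    then have "\<nu> = measure lborel (ball 0 \<rho> :: (real^2) set) / cell_area ((\<lambda>x. a *\<^sub>R x) ` \<Lambda>0) \<longleftrightarrow> \<nu> = pi * \<rho>\<^sup>2 / a\<^sup>2"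
      using cell_area_scaled[OF assms(1) that(1)] assms(2) by simp
    also have "\<dots> \<longleftrightarrow> (a * k)\<^sup>2 = \<rho>\<^sup>2"
      using that by (auto simp: k power_mult_distrib field_simps)
    also have "\<dots> \<longleftrightarrow> a * k = \<rho>"
      using that k by (simp add: power2_eq_iff_nonneg)
    also have "\<dots> \<longleftrightarrow> a = 2 * \<rho> / (2 * k)"
      using k by (simp add: field_simps)
    finally show ?thesis .
  qed
  show ?thesis
  proof (intro set_eqI iffI)
    fix e assume "e \<in> ball_energies \<Lambda>0 \<nu>"
    then obtain a \<rho> where *: "0 < a" "admissible_radius ((\<lambda>x. a *\<^sub>R x) ` \<Lambda>0) \<rho>"
      "\<nu> = measure lborel (ball 0 \<rho> :: (real^2) set) / cell_area ((\<lambda>x. a *\<^sub>R x) ` \<Lambda>0)"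
      "e = energy (indicat_real (balls ((\<lambda>x. a *\<^sub>R x) ` \<Lambda>0) \<rho>))"
      unfolding ball_energies_def by blast
    then have "0 < \<rho>" by (simp add: admissible_radius_def)
    then have a: "a = 2 * \<rho> / (2 * k)" using fraction * by blast
    then have eq: "(\<lambda>x. a *\<^sub>R x) ` \<Lambda>0 = (\<lambda>x. (2 * \<rho>) *\<^sub>R x) ` \<Lambda>1" "\<rho> = (2 * \<rho>) * (1 / 2)"
      by (simp_all only: \<Lambda>1)
    have s: "0 < 2 * \<rho>" using \<open>0 < \<rho>\<close> by simp
    have "admissible_radius \<Lambda>1 (1/2)"
      using *(2) admissible_radius_scaled[OF s] eq by metis
    moreover have "e = energy (\<lambda>x. indicat_real (balls \<Lambda>1 (1/2)) (x /\<^sub>R (2 * \<rho>)))"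
      using *(4) indicat_balls_scaled[OF s] eq by metis
    ultimately show "e \<in> {e. admissible_radius \<Lambda>1 (1/2) \<and>
      (\<exists>s>0. e = energy (\<lambda>x. indicat_real (balls \<Lambda>1 (1/2)) (x /\<^sub>R s)))}"
      using s by blast
  next
    fix e assume "e \<in> {e. admissible_radius \<Lambda>1 (1/2) \<and>
      (\<exists>s>0. e = energy (\<lambda>x. indicat_real (balls \<Lambda>1 (1/2)) (x /\<^sub>R s)))}"
    then obtain s where s: "0 < s" and adm: "admissible_radius \<Lambda>1 (1/2)"
      and e: "e = energy (\<lambda>x. indicat_real (balls \<Lambda>1 (1/2)) (x /\<^sub>R s))" by blast
    define a where "a = s / (2 * k)"
    have a: "0 < a" "a = 2 * (s * (1 / 2)) / (2 * k)" using s k by (auto simp: a_def)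
    have "\<nu> = measure lborel (ball 0 (s * (1 / 2)) :: (real^2) set) / cell_area ((\<lambda>x. a *\<^sub>R x) ` \<Lambda>0)"
      using fraction[of a "s * (1 / 2)"] a s by simp
    moreover have "admissible_radius ((\<lambda>x. a *\<^sub>R x) ` \<Lambda>0) (s * (1 / 2))"
      using admissible_radius_scaled[OF s] adm unfolding a_def \<Lambda>1[symmetric] by blast
    moreover have "e = energy (indicat_real (balls ((\<lambda>x. a *\<^sub>R x) ` \<Lambda>0) (s * (1 / 2))))"
      unfolding e indicat_balls_scaled[OF s, symmetric] a_def \<Lambda>1 ..
    ultimately show "e \<in> ball_energies \<Lambda>0 \<nu>"
      unfolding ball_energies_def using a(1) by blast
  qed
qed

text \<open>If the rescaled lattice does not admit radius \<open>1/2\<close>, then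
  \<open>e_B\<close> is infinite by definition. Otherwise \<open>renormalized_energy_ge\<close> is
  inserted into \<open>least_energy_scaled\<close> with \<open>d = 8 * \<nu>\<close>; the number
  \<open>pi / 4\<close> is \<open>K / d\<close>.\<close>

lemma e_B_ge:
  assumes \<Lambda>0: "bravais_lattice \<Lambda>0" "cell_area \<Lambda>0 = 1" and \<nu>: "0 < \<nu>" "0 \<le> interaction_bound \<nu>"
  shows "ereal (- (8 * \<nu> * exp (- 1 - (1 / 12 + 1 / 160 + 1 / 672) + pi / 4 - interaction_bound \<nu> / (8 * \<nu>)))) \<le> e_B \<Lambda>0 \<nu>"
proof -
  define t where "t = 1 / (2 * sqrt (\<nu> / pi))"
  define \<Lambda>1 where "\<Lambda>1 = (\<lambda>x. t *\<^sub>R x) ` \<Lambda>0"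
  have t: "0 < t" "t\<^sup>2 = pi / 4 / \<nu>"
    using \<nu> by (auto simp: t_def power_divide power_mult_distrib)
  have energies: "ball_energies \<Lambda>0 \<nu> = {e. admissible_radius \<Lambda>1 (1/2) \<and>
    (\<exists>s>0. e = energy (\<lambda>x. indicat_real (balls \<Lambda>1 (1/2)) (x /\<^sub>R s)))}"
    unfolding \<Lambda>1_def t_def using \<Lambda>0 \<nu>(1) by (rule ball_energies_eq)
  show ?thesis
  proof (cases "admissible_radius \<Lambda>1 (1/2)")
    case False
    then have "ball_energies \<Lambda>0 \<nu> = {}" using energies by simp
    then show ?thesis by (simp add: e_B_def)
  next
    case True
    obtain v w where vw: "lattice_basis \<Lambda>0 v w" using \<Lambda>0 by (auto simp: bravais_lattice_def)
    interpret ball_lattice \<Lambda>1 "t *\<^sub>R v" "t *\<^sub>R w"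
      using lattice_basis_scaled[OF vw t(1)] True by unfold_locales (simp_all add: \<Lambda>1_def)
    have "covol = t\<^sup>2"
      using cell_area_scaled[OF \<Lambda>0(1) t(1)] \<Lambda>0(2) cell_area_eq[OF basis] by (simp add: \<Lambda>1_def)
    then have vf: "vf = \<nu>" using \<nu> t by (simp add: vf_def)
    have "ball_energies \<Lambda>0 \<nu> = {e. \<exists>s>0. e = energy (\<lambda>x. indicat_real (balls \<Lambda>1 (1/2)) (x /\<^sub>R s))}"
      using energies True by simp
    moreover from this have "energy (\<lambda>x. indicat_real (balls \<Lambda>1 (1/2)) (x /\<^sub>R 1)) \<in> ball_energies \<Lambda>0 \<nu>"
      using zero_less_one by blast
    then have "ball_energies \<Lambda>0 \<nu> \<noteq> {}" by blast
    ultimately have "e_B \<Lambda>0 \<nu> = (LEAST e. \<exists>s>0. e = energy (\<lambda>x. indicat_real (balls \<Lambda>1 (1/2)) (x /\<^sub>R s)))"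
      by (simp only: e_B_def if_False mem_Collect_eq)
    also have "\<dots> = (if renormalized_energy = \<infinity> then \<infinity>
       else ereal (- (8 * \<nu>) * exp (- 1 - (enn2real renormalized_energy - 2 * pi * \<nu>) / (8 * \<nu>))))"
      using least_energy_scaled unfolding vf .
    also have "\<dots> \<ge> ereal (- (8 * \<nu> * exp (- 1 - (1 / 12 + 1 / 160 + 1 / 672) + pi / 4 - interaction_bound \<nu> / (8 * \<nu>))))"
    proof (cases "renormalized_energy = \<infinity>")
      case False
      define J where "J = enn2real renormalized_energy"
      have "ennreal (8 * \<nu> * (1 / 12 + 1 / 160 + 1 / 672) + interaction_bound \<nu>) \<le> ennreal J"
        using renormalized_energy_ge \<nu>(2) False unfolding vf J_def by (simp add: less_top)
      then have "8 * \<nu> * (1 / 12 + 1 / 160 + 1 / 672) + interaction_bound \<nu> \<le> J"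
        by (subst (asm) ennreal_le_iff) (auto simp: J_def)
      then have "(8 * \<nu> * (1 / 12 + 1 / 160 + 1 / 672) + interaction_bound \<nu> - 2 * pi * \<nu>) / (8 * \<nu>)
          \<le> (J - 2 * pi * \<nu>) / (8 * \<nu>)"
        using \<nu> by (intro divide_right_mono) auto
      moreover have "(8 * \<nu> * (1 / 12 + 1 / 160 + 1 / 672) + interaction_bound \<nu> - 2 * pi * \<nu>) / (8 * \<nu>)
          = (1 / 12 + 1 / 160 + 1 / 672) + interaction_bound \<nu> / (8 * \<nu>) - pi / 4"
        using \<nu> by (simp add: add_divide_distrib diff_divide_distrib)
      ultimately have "- 1 - (J - 2 * pi * \<nu>) / (8 * \<nu>)
          \<le> - 1 - (1 / 12 + 1 / 160 + 1 / 672) + pi / 4 - interaction_bound \<nu> / (8 * \<nu>)"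
        by linarith
      then show ?thesis
        using \<nu> False by (simp add: J_def)
    qed simp
    finally show ?thesis .
  qed
qed

section \<open>The numerical comparison at volume fraction \<open>1/2\<close>, and its extension to
  a neighbourhood\<close>

lemma interaction_bound_half: "2.147 \<le> interaction_bound (1 / 2)"
proof -
  \<comment> \<open>The value is about 2.149, so these digits of \<open>pi\<close> leave room;
    anything above about 2.129 would do below.\<close>
  have pi: "3.14159 \<le> pi" "pi \<le> 3.1416" using pi_approx by simp_all
  then have "pi\<^sup>2 \<le> 3.1416\<^sup>2" by (intro power_mono) auto
  then show ?thesis
    using pi by (simp add: interaction_bound_def tail_pow_def power_divide field_simps)
qed

text \<open>After division the claim is \<open>2 * pi < exp x\<close>, where \<open>x\<close> is at
  least 1.842 and \<open>ln (2 * pi)\<close> is about 1.838.\<close>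

lemma stripes_beat_balls_half:
  "8 * (1 / 2) * exp (- 1 - (1 / 12 + 1 / 160 + 1 / 672) + pi / 4 - interaction_bound (1 / 2) / (8 * (1 / 2)))
    < 2 * exp 1 / pi * sin (pi * (1 / 2))"
proof -
  define x where "x = 2 + (1 / 12 + 1 / 160 + 1 / 672) - pi / 4 + interaction_bound (1 / 2) / 4"
  have pi: "pi \<le> 3.1416" using pi_approx by simp
  then have x: "1.842 \<le> x" using interaction_bound_half by (simp add: x_def)
  \<comment> \<open>The exponential is estimated by the 32nd power of a quadratic Taylor polynomial:
    \<open>1.0592\<close> lies just below its value at \<open>1.842 / 32\<close>, and its 32nd power
    is about 6.30, still above \<open>2 * pi\<close>.\<close>
  have "2 * pi < 1.0592 ^ 32" using pi by (rule_tac le_less_trans[of _ "2 * 3.1416"]) (auto simp: power_divide)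
  also have "\<dots> \<le> exp (1.842 / 32) ^ 32"
    using exp_lower_Taylor_quadratic[of "1.842 / 32"] by (intro power_mono) (auto simp: power2_eq_square)
  also have "\<dots> = exp (1.842 :: real)" by (simp flip: exp_of_nat_mult)
  also have "\<dots> \<le> exp x" using x by simp
  finally have "2 * pi * exp (- x) < 1" by (simp add: exp_minus field_simps)
  then have "4 * (exp 1 * exp (- x)) < 2 * exp 1 / pi"
    by (simp add: field_simps)
  moreover have "exp 1 * exp (- x) = exp (- 1 - (1 / 12 + 1 / 160 + 1 / 672) + pi / 4 - interaction_bound (1 / 2) / 4)"
    unfolding exp_add[symmetric] by (rule arg_cong[where f=exp]) (simp add: x_def)
  ultimately show ?thesis by simp
qed

lemma isCont_interaction_bound: "isCont interaction_bound \<nu>"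
proof -
  have "continuous_on UNIV interaction_bound"
    unfolding interaction_bound_def[abs_def] tail_pow_def by (intro continuous_intros) auto
  then show ?thesis by (simp add: continuous_on_eq_continuous_at)
qed

theorem proposition1p4:
  shows "\<exists>c0>0. \<forall>vf::real. \<bar>vf - 1/2\<bar> < c0 \<longrightarrow>
           (\<forall>\<Lambda>0. bravais_lattice \<Lambda>0 \<and> cell_area \<Lambda>0 = 1 \<longrightarrow> e_S vf < e_B \<Lambda>0 vf)"
proof -
  \<comment> \<open>The upper bound for \<open>e_S\<close> minus the lower bound for
    \<open>e_B\<close>. No lattice occurs in it, which is what makes the neighbourhood
    uniform.\<close>
  define \<Psi> where "\<Psi> \<nu> = 8 * \<nu> * exp (- 1 - (1 / 12 + 1 / 160 + 1 / 672) + pi / 4 - interaction_bound \<nu> / (8 * \<nu>))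
      - 2 * exp 1 / pi * sin (pi * \<nu>)" for \<nu>
  have "isCont \<Psi> (1 / 2)"
    unfolding \<Psi>_def by (rule continuous_intros isCont_interaction_bound | simp)+
  then have "(\<Psi> \<longlongrightarrow> \<Psi> (1 / 2)) (nhds (1 / 2))"
    by (simp only: isCont_def tendsto_at_iff_tendsto_nhds)
  moreover have "\<Psi> (1 / 2) < 0"
    using stripes_beat_balls_half by (simp only: \<Psi>_def diff_less_0_iff_less)
  ultimately have "eventually (\<lambda>\<nu>. \<Psi> \<nu> < 0) (nhds (1 / 2))"
    by (rule order_tendstoD(2))
  moreover have "(interaction_bound \<longlongrightarrow> interaction_bound (1 / 2)) (nhds (1 / 2))"
    using isCont_interaction_bound by (simp only: isCont_def tendsto_at_iff_tendsto_nhds)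
  then have "eventually (\<lambda>\<nu>. 0 < interaction_bound \<nu>) (nhds (1 / 2))"
    by (rule order_tendstoD(1)) (use interaction_bound_half in simp)
  ultimately have "eventually (\<lambda>\<nu>. \<Psi> \<nu> < 0 \<and> 0 < interaction_bound \<nu>) (nhds (1 / 2))"
    by (rule eventually_conj)
  \<comment> \<open>Positivity of \<open>interaction_bound\<close> is carried along because
    \<open>e_B_ge\<close> requires its nonnegativity: as an \<open>ennreal\<close>, a negative value
    would be cut off at 0.\<close>
  then obtain c where c: "0 < c" "\<And>\<nu>. dist \<nu> (1 / 2) < c \<Longrightarrow> \<Psi> \<nu> < 0 \<and> 0 < interaction_bound \<nu>"
    unfolding eventually_nhds_metric by blast
  show ?thesis
  \<comment> \<open>The cap \<open>1 / 2\<close> keeps the volume fraction strictly between 0 and 1,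
    as \<open>stripe_pattern\<close> demands.\<close>
  proof (intro exI[of _ "min c (1 / 2)"] conjI allI impI)
    show "0 < min c (1 / 2)" using c by simp
    fix vf :: real and \<Lambda>0
    assume near: "\<bar>vf - 1/2\<bar> < min c (1 / 2)" and \<Lambda>0: "bravais_lattice \<Lambda>0 \<and> cell_area \<Lambda>0 = 1"
    have "\<bar>vf - 1/2\<bar> < 1/2" using near by simp
    then have vf: "0 < vf" "vf < 1" by linarith+
    have *: "\<Psi> vf < 0" "0 < interaction_bound vf" using c(2)[of vf] near by (auto simp: dist_real_def)
    interpret stripe_pattern vf using vf by unfold_locales
    note e_S_le
    also have "ereal (- (2 * exp 1 / pi * sin (pi * vf)))
      < ereal (- (8 * vf * exp (- 1 - (1 / 12 + 1 / 160 + 1 / 672) + pi / 4 - interaction_bound vf / (8 * vf))))"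
      using *(1) by (simp add: \<Psi>_def)
    also have "\<dots> \<le> e_B \<Lambda>0 vf"
      using \<Lambda>0 vf *(2) by (intro e_B_ge) auto
    finally show "e_S vf < e_B \<Lambda>0 vf" .
  qed
qed

end
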